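(* A connected cubic graph $G$ satisfies $\alpha(G)=\frac{3}{5}\,\mathrm{diss}(G)$ if and only if $G\in\bigcup_{k\in\mathbb{N}}\mathcal{G}_k$ (where $\mathbb{N}$ is the set of positive integers).
   Context: All graphs are finite; $\alpha(G)$ is the independence number; a set $D$ of vertices is a dissociation set if the induced subgraph $G[D]$ has maximum degree at most $1$, and $\mathrm{diss}(G)$ is the maximum order of a dissociation set. Let $K_4^*$ be the graph obtained from $K_4$ with vertices $a,b,c,d$ by subdividing the edge $ab$ twice, i.e. replacing $ab$ by a path $a\,x\,y\,b$ with new vertices $x,y$ (the subdivision vertices). For a positive integer $k$, $\mathcal{H}_k$ is the set of all connected multigraphs $H$ (parallel edges allowed, no loops) of maximum degree at most $3$ such that: (i) $3n_1+2n_2+n_3=6k$, where $n_i$ is the number of vertices of degree $i$ (degree = number of incident edges); (ii) $H$ has an induced matching $M$ with $|M|=k$ covering all vertices of degree $1$; (iii) $H-M$ has an orientation in which every vertex of $H$ not incident with an edge of $M$ has exactly two outgoing edges. $\mathcal{G}_k$ is the set of all graphs $G$ obtained from some $H\in\mathcal{H}_k$ by replacing each vertex $w$ of $H$ by a gadget $G_w$ with designated attachment vertices, one per edge of $H$ at $w$, and replacing each edge $ww'$ of $H$ by an edge joining the attachment vertex of $G_w$ assigned to this edge with the attachment vertex of $G_{w'}$ assigned to this edge (distinct edges of $H$ use distinct attachment vertices). The gadgets are: if $\deg_H(w)=3$, $G_w$ is a triangle and each of its three vertices is the attachment vertex for one of the three edges at $w$; if $\deg_H(w)=2$, $G_w$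 is a copy of $K_4^*$ whose two subdivision vertices $x,y$ are the attachment vertices for the two edges at $w$; if $\deg_H(w)=1$, $G_w$ is one of the following two graphs on $9$ vertices $z,a_1,a_2,p_1,q_1,r_1,p_2,q_2,r_2$, with $z$ the attachment vertex: both have edges $za_1$, $za_2$, the triangles $p_1q_1r_1$ and $p_2q_2r_2$, and the edge $r_1r_2$; the first additionally has edges $a_1p_1,a_1q_1,a_2p_2,a_2q_2$, the second additionally has edges $a_1p_1,a_1q_2,a_2p_2,a_2q_1$. *)

theory Defs
  imports Complex_Main
begin

section \<open>Simple graphs\<close>

text \<open>A finite simple graph: vertex set V, edges are 2-element subsets of V.\<close>
definition simple_graph :: "'a set \<Rightarrow> 'a set set \<Rightarrow> bool" where
  "simple_graph V E \<longleftrightarrow> finite V \<and>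
     (\<forall>e\<in>E. \<exists>u v. u \<in> V \<and> v \<in> V \<and> u \<noteq> v \<and> e = {u, v})"

definition degree :: "'a set \<Rightarrow> 'a set set \<Rightarrow> 'a \<Rightarrow> nat" where
  "degree V E v = card {u \<in> V. {u, v} \<in> E}"

definition cubic :: "'a set \<Rightarrow> 'a set set \<Rightarrow> bool" where
  "cubic V E \<longleftrightarrow> (\<forall>v\<in>V. degree V E v = 3)"

text \<open>Connected graphs are nonempty by convention.\<close>
definition connected_graph :: "'a set \<Rightarrow> 'a set set \<Rightarrow> bool" where
  "connected_graph V E \<longleftrightarrow> V \<noteq> {} \<and>
     (\<forall>u\<in>V. \<forall>v\<in>V. (u, v) \<in> {(x, y). {x, y} \<in> E}\<^sup>*)"

definition independent_set :: "'a set \<Rightarrow> 'a set set \<Rightarrow> 'a set \<Rightarrow> bool" where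
  "independent_set V E S \<longleftrightarrow> S \<subseteq> V \<and> (\<forall>u\<in>S. \<forall>v\<in>S. {u, v} \<notin> E)"

text \<open>Dissociation set: induced subgraph has maximum degree at most 1.\<close>
definition dissociation_set :: "'a set \<Rightarrow> 'a set set \<Rightarrow> 'a set \<Rightarrow> bool" where
  "dissociation_set V E S \<longleftrightarrow> S \<subseteq> V \<and> (\<forall>v\<in>S. card {u \<in> S. {u, v} \<in> E} \<le> 1)"

definition alpha :: "'a set \<Rightarrow> 'a set set \<Rightarrow> nat" where
  "alpha V E = Max (card ` {S. independent_set V E S})"

definition diss :: "'a set \<Rightarrow> 'a set set \<Rightarrow> nat" where
  "diss V E = Max (card ` {S. dissociation_set V E S})"

definition graph_iso :: "'a set \<Rightarrow> 'a set set \<Rightarrow> 'b set \<Rightarrow> 'b set set \<Rightarrow> bool" where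
  "graph_iso V E V' E' \<longleftrightarrow> (\<exists>f. bij_betw f V V' \<and>
     (\<forall>u\<in>V. \<forall>v\<in>V. {u, v} \<in> E \<longleftrightarrow> {f u, f v} \<in> E'))"

section \<open>Multigraphs\<close>

text \<open>A finite loopless multigraph: vertex set W, edge identifiers Ed,
  and each edge has a set of exactly two distinct ends in W.\<close>
definition multigraph :: "nat set \<Rightarrow> nat set \<Rightarrow> (nat \<Rightarrow> nat set) \<Rightarrow> bool" where
  "multigraph W Ed ends \<longleftrightarrow> finite W \<and> finite Ed \<and>
     (\<forall>e\<in>Ed. card (ends e) = 2 \<and> ends e \<subseteq> W)"

definition mdeg :: "nat set \<Rightarrow> (nat \<Rightarrow> nat set) \<Rightarrow> nat \<Rightarrow> nat" where
  "mdeg Ed ends w = card {e \<in> Ed. w \<in> ends e}"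

definition mconnected :: "nat set \<Rightarrow> nat set \<Rightarrow> (nat \<Rightarrow> nat set) \<Rightarrow> bool" where
  "mconnected W Ed ends \<longleftrightarrow> W \<noteq> {} \<and>
     (\<forall>u\<in>W. \<forall>v\<in>W. (u, v) \<in> {(x, y). \<exists>e\<in>Ed. ends e = {x, y}}\<^sup>*)"

definition ncount :: "nat set \<Rightarrow> nat set \<Rightarrow> (nat \<Rightarrow> nat set) \<Rightarrow> nat \<Rightarrow> nat" where
  "ncount W Ed ends i = card {w \<in> W. mdeg Ed ends w = i}"

text \<open>Induced matching: pairwise vertex-disjoint edges, and every edge of H with both
  ends covered by M belongs to M.\<close>
definition induced_matching :: "nat set \<Rightarrow> (nat \<Rightarrow> nat set) \<Rightarrow> nat set \<Rightarrow> bool" where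
  "induced_matching Ed ends M \<longleftrightarrow> M \<subseteq> Ed \<and>
     (\<forall>e\<in>M. \<forall>e'\<in>M. e \<noteq> e' \<longrightarrow> ends e \<inter> ends e' = {}) \<and>
     (\<forall>e\<in>Ed. ends e \<subseteq> \<Union>(ends ` M) \<longrightarrow> e \<in> M)"

definition in_Hk :: "nat \<Rightarrow> nat set \<Rightarrow> nat set \<Rightarrow> (nat \<Rightarrow> nat set) \<Rightarrow> bool" where
  "in_Hk k W Ed ends \<longleftrightarrow> multigraph W Ed ends \<and> mconnected W Ed ends \<and>
     (\<forall>w\<in>W. mdeg Ed ends w \<le> 3) \<and>
     3 * ncount W Ed ends 1 + 2 * ncount W Ed ends 2 + ncount W Ed ends 3 = 6 * k \<and>
     (\<exists>M. induced_matching Ed ends M \<and> card M = k \<and>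
        (\<forall>w\<in>W. mdeg Ed ends w = 1 \<longrightarrow> w \<in> \<Union>(ends ` M)) \<and>
        (\<exists>tl :: nat \<Rightarrow> nat. (\<forall>e\<in>Ed - M. tl e \<in> ends e) \<and>
           (\<forall>w\<in>W - \<Union>(ends ` M). card {e \<in> Ed - M. tl e = w} = 2)))"

section \<open>Gadgets\<close>

text \<open>Local labels.
  Triangle: 0,1,2.
  K4*: a=0, b=1, c=2, d=3, x=4, y=5.
  Degree-1 gadget: z=0, a1=1, a2=2, p1=3, q1=4, r1=5, p2=6, q2=7, r2=8.\<close>
definition gadget_verts :: "nat \<Rightarrow> nat set" where
  "gadget_verts d = (if d = 3 then {0..<3} else if d = 2 then {0..<6}
                     else if d = 1 then {0..<9} else {})"

definition attach_verts :: "nat \<Rightarrow> nat set" where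
  "attach_verts d = (if d = 3 then {0, 1, 2} else if d = 2 then {4, 5}
                     else if d = 1 then {0} else {})"

text \<open>The boolean selects the first (True) or second (False) degree-1 gadget.\<close>
definition gadget_edges :: "nat \<Rightarrow> bool \<Rightarrow> nat set set" where
  "gadget_edges d b =
    (if d = 3 then {{0, 1}, {1, 2}, {0, 2}}
     else if d = 2 then {{0, 2}, {0, 3}, {1, 2}, {1, 3}, {2, 3}, {0, 4}, {4, 5}, {5, 1}}
     else if d = 1 then
       {{0, 1}, {0, 2}, {3, 4}, {4, 5}, {3, 5}, {6, 7}, {7, 8}, {6, 8}, {5, 8}} \<union>
       (if b then {{1, 3}, {1, 4}, {2, 6}, {2, 7}} else {{1, 3}, {1, 7}, {2, 6}, {2, 4}})
     else {})"

text \<open>att w e: the local attachment vertex of gadget G_w used for edge e.\<close>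
definition valid_att :: "nat set \<Rightarrow> nat set \<Rightarrow> (nat \<Rightarrow> nat set) \<Rightarrow> (nat \<Rightarrow> nat \<Rightarrow> nat) \<Rightarrow> bool" where
  "valid_att W Ed ends att \<longleftrightarrow>
     (\<forall>w\<in>W. inj_on (att w) {e \<in> Ed. w \<in> ends e} \<and>
            att w ` {e \<in> Ed. w \<in> ends e} = attach_verts (mdeg Ed ends w))"

definition blowup_V :: "nat set \<Rightarrow> nat set \<Rightarrow> (nat \<Rightarrow> nat set) \<Rightarrow> (nat \<times> nat) set" where
  "blowup_V W Ed ends = {(w, i). w \<in> W \<and> i \<in> gadget_verts (mdeg Ed ends w)}"

definition blowup_E :: "nat set \<Rightarrow> nat set \<Rightarrow> (nat \<Rightarrow> nat set) \<Rightarrow> (nat \<Rightarrow> bool)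
    \<Rightarrow> (nat \<Rightarrow> nat \<Rightarrow> nat) \<Rightarrow> (nat \<times> nat) set set" where
  "blowup_E W Ed ends typ att =
     {{(w, i), (w, j)} | w i j. w \<in> W \<and> {i, j} \<in> gadget_edges (mdeg Ed ends w) (typ w)} \<union>
     {{(u, att u e), (v, att v e)} | e u v. e \<in> Ed \<and> ends e = {u, v} \<and> u \<noteq> v}"

definition in_Gk :: "nat \<Rightarrow> 'a set \<Rightarrow> 'a set set \<Rightarrow> bool" where
  "in_Gk k V E \<longleftrightarrow> (\<exists>W Ed ends. in_Hk k W Ed ends \<and>
     (\<exists>typ att. valid_att W Ed ends att \<and>
        graph_iso V E (blowup_V W Ed ends) (blowup_E W Ed ends typ att)))"

end

theory Submission
  imports Defs
begin

text \<open>
  Let a be the independence number of a connected cubic graph on n vertices and let D be a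
  dissociation set with complement R. Brooks' theorem gives 3 a \<ge> n, and deleting an end of every edge
  inside R gives a \<ge> |R| - e(R). Counting edges between D and R, two copies of the second
  inequality and one copy of the first add up to 5 a \<ge> 3 |D|. In the case of equality 3 a = n, the
  subgraph induced by D is 1-regular, and R induces a matching.

  The graphs with 3 a = n are handled by peeling. Call a set U of vertices tight if every
  independent subset has at most |U| / 3 elements. If U is tight and no component of the induced
  subgraph is cubic, then a vertex of degree at most 2 has degree exactly 2 and U without its
  closed neighbourhood is tight again, hence by induction partitioned into gadgets. The two neighbours
  together block every maximum independent set of the rest. Every gadget but the triangle has a
  maximum independent set avoiding its attachment vertices, so by Hall's theorem the neighbours
  block one triangle or two adjacent ones, which completes another gadget. A cubic graph with
  3 a = n is reduced to this case: it contains a triangle; if two triangles share an edge, the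
  two vertices opposite to this edge are removed with their neighbours; otherwise a
  triangle is removed and two of its outer neighbours are joined. The only exceptions have 12 vertices,
  such as the ring of three diamonds.

  Given a partition into gadgets, a table of the possible traces of D on a gadget shows that each
  gadget either has two attachment vertices in D, both with outer neighbour in R, or exactly one,
  whose outer neighbour lies in D. The edges of the second kind form the induced matching M, and the
  other edges between gadgets are oriented from D to R.
\<close>

text \<open>Deleting a vertex of degree at most 2 together with its neighbours costs at most three
  vertices and gains one independent vertex. So an independent third exists wherever such a vertex
  is always available, and tightness says that nothing better exists. The obstacle is that a
  connected cubic graph offers no such vertex at the start: Brooks' bound, the diamond and the
  triangle are three ways to make the first move. Removing a triangle alone does not preserve
  tightness: an independent set containing all three outer neighbours may exceed a third of the
  rest. Joining two of these neighbours destroys exactly such sets, but some tile may then use the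
  artificial edge. Every edge of a gadget is critical for its independence number, so losing this
  edge again leaves too large an independent set unless the tile and the removed triangle belong to
  one gadget. The exceptions on 12 vertices are harmless because equality makes the order a multiple
  of 9. With |V| = 9s and |D| = 5s the independence numbers of the tiles add up to 3s, and |D| falls
  short of twice this sum by s, one vertex for each tile at an edge of M. Hence s = 2k, which
  explains the 6k in condition (i).\<close>

section \<open>Hall's marriage theorem\<close>

lemma hall_marriage:
  fixes S :: "'i \<Rightarrow> 'b set"
  assumes "finite I" and "\<And>i. i \<in> I \<Longrightarrow> finite (S i)"
    and "\<And>K. K \<subseteq> I \<Longrightarrow> card K \<le> card (\<Union>(S ` K))"
  shows "\<exists>f. inj_on f I \<and> (\<forall>i\<in>I. f i \<in> S i)"
  using assms
proof (induction "card I" arbitrary: I S rule: less_induct)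
  case less
  note fin = less.prems(1) and finS = less.prems(2) and hall = less.prems(3)
  show ?case
  proof (cases "I = {}")
    case False
    then obtain i where i: "i \<in> I" by blast
    show ?thesis
    proof (cases "\<forall>K. K \<noteq> {} \<and> K \<subset> I \<longrightarrow> card K < card (\<Union>(S ` K))")
      \<comment> \<open>Every proper subfamily has a surplus, so removing one element x from all
        other sets keeps Hall's condition.\<close>
      case True
      have "card (S i) \<ge> 1" using hall[of "{i}"] i by simp
      then obtain x where x: "x \<in> S i" by (cases "S i = {}") auto
      have "\<exists>f. inj_on f (I - {i}) \<and> (\<forall>j\<in>I - {i}. f j \<in> S j - {x})"
      proof (rule less.hyps)
        show "card (I - {i}) < card I" using fin i by (rule card_Diff1_less)
        fix K assume K: "K \<subseteq> I - {i}"
        have e: "\<Union>((\<lambda>j. S j - {x}) ` K) = \<Union>(S ` K) - {x}" by blast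
        show "card K \<le> card (\<Union>((\<lambda>j. S j - {x}) ` K))"
        proof (cases "K = {}")
          case False
          then have "card K < card (\<Union>(S ` K))" using True K i by blast
          moreover have "card (\<Union>(S ` K)) - 1 \<le> card (\<Union>(S ` K) - {x})"
            by (simp only: card_Diff_singleton_if split: if_split) simp
          ultimately show ?thesis unfolding e by linarith
        qed simp
      qed (use fin finS in auto)
      then obtain f where f: "inj_on f (I - {i})" "\<forall>j\<in>I - {i}. f j \<in> S j - {x}" by blast
      let ?g = "f(i := x)"
      have "inj_on ?g I" using f by (auto simp: inj_on_def)
      moreover have "\<forall>j\<in>I. ?g j \<in> S j" using f x by auto
      ultimately show ?thesis by blast
    next
      \<comment> \<open>The subfamily K uses up its whole union. The sets outside K, reduced by this
        union, still satisfy Hall's condition, as adding K to a subfamily shows.\<close>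
      case False
      then obtain K where K: "K \<noteq> {}" "K \<subset> I" "card (\<Union>(S ` K)) \<le> card K"
        by (meson not_less)
      let ?U = "\<Union>(S ` K)"
      have finK: "finite K" using K fin finite_subset by blast
      have finU: "finite ?U" using finK finS K by blast
      have "\<exists>f. inj_on f K \<and> (\<forall>j\<in>K. f j \<in> S j)"
      proof (rule less.hyps)
        show "card K < card I" using fin K(2) by (rule psubset_card_mono)
        show "card L \<le> card (\<Union>(S ` L))" if "L \<subseteq> K" for L
          using hall[of L] that K(2) by blast
      qed (use finK finS K(2) in blast)+
      then obtain f where f: "inj_on f K" "\<forall>j\<in>K. f j \<in> S j" by blast
      have "\<exists>g. inj_on g (I - K) \<and> (\<forall>j\<in>I - K. g j \<in> S j - ?U)"
      proof (rule less.hyps)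
        show "card (I - K) < card I" using fin K by (intro psubset_card_mono) auto
        fix L assume L: "L \<subseteq> I - K"
        have finL: "finite L" using L fin finite_subset by blast
        have e: "\<Union>(S ` (K \<union> L)) = ?U \<union> \<Union>((\<lambda>j. S j - ?U) ` L)" by blast
        have "card K + card L = card (K \<union> L)"
          using L finK finL by (subst card_Un_disjoint) auto
        also have "\<dots> \<le> card (\<Union>(S ` (K \<union> L)))" using hall[of "K \<union> L"] L K by blast
        also have "\<dots> \<le> card ?U + card (\<Union>((\<lambda>j. S j - ?U) ` L))"
          unfolding e by (rule card_Un_le)
        finally show "card L \<le> card (\<Union>((\<lambda>j. S j - ?U) ` L))" using K(3) by linarith
      qed (use fin finS in auto)
      then obtain g where g: "inj_on g (I - K)" "\<forall>j\<in>I - K. g j \<in> S j - ?U" by blast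
      let ?h = "\<lambda>j. if j \<in> K then f j else g j"
      have "inj_on ?h I"
      proof (rule inj_onI)
        fix a b assume ab: "a \<in> I" "b \<in> I" "?h a = ?h b"
        have fU: "f c \<in> ?U" if "c \<in> K" for c using f(2) that by blast
        have gU: "g c \<notin> ?U" if "c \<in> I - K" for c using g(2) that by blast
        show "a = b"
        proof (cases "a \<in> K \<longleftrightarrow> b \<in> K")
          case True
          then show ?thesis using ab f(1) g(1) by (cases "a \<in> K") (auto dest: inj_onD)
        next
          case False
          then show ?thesis using ab fU[of a] fU[of b] gU[of a] gU[of b] by (cases "a \<in> K") auto
        qed
      qed
      moreover have "\<forall>j\<in>I. ?h j \<in> S j" using f g by auto
      ultimately show ?thesis by blast
    qed
  qed simp
qed

section \<open>The gadgets as labelled graphs\<close>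

text \<open>The independence number of a gadget, always a third of its order. Degree 0 falls into
  the last branch although its gadget is empty, so sums over \<open>W\<close> have to treat it
  separately.\<close>

definition gadget_alpha :: "nat \<Rightarrow> nat" where
  "gadget_alpha d = (if d = 3 then 1 else if d = 2 then 2 else 3)"

lemma gadget_verts_simps:
  "gadget_verts 3 = {0, 1, 2}" "gadget_verts 2 = {0, 1, 2, 3, 4, 5}"
  "gadget_verts (Suc 0) = {0, 1, 2, 3, 4, 5, 6, 7, 8}"
  by (auto simp: gadget_verts_def)

lemma attach_verts_simps:
  "attach_verts 3 = {0, 1, 2}" "attach_verts 2 = {4, 5}" "attach_verts (Suc 0) = {0}"
  by (auto simp: attach_verts_def)

lemma attach_subset: "attach_verts d \<subseteq> gadget_verts d"
  by (auto simp: attach_verts_def gadget_verts_def)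

lemma finite_gadget_verts [simp]: "finite (gadget_verts d)"
  by (auto simp: gadget_verts_def)

lemma card_gadget_verts: "d \<in> {1,2,3} \<Longrightarrow> card (gadget_verts d) = 3 * gadget_alpha d"
  by (auto simp: gadget_verts_def gadget_alpha_def)

lemma card_attach_verts: "d \<in> {1,2,3} \<Longrightarrow> card (attach_verts d) = d"
  by (auto simp: attach_verts_def)

definition gnb :: "nat \<Rightarrow> bool \<Rightarrow> nat \<Rightarrow> nat set" where
  "gnb d b i = {j \<in> gadget_verts d. {i, j} \<in> gadget_edges d b}"

lemma gadget_edges_verts: "{i, j} \<in> gadget_edges d b \<Longrightarrow> i \<in> gadget_verts d \<and> j \<in> gadget_verts d"
  by (auto simp: gadget_edges_def gadget_verts_def doubleton_eq_iff split: if_splits)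

lemma gnb_simps:
  "gnb 3 b 0 = {1,2}" "gnb 3 b (Suc 0) = {0,2}" "gnb 3 b 2 = {0,1}"
  "gnb 2 b 0 = {2,3,4}" "gnb 2 b (Suc 0) = {2,3,5}" "gnb 2 b 2 = {0,1,3}" "gnb 2 b 3 = {0,1,2}"
  "gnb 2 b 4 = {0,5}" "gnb 2 b 5 = {1,4}"
  "gnb (Suc 0) b 0 = {1,2}" "gnb (Suc 0) b (Suc 0) = (if b then {0,3,4} else {0,3,7})"
  "gnb (Suc 0) b 2 = (if b then {0,6,7} else {0,6,4})"
  "gnb (Suc 0) b 3 = {1,4,5}" "gnb (Suc 0) b 4 = (if b then {1,3,5} else {2,3,5})"
  "gnb (Suc 0) b 5 = {3,4,8}" "gnb (Suc 0) b 6 = {2,7,8}"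
  "gnb (Suc 0) b 7 = (if b then {2,6,8} else {1,6,8})" "gnb (Suc 0) b 8 = {5,6,7}"
  unfolding gnb_def gadget_verts_simps by (auto simp: gadget_edges_def doubleton_eq_iff)

lemma gnb_sym: "i \<in> gadget_verts d \<Longrightarrow> j \<in> gnb d b i \<Longrightarrow> i \<in> gnb d b j"
  by (auto simp: gnb_def insert_commute)

lemma card_gnb:
  assumes "d \<in> {1,2,3}" "i \<in> gadget_verts d"
  shows "card (gnb d b i) = (if i \<in> attach_verts d then 2 else 3)"
  using assms by (auto simp: gadget_verts_simps attach_verts_simps gnb_simps)

text \<open>All non-edges of a gadget therefore involve an inner vertex, whose three neighbours are
  known. This is why a copy of a gadget can be recognised from its edges alone.\<close>

lemma attach_adjacent:
  assumes "d \<in> {1,2,3}" "i \<in> attach_verts d" "j \<in> attach_verts d" "i \<noteq> j"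
  shows "j \<in> gnb d b i"
  using assms by (auto simp: attach_verts_simps gnb_simps)

lemma gnb_irrefl: "i \<notin> gnb d b i"
  by (auto simp: gnb_def gadget_edges_def)

lemma gadget_inner_set:
  assumes "d \<in> {1,2}"
  obtains L where "L \<subseteq> gadget_verts d - attach_verts d" "card L = gadget_alpha d"
    "\<And>i j. i \<in> L \<Longrightarrow> j \<in> L \<Longrightarrow> j \<notin> gnb d b i"
proof (cases "d = 2")
  case True
  show ?thesis
    by (rule that[of "{0,1}"]) (auto simp: True gadget_verts_simps attach_verts_simps gadget_alpha_def gnb_simps)
next
  case False
  \<comment> \<open>The witness consists of a_1, a_2 and r_1, which are pairwise nonadjacent in both
    versions.\<close>
  then have "d = 1" using assms by auto
  then show ?thesis
    by (intro that[of "{1,2,5}"])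
      (auto simp: gadget_verts_simps attach_verts_simps gadget_alpha_def gnb_simps split: if_splits)
qed

text \<open>The indicator of an independent set sums to at most 1 over every clique. A few triangles
  and edges suffice, so that each bound is a matter of linear arithmetic over the integers.\<close>

lemma gadget_independent_bound:
  assumes d: "d \<in> {1,2,3}" and L: "L \<subseteq> gadget_verts d"
    and ind: "\<And>i j. i \<in> L \<Longrightarrow> j \<in> L \<Longrightarrow> j \<notin> gnb d b i"
  shows "card L \<le> gadget_alpha d"
proof -
  define x :: "nat \<Rightarrow> nat" where "x i = (if i \<in> L then 1 else 0)" for i
  have le1: "x i \<le> 1" for i by (simp add: x_def)
  have two: "x i + x j \<le> 1" if "j \<in> gnb d b i" for i j
    using ind[of i j] that by (auto simp: x_def)
  have three: "x i + x j + x k \<le> 1" if "j \<in> gnb d b i" "k \<in> gnb d b i" "k \<in> gnb d b j" for i j k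
    using two[OF that(1)] two[OF that(2)] two[OF that(3)] by linarith
  have card: "card L = (\<Sum>i\<in>gadget_verts d. x i)"
    using L by (simp add: x_def sum.If_cases Int_absorb1)
  consider "d = 3" | "d = 2" | "d = Suc 0" using d by auto
  then show ?thesis
  proof cases
    case 1
    have "x 0 + x 1 + x 2 \<le> 1" by (rule three) (auto simp: 1 gnb_simps)
    then show ?thesis unfolding card by (simp add: 1 gadget_verts_simps gadget_alpha_def)
  next
    case 2
    \<comment> \<open>The two triangles and the three edges cover each vertex exactly twice, so
      twice the total is at most 5.\<close>
    have "x 0 + x 2 + x 3 \<le> 1" by (rule three) (auto simp: 2 gnb_simps)
    moreover have "x 1 + x 2 + x 3 \<le> 1" by (rule three) (auto simp: 2 gnb_simps)
    moreover have "x 0 + x 4 \<le> 1" "x 4 + x 5 \<le> 1" "x 1 + x 5 \<le> 1"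
      by (rule two, simp add: 2 gnb_simps)+
    ultimately have "x 0 + x 1 + x 2 + x 3 + x 4 + x 5 \<le> 2" by linarith
    then show ?thesis unfolding card by (simp add: 2 gadget_verts_simps gadget_alpha_def)
  next
    case 3
    have t1: "x 3 + x 4 + x 5 \<le> 1" by (rule three) (auto simp: 3 gnb_simps)
    have t2: "x 6 + x 7 + x 8 \<le> 1" by (rule three) (auto simp: 3 gnb_simps)
    have z: "x 0 + x 1 \<le> 1" "x 0 + x 2 \<le> 1" "x 5 + x 8 \<le> 1"
      by (rule two, simp add: 3 gnb_simps)+
    have a: "x 1 + x 3 \<le> 1" "x 2 + x 6 \<le> 1"
      by (rule two, simp add: 3 gnb_simps)+
    have a': "(x 1 + x 4 \<le> 1 \<and> x 2 + x 7 \<le> 1) \<or> (x 1 + x 7 \<le> 1 \<and> x 2 + x 4 \<le> 1)"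
    proof (cases b)
      case True
      have "x 1 + x 4 \<le> 1" "x 2 + x 7 \<le> 1" by (rule two, simp add: 3 gnb_simps True)+
      then show ?thesis by blast
    next
      case False
      have "x 1 + x 7 \<le> 1" "x 2 + x 4 \<le> 1" by (rule two, simp add: 3 gnb_simps False)+
      then show ?thesis by blast
    qed
    have "x 0 + x 1 + x 2 + x 3 + x 4 + x 5 + x 6 + x 7 + x 8 \<le> 3"
    proof (cases "x 1 = 1 \<and> x 2 = 1")
      \<comment> \<open>Choosing both a_1 and a_2 excludes z and all of p_1, q_1, p_2, q_2, and
        leaves only the adjacent vertices r_1 and r_2. Otherwise z, a_1, a_2 contribute at most one,
        and so does each triangle.\<close>
      case True
      then have "x 3 = 0" "x 6 = 0" "x 0 = 0" using a z by linarith+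
      moreover have "x 4 = 0 \<and> x 7 = 0" using a'
      proof
        assume "x 1 + x 4 \<le> 1 \<and> x 2 + x 7 \<le> 1"
        then show ?thesis using True by linarith
      next
        assume "x 1 + x 7 \<le> 1 \<and> x 2 + x 4 \<le> 1"
        then show ?thesis using True by linarith
      qed
      ultimately show ?thesis using True z(3) by linarith
    next
      case False
      then have "x 0 + x 1 + x 2 \<le> 1" using z le1[of 1] le1[of 2] le1[of 0] by linarith
      then show ?thesis using t1 t2 by linarith
    qed
    then show ?thesis unfolding card by (simp add: 3 gadget_verts_simps gadget_alpha_def)
  qed
qed

section \<open>Tight and deficient sets\<close>

text \<open>Adjacency lives on the whole type and induced subgraphs are named by their vertex sets,
  so deleting vertices changes only a set. Adding an edge gives a second instance of the locale on
  the same type.\<close>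

locale sgraph =
  fixes adj :: "'a \<Rightarrow> 'a \<Rightarrow> bool"
  assumes adj_sym: "adj u v \<Longrightarrow> adj v u" and adj_irrefl [simp]: "\<not> adj u u"
begin

lemma adj_commute: "adj u v \<longleftrightarrow> adj v u"
  using adj_sym by blast

definition nb :: "'a set \<Rightarrow> 'a \<Rightarrow> 'a set" where
  "nb U v = {u \<in> U. adj v u}"

definition indep :: "'a set \<Rightarrow> bool" where
  "indep I \<longleftrightarrow> (\<forall>u\<in>I. \<forall>v\<in>I. \<not> adj u v)"

definition subcubic :: "'a set \<Rightarrow> bool" where
  "subcubic U \<longleftrightarrow> finite U \<and> (\<forall>v\<in>U. card (nb U v) \<le> 3)"

text \<open>No union of connected components of the induced subgraph is cubic.\<close>
definition deficient :: "'a set \<Rightarrow> bool" where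
  "deficient U \<longleftrightarrow> (\<forall>W\<subseteq>U. W \<noteq> {} \<longrightarrow> (\<forall>w\<in>W. nb U w \<subseteq> W) \<longrightarrow> (\<exists>w\<in>W. card (nb U w) < 3))"

text \<open>Subcubic deficient sets always contain an independent third, so for them tightness means
  that the independence number is exactly a third of the order.\<close>

definition tight :: "'a set \<Rightarrow> bool" where
  "tight U \<longleftrightarrow> (\<forall>I\<subseteq>U. indep I \<longrightarrow> 3 * card I \<le> card U)"

definition gadget_at :: "nat \<Rightarrow> bool \<Rightarrow> (nat \<Rightarrow> 'a) \<Rightarrow> 'a set \<Rightarrow> bool" where
  "gadget_at d b g B \<longleftrightarrow> d \<in> {1,2,3} \<and> bij_betw g (gadget_verts d) B \<and>
     (\<forall>i\<in>gadget_verts d. \<forall>j\<in>gadget_verts d. adj (g i) (g j) \<longleftrightarrow> j \<in> gnb d b i)"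

definition gadget :: "'a set \<Rightarrow> bool" where
  "gadget B \<longleftrightarrow> (\<exists>d b g. gadget_at d b g B)"

definition tiling :: "'a set \<Rightarrow> 'a set set \<Rightarrow> bool" where
  "tiling U P \<longleftrightarrow> \<Union>P = U \<and> pairwise disjnt P \<and> (\<forall>B\<in>P. gadget B)"

definition tiled :: "'a set \<Rightarrow> bool" where
  "tiled U \<longleftrightarrow> (\<exists>P. tiling U P)"

lemma nb_iff [simp]: "u \<in> nb U v \<longleftrightarrow> u \<in> U \<and> adj v u"
  by (simp add: nb_def)

lemma nb_subset: "nb U v \<subseteq> U"
  by auto

lemma nb_mono: "U \<subseteq> U' \<Longrightarrow> nb U v \<subseteq> nb U' v"
  by auto

lemma subcubic_finite: "subcubic U \<Longrightarrow> finite U"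
  by (simp add: subcubic_def)

lemma finite_nb: "finite U \<Longrightarrow> finite (nb U v)"
  by (simp add: nb_def)

lemma subcubic_mono: "subcubic U \<Longrightarrow> U' \<subseteq> U \<Longrightarrow> subcubic U'"
  unfolding subcubic_def
  by (meson card_mono finite_nb finite_subset nb_mono order_trans subsetD)

lemma nb_eq3:
  assumes "subcubic U" "v \<in> U" "x \<in> U" "y \<in> U" "z \<in> U" "adj v x" "adj v y" "adj v z"
    "x \<noteq> y" "x \<noteq> z" "y \<noteq> z"
  shows "nb U v = {x, y, z}"
proof -
  have "card (nb U v) \<le> 3" "finite (nb U v)"
    using assms by (auto simp: subcubic_def finite_nb)
  moreover have "{x, y, z} \<subseteq> nb U v" "card {x, y, z} = 3" using assms by auto
  ultimately show ?thesis by (metis card_subset_eq le_antisym card_mono)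
qed

text \<open>A union of components that is cubic in the smaller set has no room for further
  neighbours in the subcubic larger set, so it would be a cubic union of components there as
  well.\<close>

lemma deficient_mono:
  assumes "subcubic U" "deficient U" "U' \<subseteq> U"
  shows "deficient U'"
  unfolding deficient_def
proof (intro allI impI)
  fix W assume W: "W \<subseteq> U'" "W \<noteq> {}" "\<forall>w\<in>W. nb U' w \<subseteq> W"
  show "\<exists>w\<in>W. card (nb U' w) < 3"
  proof (rule ccontr)
    assume "\<not> ?thesis"
    then have c: "card (nb U' w) \<ge> 3" if "w \<in> W" for w using that by (auto simp: not_less)
    have "nb U w = nb U' w" if "w \<in> W" for w
    proof -
      have "w \<in> U" using that W assms by auto
      then have "card (nb U w) \<le> 3" "finite (nb U w)" using assms by (auto simp: subcubic_def finite_nb)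
      moreover have "nb U' w \<subseteq> nb U w" using assms(3) by (rule nb_mono)
      ultimately show ?thesis by (metis c card_mono card_subset_eq le_antisym le_trans that)
    qed
    then show False
      using assms(2) W c unfolding deficient_def by (metis assms(3) linorder_not_less order_trans)
  qed
qed

lemma indep_insert: "indep (insert v I) \<longleftrightarrow> indep I \<and> (\<forall>u\<in>I. \<not> adj v u)"
  unfolding indep_def using adj_sym by auto

lemma indep_empty [simp]: "indep {}"
  by (simp add: indep_def)

lemma indep_subset: "indep I \<Longrightarrow> J \<subseteq> I \<Longrightarrow> indep J"
  unfolding indep_def by blast

lemma indep_Un: "indep (I \<union> J) \<longleftrightarrow> indep I \<and> indep J \<and> (\<forall>u\<in>I. \<forall>v\<in>J. \<not> adj u v)"
  unfolding indep_def using adj_sym by blast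

lemma deficient_low_vertex:
  assumes "deficient U" "U \<noteq> {}"
  obtains v where "v \<in> U" "card (nb U v) < 3"
  using assms unfolding deficient_def by (metis nb_subset subset_refl)

lemma card_closed_nb:
  assumes "finite U" "v \<in> U"
  shows "card (U - insert v (nb U v)) + (card (nb U v) + 1) = card U"
proof -
  have "card (insert v (nb U v)) = card (nb U v) + 1" using assms by (simp add: finite_nb)
  moreover have "card (insert v (nb U v)) \<le> card U"
    using assms by (intro card_mono) auto
  ultimately show ?thesis using assms by (subst card_Diff_subset) (auto simp: finite_nb)
qed

text \<open>Greedy choice: some vertex always has degree at most 2, and its closed neighbourhood has
  at most three vertices. Deficiency passes to what remains.\<close>

lemma deficient_third:
  assumes "subcubic U" "deficient U"
  obtains I where "I \<subseteq> U" "indep I" "card U \<le> 3 * card I"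
proof -
  have "\<exists>I\<subseteq>U. indep I \<and> card U \<le> 3 * card I"
    using assms
  proof (induction "card U" arbitrary: U rule: less_induct)
    case less
    have fin: "finite U" using less.prems by (simp add: subcubic_def)
    show ?case
    proof (cases "U = {}")
      case False
      then obtain v where v: "v \<in> U" "card (nb U v) < 3"
        using less.prems deficient_low_vertex by blast
      let ?F = "U - insert v (nb U v)"
      have F: "?F \<subseteq> U" by blast
      have "card ?F < card U" using v fin by (intro psubset_card_mono) auto
      then obtain I where I: "I \<subseteq> ?F" "indep I" "card ?F \<le> 3 * card I"
        using less.hyps less.prems F deficient_mono subcubic_mono by meson
      have finI: "finite I" using I F fin by (meson finite_subset)
      have "indep (insert v I)" using I by (auto simp: indep_insert)
      moreover have "card (insert v I) = card I + 1" using I finI by (subst card_insert_disjoint) auto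
      moreover have "card U \<le> card ?F + 3" using card_closed_nb[OF fin v(1)] v(2) by linarith
      ultimately show ?thesis using I v by (intro exI[of _ "insert v I"]) auto
    qed auto
  qed
  then show ?thesis using that by blast
qed

text \<open>Every independent set of \<open>U - X\<close> extends by \<open>S\<close>, which already
  accounts for a third of \<open>X\<close> and has no neighbours outside.\<close>

lemma tight_split:
  assumes "finite U" "tight U" "X \<subseteq> U" "S \<subseteq> X" "indep S" "card X = 3 * card S"
    and "\<And>s u. s \<in> S \<Longrightarrow> u \<in> U - X \<Longrightarrow> \<not> adj s u"
  shows "tight (U - X)"
  unfolding tight_def
proof (intro allI impI)
  fix I assume I: "I \<subseteq> U - X" "indep I"
  have fin: "finite I" "finite S" using assms I by (meson finite_subset finite_Diff)+
  have "indep (S \<union> I)" using assms I by (auto simp: indep_Un)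
  moreover have "S \<union> I \<subseteq> U" using assms(3,4) I by blast
  ultimately have "3 * card (S \<union> I) \<le> card U" using assms(2) unfolding tight_def by simp
  moreover have "card (S \<union> I) = card S + card I"
    using fin assms I by (intro card_Un_disjoint) auto
  moreover have "card (U - X) + card X = card U"
    using assms(1,3) by (simp add: card_Diff_subset card_mono finite_subset)
  ultimately show "3 * card I \<le> card (U - X)" using assms(6) by linarith
qed

text \<open>Edges suffice: an inner vertex reaches degree 3 within the gadget and can have no
  further neighbour, and two attachment vertices are adjacent anyway.\<close>

lemma gadgetI:
  assumes U: "subcubic U" "B \<subseteq> U" and d: "d \<in> {1,2,3}" and g: "bij_betw g (gadget_verts d) B"
    and e: "\<And>i j. i \<in> gadget_verts d \<Longrightarrow> j \<in> gnb d b i \<Longrightarrow> adj (g i) (g j)"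
  shows "gadget_at d b g B"
proof -
  have inB: "g i \<in> B" if "i \<in> gadget_verts d" for i
    using g that by (auto simp: bij_betw_def)
  have inj: "inj_on g (gadget_verts d)" using g by (simp add: bij_betw_def)
  have inner: "nb U (g i) = g ` gnb d b i" if "i \<in> gadget_verts d - attach_verts d" for i
  proof -
    have sub: "gnb d b i \<subseteq> gadget_verts d" by (auto simp: gnb_def)
    have "card (g ` gnb d b i) = 3"
      using inj sub that d card_gnb[of d i b] by (subst card_image) (auto intro: inj_on_subset)
    moreover have "g j \<in> U" if "j \<in> gnb d b i" for j using inB sub that U(2) by blast
    then have "g ` gnb d b i \<subseteq> nb U (g i)" using e that by auto
    moreover have "card (nb U (g i)) \<le> 3" "finite (nb U (g i))"
      using U inB that by (auto simp: subcubic_def finite_nb)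
    ultimately show ?thesis by (metis card_mono card_subset_eq le_antisym)
  qed
  have *: "j \<in> gnb d b i" if "i \<in> gadget_verts d - attach_verts d" "j \<in> gadget_verts d" "adj (g i) (g j)" for i j
  proof -
    have "g j \<in> nb U (g i)" using inB[OF that(2)] that(3) U(2) by auto
    then have "g j \<in> g ` gnb d b i" using inner[OF that(1)] by simp
    then show ?thesis using inj that(2) by (auto simp: gnb_def inj_on_def)
  qed
  have "adj (g i) (g j) \<longleftrightarrow> j \<in> gnb d b i" if ij: "i \<in> gadget_verts d" "j \<in> gadget_verts d" for i j
  proof
    assume a: "adj (g i) (g j)"
    show "j \<in> gnb d b i"
    proof (cases "i \<in> attach_verts d \<and> j \<in> attach_verts d")
      case True
      then show ?thesis using attach_adjacent[OF d] a by (cases "i = j") auto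
    next
      case False
      then show ?thesis using * ij a adj_sym gnb_sym by (metis DiffI)
    qed
  qed (use e ij in blast)
  then show ?thesis using d g by (auto simp: gadget_at_def)
qed

lemma gadget_atD:
  assumes "gadget_at d b g B"
  shows "d \<in> {1,2,3}" "bij_betw g (gadget_verts d) B" "inj_on g (gadget_verts d)"
    "B = g ` gadget_verts d"
    "i \<in> gadget_verts d \<Longrightarrow> j \<in> gadget_verts d \<Longrightarrow> adj (g i) (g j) \<longleftrightarrow> j \<in> gnb d b i"
  using assms by (auto simp: gadget_at_def bij_betw_def)

lemma gadget_card: "gadget_at d b g B \<Longrightarrow> card B = 3 * gadget_alpha d"
  by (metis gadget_atD(1,2) bij_betw_same_card card_gadget_verts)

lemma gadget_finite: "gadget B \<Longrightarrow> finite B"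
  by (metis gadget_def gadget_atD(4) finite_gadget_verts finite_imageI)

lemma gadget_card_pos: "gadget B \<Longrightarrow> card B > 0"
  unfolding gadget_def by (auto simp: gadget_card gadget_alpha_def)

lemma gadget_nb:
  assumes "gadget_at d b g B" "i \<in> gadget_verts d"
  shows "nb B (g i) = g ` gnb d b i"
  using assms gadget_atD[OF assms(1)] by (auto simp: gnb_def)

lemma gadget_card_nb:
  assumes "gadget_at d b g B" "i \<in> gadget_verts d"
  shows "card (nb B (g i)) = (if i \<in> attach_verts d then 2 else 3)"
proof -
  have "gnb d b i \<subseteq> gadget_verts d" by (auto simp: gnb_def)
  then show ?thesis
    using gadget_atD[OF assms(1)] assms card_gnb gadget_nb
    by (metis card_image inj_on_subset)
qed

lemma gadget_inner_nb:
  assumes "gadget_at d b g B" "i \<in> gadget_verts d - attach_verts d" "subcubic U" "B \<subseteq> U"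
  shows "nb U (g i) \<subseteq> B"
proof -
  have "g i \<in> B" using assms(1,2) gadget_atD by blast
  then have "card (nb U (g i)) \<le> 3" "finite (nb U (g i))"
    using assms by (auto simp: subcubic_def finite_nb)
  moreover have "nb B (g i) \<subseteq> nb U (g i)" using assms(4) by (rule nb_mono)
  moreover have "card (nb B (g i)) = 3" using gadget_card_nb assms by auto
  ultimately have "nb B (g i) = nb U (g i)" by (metis card_mono card_subset_eq le_antisym)
  then show ?thesis by auto
qed

lemma tri_gadgetI:
  assumes "adj x y" "adj y z" "adj x z"
  shows "gadget {x, y, z}"
proof -
  let ?g = "\<lambda>i. [x, y, z] ! i"
  have "gadget_at 3 True ?g {x, y, z}"
    unfolding gadget_at_def
    using assms adj_sym
    by (auto simp: gadget_verts_simps gnb_simps bij_betw_def inj_on_def)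
  then show ?thesis by (auto simp: gadget_def)
qed

lemma k4star_gadgetI:
  assumes "subcubic U" "{A, B, C, D, X, Y} \<subseteq> U" "distinct [A, B, C, D, X, Y]"
    "adj A C" "adj A D" "adj B C" "adj B D" "adj C D" "adj A X" "adj X Y" "adj Y B"
  shows "gadget {A, B, C, D, X, Y}"
proof -
  let ?g = "\<lambda>i. [A, B, C, D, X, Y] ! i"
  have "gadget_at 2 True ?g {A, B, C, D, X, Y}"
  proof (rule gadgetI[OF assms(1,2)])
    show "bij_betw ?g (gadget_verts 2) {A, B, C, D, X, Y}"
      using assms(3) by (auto simp: gadget_verts_simps bij_betw_def inj_on_def)
    fix i j assume "i \<in> gadget_verts 2" "j \<in> gnb 2 True i"
    then show "adj (?g i) (?g j)" using assms(4-) adj_sym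
      by (auto simp: gadget_verts_simps gnb_simps)
  qed auto
  then show ?thesis by (auto simp: gadget_def)
qed

lemma nine_gadgetI:
  assumes "subcubic U" "{z, a1, a2, p1, q1, r1, p2, q2, r2} \<subseteq> U"
    "distinct [z, a1, a2, p1, q1, r1, p2, q2, r2]"
    "adj z a1" "adj z a2" "adj p1 q1" "adj q1 r1" "adj p1 r1" "adj p2 q2" "adj q2 r2" "adj p2 r2"
    "adj r1 r2" "adj a1 p1" "adj a2 p2" "adj a1 q1 \<and> adj a2 q2 \<or> adj a1 q2 \<and> adj a2 q1"
  shows "gadget {z, a1, a2, p1, q1, r1, p2, q2, r2}"
proof -
  let ?g = "\<lambda>i. [z, a1, a2, p1, q1, r1, p2, q2, r2] ! i"
  let ?b = "adj a1 q1 \<and> adj a2 q2"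
  have b: "?b \<or> \<not> ?b \<and> adj a1 q2 \<and> adj a2 q1" using assms(15) by blast
  have "gadget_at (Suc 0) ?b ?g {z, a1, a2, p1, q1, r1, p2, q2, r2}"
  proof (rule gadgetI[OF assms(1,2)])
    show "bij_betw ?g (gadget_verts (Suc 0)) {z, a1, a2, p1, q1, r1, p2, q2, r2}"
      using assms(3) by (auto simp: gadget_verts_simps bij_betw_def inj_on_def)
    fix i j assume i: "i \<in> gadget_verts (Suc 0)" and j: "j \<in> gnb (Suc 0) ?b i"
    consider "?b" | "\<not> ?b" "adj a1 q2" "adj a2 q1" using b by blast
    then show "adj (?g i) (?g j)"
    proof cases
      case 1
      then have "?b = True" by simp
      with i j 1 show ?thesis using assms(4-14) adj_sym
        by (auto simp: gadget_verts_simps gnb_simps)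
    next
      case 2
      then have "?b = False" by simp
      with i j 2 show ?thesis using assms(4-14) adj_sym
        by (auto simp: gadget_verts_simps gnb_simps)
    qed
  qed auto
  then show ?thesis by (auto simp: gadget_def)
qed

lemma tiling_finite: "tiling U P \<Longrightarrow> finite U \<Longrightarrow> finite P"
  unfolding tiling_def using finite_UnionD by blast

lemma tiling_Un:
  assumes "tiling U P" "tiling U' P'" "U \<inter> U' = {}"
  shows "tiling (U \<union> U') (P \<union> P')"
  unfolding tiling_def
proof (intro conjI)
  have sub: "A \<subseteq> U" if "A \<in> P" for A using assms(1) that unfolding tiling_def by blast
  have sub': "A \<subseteq> U'" if "A \<in> P'" for A using assms(2) that unfolding tiling_def by blast
  have pw: "pairwise disjnt P" "pairwise disjnt P'" using assms unfolding tiling_def by auto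
  show "pairwise disjnt (P \<union> P')"
  proof (rule pairwiseI)
    fix A B assume AB: "A \<in> P \<union> P'" "B \<in> P \<union> P'" "A \<noteq> B"
    have "disjnt U U'" using assms(3) by (simp add: disjnt_def)
    then have "disjnt A B" if "A \<in> P" "B \<in> P'" for A B
      using sub[OF that(1)] sub'[OF that(2)] by (meson disjnt_subset1 disjnt_subset2)
    then show "disjnt A B" using AB pw by (metis Un_iff disjnt_sym pairwiseD)
  qed
qed (use assms in \<open>auto simp: tiling_def\<close>)

lemma tiled_Un: "tiled U \<Longrightarrow> tiled U' \<Longrightarrow> U \<inter> U' = {} \<Longrightarrow> tiled (U \<union> U')"
  unfolding tiled_def using tiling_Un by blast

lemma tiled_gadget: "gadget B \<Longrightarrow> tiled B"
  unfolding tiled_def tiling_def by (rule exI[of _ "{B}"]) auto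

lemma tiled_empty: "tiled {}"
  unfolding tiled_def tiling_def by (rule exI[of _ "{}"]) auto

lemma tiling_Diff:
  assumes "tiling U P" "Q \<subseteq> P"
  shows "tiled (U - \<Union>Q)"
proof -
  have "\<Union>(P - Q) = U - \<Union>Q"
  proof
    show "\<Union>(P - Q) \<subseteq> U - \<Union>Q"
    proof
      fix x assume "x \<in> \<Union>(P - Q)"
      then obtain A where A: "x \<in> A" "A \<in> P" "A \<notin> Q" by blast
      have "x \<notin> C" if "C \<in> Q" for C
      proof -
        have "C \<in> P" "A \<noteq> C" using that A assms(2) by auto
        then have "disjnt A C" using assms(1) A(2) unfolding tiling_def by (metis pairwiseD)
        then show ?thesis using A(1) by (auto simp: disjnt_def)
      qed
      then show "x \<in> U - \<Union>Q" using A assms(1) unfolding tiling_def by blast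
    qed
  qed (use assms in \<open>auto simp: tiling_def\<close>)
  moreover have "pairwise disjnt (P - Q)" "\<forall>B\<in>P - Q. gadget B"
    using assms(1) unfolding tiling_def by (auto intro: pairwise_subset)
  ultimately show ?thesis unfolding tiled_def tiling_def by blast
qed

text \<open>The common form of the peeling steps: the removed vertices \<open>N\<close> absorb the
  tiles in \<open>Q\<close>, which are none, one triangle or two triangles, into one gadget.\<close>

lemma tiled_replace:
  assumes "tiling F P" "Q \<subseteq> P" "gadget (N \<union> \<Union>Q)" "N \<inter> F = {}"
  shows "tiled (N \<union> F)"
proof -
  have QF: "\<Union>Q \<subseteq> F" using assms unfolding tiling_def by blast
  have "tiled ((N \<union> \<Union>Q) \<union> (F - \<Union>Q))"
    using assms QF by (intro tiled_Un tiled_gadget tiling_Diff) auto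
  moreover have "(N \<union> \<Union>Q) \<union> (F - \<Union>Q) = N \<union> F" using QF by blast
  ultimately show ?thesis by simp
qed

end

lemma pigeonhole_three:
  assumes "card T = 3" "T \<subseteq> A \<union> C" "finite A" "finite C" "card A \<le> 2" "card C \<le> 2"
  obtains x y z where "T = {x, y, z}" "x \<noteq> y" "x \<noteq> z" "y \<noteq> z"
    "x \<in> A \<and> y \<in> A \<and> z \<in> C \<or> x \<in> C \<and> y \<in> C \<and> z \<in> A"
proof -
  obtain x y z where T: "T = {x, y, z}" "x \<noteq> y" "x \<noteq> z" "y \<noteq> z"
    using assms(1) by (auto simp: card_3_iff)
  have nA: "\<not> (x \<in> A \<and> y \<in> A \<and> z \<in> A)"
    using assms(1,3,5) T card_mono[of A T] by auto
  have nC: "\<not> (x \<in> C \<and> y \<in> C \<and> z \<in> C)"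
    using assms(1,4,6) T card_mono[of C T] by auto
  have un: "x \<in> A \<or> x \<in> C" "y \<in> A \<or> y \<in> C" "z \<in> A \<or> z \<in> C" using assms(2) T by auto
  consider "x \<in> A" "y \<in> A" "z \<in> C" | "x \<in> A" "z \<in> A" "y \<in> C" | "y \<in> A" "z \<in> A" "x \<in> C"
    | "x \<in> C" "y \<in> C" "z \<in> A" | "x \<in> C" "z \<in> C" "y \<in> A" | "y \<in> C" "z \<in> C" "x \<in> A"
    using un nA nC by blast
  then show ?thesis
  proof cases
    case 1 then show ?thesis using that[of x y z] T by auto
  next
    case 2 then show ?thesis using that[of x z y] T by auto
  next
    case 3 then show ?thesis using that[of y z x] T by auto
  next
    case 4 then show ?thesis using that[of x y z] T by auto
  next
    case 5 then show ?thesis using that[of x z y] T by auto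
  next
    case 6 then show ?thesis using that[of y z x] T by auto
  qed
qed

lemma card_le_2_fibres:
  assumes "finite X" "\<And>x. x \<in> X \<Longrightarrow> card {y \<in> X. f y = f x} \<le> 2"
  shows "card X \<le> 2 * card (f ` X)"
proof -
  have "card X = (\<Sum>r\<in>f ` X. card {y \<in> X. f y = r})"
    using sum.image_gen[OF assms(1), of "\<lambda>_. 1::nat" f] by simp
  also have "\<dots> \<le> (\<Sum>r\<in>f ` X. 2)" by (rule sum_mono) (use assms(2) in auto)
  finally show ?thesis by simp
qed

section \<open>Blocking the maximum independent sets of a tiled set\<close>

context sgraph
begin

lemma tilingD:
  assumes "tiling U P"
  shows "T \<in> P \<Longrightarrow> T \<subseteq> U" "T \<in> P \<Longrightarrow> gadget T" "x \<in> U \<Longrightarrow> \<exists>T\<in>P. x \<in> T"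
    "T \<in> P \<Longrightarrow> T' \<in> P \<Longrightarrow> x \<in> T \<Longrightarrow> x \<in> T' \<Longrightarrow> T = T'"
proof -
  show "T = T'" if "T \<in> P" "T' \<in> P" "x \<in> T" "x \<in> T'"
  proof (rule ccontr)
    assume "T \<noteq> T'"
    then have "disjnt T T'" using assms that unfolding tiling_def by (metis pairwiseD)
    then show False using that by (auto simp: disjnt_def)
  qed
qed (use assms in \<open>auto simp: tiling_def\<close>)

lemma tiling_card_parts:
  assumes "tiling U P" "finite U" "\<And>T. T \<in> P \<Longrightarrow> M T \<subseteq> T"
  shows "card (\<Union>T\<in>P. M T) = (\<Sum>T\<in>P. card (M T))"
proof (rule card_UN_disjoint)
  show "finite P" using assms tiling_finite by blast
  show "\<forall>T\<in>P. finite (M T)" using assms gadget_finite tilingD(2) finite_subset by metis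
  show "\<forall>T\<in>P. \<forall>T'\<in>P. T \<noteq> T' \<longrightarrow> M T \<inter> M T' = {}"
    using assms(3) tilingD(4)[OF assms(1)] by (metis disjoint_iff subsetD)
qed

lemma tiling_card:
  assumes "tiling U P" "finite U"
  shows "card U = (\<Sum>T\<in>P. card T)"
  using tiling_card_parts[OF assms, of "\<lambda>T. T"] assms(1) by (simp add: tiling_def)

lemma triangle_gadget:
  assumes "gadget T" "card T = 3" "x \<in> T" "y \<in> T" "x \<noteq> y"
  shows "adj x y"
proof -
  obtain d b g where g: "gadget_at d b g T" using assms(1) by (auto simp: gadget_def)
  have d: "d = 3" using gadget_card[OF g] assms(2) gadget_atD(1)[OF g]
    by (auto simp: gadget_alpha_def)
  obtain i j where ij: "i \<in> gadget_verts d" "j \<in> gadget_verts d" "x = g i" "y = g j"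
    using assms gadget_atD(4)[OF g] by auto
  have "j \<in> gnb d b i" using ij assms(5) attach_adjacent[of d i j b]
    by (auto simp: d gadget_verts_simps attach_verts_simps)
  then show ?thesis using gadget_atD(5)[OF g ij(1,2)] ij by simp
qed

text \<open>The chosen vertices have all three neighbours inside their tile. They can conflict
  neither with choices in other tiles nor with a set of vertices of degree at most 2.\<close>

lemma nontriangle_gadget:
  assumes "gadget T" "card T \<noteq> 3" "T \<subseteq> F" "subcubic F"
  obtains L where "L \<subseteq> T" "indep L" "3 * card L = card T"
    "\<And>x. x \<in> L \<Longrightarrow> nb F x \<subseteq> T \<and> card (nb F x) = 3"
proof -
  obtain d b g where g: "gadget_at d b g T" using assms(1) by (auto simp: gadget_def)
  have "d \<in> {1,2}" using gadget_card[OF g] assms(2) gadget_atD(1)[OF g]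
    by (auto simp: gadget_alpha_def)
  then obtain L where L: "L \<subseteq> gadget_verts d - attach_verts d" "card L = gadget_alpha d"
    "\<And>i j. i \<in> L \<Longrightarrow> j \<in> L \<Longrightarrow> j \<notin> gnb d b i"
    by (rule gadget_inner_set) blast
  have Lv: "L \<subseteq> gadget_verts d" using L(1) by blast
  show ?thesis
  proof (rule that[of "g ` L"])
    show "g ` L \<subseteq> T" using Lv gadget_atD(4)[OF g] by blast
    show "indep (g ` L)" unfolding indep_def using L(3) Lv gadget_atD(5)[OF g] by blast
    have "card (g ` L) = card L" using gadget_atD(3)[OF g] Lv by (meson card_image inj_on_subset)
    then show "3 * card (g ` L) = card T" using gadget_card[OF g] L(2) by simp
    fix x assume "x \<in> g ` L"
    then obtain i where i: "i \<in> gadget_verts d - attach_verts d" "x = g i" using L(1) by blast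
    have sub: "nb F x \<subseteq> T" using gadget_inner_nb[OF g i(1) assms(4,3)] i by simp
    have "nb T x \<subseteq> nb F x" using assms(3) by (rule nb_mono)
    then have "nb F x = nb T x" using sub by auto
    then show "nb F x \<subseteq> T \<and> card (nb F x) = 3" using sub gadget_card_nb[OF g, of i] i by simp
  qed
qed

text \<open>Only triangles can obstruct: every other gadget has a maximum independent set avoiding its
  attachment vertices. Choosing a vertex in each triangle so that no two chosen vertices are
  adjacent is a choice of distinct edges leaving the triangles, so Hall's condition applies,
  and a violating family of t triangles is a tree with t + 2 of its vertices in B.\<close>
lemma blocking:
  assumes F: "subcubic F" and P: "tiling F P" and B: "finite B" "card B \<le> 4"
    and low: "\<And>b. b \<in> B \<Longrightarrow> b \<in> F \<Longrightarrow> card (nb F b) \<le> 2"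
    and no: "\<And>J. J \<subseteq> F \<Longrightarrow> indep J \<Longrightarrow> 3 * card J = card F \<Longrightarrow> J \<inter> B \<noteq> {}"
  obtains (one) T where "T \<in> P" "card T = 3" "T \<subseteq> B"
  | (two) T1 T2 r1 r2 where "T1 \<in> P" "T2 \<in> P" "T1 \<noteq> T2" "card T1 = 3" "card T2 = 3"
    "r1 \<in> T1" "r2 \<in> T2" "adj r1 r2" "B = T1 \<union> T2 - {r1, r2}"
proof -
  define Tr where "Tr = {T \<in> P. card T = 3}"
  define out where "out x = {y \<in> F. adj x y \<and> (\<forall>T\<in>P. x \<in> T \<longrightarrow> y \<notin> T)}" for x
  \<comment> \<open>The value encodes the edge leaving the triangle at x, or the single vertex x if
    there is none. Vertices of different triangles have the same value if and only if they are
    adjacent.\<close>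
  define \<rho> where "\<rho> x = insert x (out x)" for x
  have finF: "finite F" using F by (rule subcubic_finite)
  have finP: "finite P" using P finF by (rule tiling_finite)
  have finTr: "finite Tr" using finP by (simp add: Tr_def)
  note PF = tilingD(1)[OF P] and gad = tilingD(2)[OF P] and uniq = tilingD(4)[OF P]
  have TrP: "T \<in> P" "card T = 3" if "T \<in> Tr" for T using that by (auto simp: Tr_def)
  have finT: "finite T" if "T \<in> P" for T using gad[OF that] by (rule gadget_finite)
  have out1: "y = y'" if T: "T \<in> Tr" "x \<in> T" and y: "y \<in> out x" "y' \<in> out x" for T x y y'
  proof (rule ccontr)
    assume ne: "y \<noteq> y'"
    have TP: "T \<in> P" using T TrP by blast
    have yT: "y \<notin> T" "y' \<notin> T" using y T TP by (auto simp: out_def)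
    have "adj x t \<and> t \<in> F" if "t \<in> T - {x}" for t
      using triangle_gadget[OF gad[OF TP] TrP(2)[OF T(1)] T(2), of t] that PF[OF TP] by auto
    moreover have "y \<in> F \<and> adj x y" "y' \<in> F \<and> adj x y'" using y by (auto simp: out_def)
    ultimately have "insert y (insert y' (T - {x})) \<subseteq> nb F x" by (simp add: subset_iff)
    then have "card (insert y (insert y' (T - {x}))) \<le> card (nb F x)"
      using finF by (intro card_mono finite_nb)
    moreover have "card (insert y (insert y' (T - {x}))) = 4"
      using ne yT finT[OF TP] T TrP(2)[OF T(1)] by simp
    moreover have "card (nb F x) \<le> 3" using F PF[OF TP] T(2) by (auto simp: subcubic_def)
    ultimately show False by simp
  qed
  have out_sym: "x \<in> out y" if "T \<in> P" "x \<in> T" "T' \<in> P" "y \<in> T'" "y \<in> out x" for x y T T'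
  proof -
    have y: "adj x y" "y \<notin> T" using that(1,2,5) by (auto simp: out_def)
    have "x \<notin> T''" if "T'' \<in> P" "y \<in> T''" for T''
    proof
      assume "x \<in> T''"
      then have "T = T''" using uniq \<open>T \<in> P\<close> \<open>x \<in> T\<close> that(1) by metis
      then show False using y(2) that(2) by simp
    qed
    then show ?thesis using PF[OF that(1)] that(2) adj_sym[OF y(1)] by (auto simp: out_def)
  qed
  have card_\<rho>: "card (\<rho> x) \<le> 2" "finite (\<rho> x)" if T: "T \<in> Tr" "x \<in> T" for T x
  proof -
    have fin: "finite (out x)" using finF by (simp add: out_def)
    have "card (out x) \<le> 1" using out1[OF T] by (metis One_nat_def card_le_Suc0_iff_eq fin)
    then show "card (\<rho> x) \<le> 2" "finite (\<rho> x)" using fin by (auto simp: \<rho>_def card_insert_if)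
  qed
  \<comment> \<open>Distinct representatives would give one vertex outside \<open>B\<close> in each
    triangle, pairwise nonadjacent. Together with the inner sets of the larger tiles they would form
    an independent third of \<open>F\<close> avoiding \<open>B\<close>.\<close>
  have "\<exists>K\<subseteq>Tr. card (\<Union>((\<lambda>T. \<rho> ` (T - B)) ` K)) < card K"
  proof (rule ccontr)
    assume "\<not> ?thesis"
    then have h: "card K \<le> card (\<Union>((\<lambda>T. \<rho> ` (T - B)) ` K))" if "K \<subseteq> Tr" for K
      using that by (meson not_less)
    have "\<exists>f. inj_on f Tr \<and> (\<forall>T\<in>Tr. f T \<in> \<rho> ` (T - B))"
      by (rule hall_marriage[OF finTr _ h]) (simp_all add: finT TrP)
    then obtain f where f: "inj_on f Tr" "\<forall>T\<in>Tr. f T \<in> \<rho> ` (T - B)" by blast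
    have "\<forall>T\<in>Tr. \<exists>x. x \<in> T - B \<and> \<rho> x = f T" using f(2) by (metis imageE)
    then obtain x where x: "\<And>T. T \<in> Tr \<Longrightarrow> x T \<in> T - B \<and> \<rho> (x T) = f T" by metis
    have "\<exists>L. L \<subseteq> T \<and> indep L \<and> 3 * card L = card T \<and> (\<forall>u\<in>L. nb F u \<subseteq> T \<and> card (nb F u) = 3)"
      if "T \<in> P - Tr" for T
    proof -
      have "gadget T" "card T \<noteq> 3" "T \<subseteq> F" using that gad PF by (auto simp: Tr_def)
      then show ?thesis using F by (rule nontriangle_gadget) blast
    qed
    then obtain L where L: "\<And>T. T \<in> P - Tr \<Longrightarrow> L T \<subseteq> T" "\<And>T. T \<in> P - Tr \<Longrightarrow> indep (L T)"
      "\<And>T. T \<in> P - Tr \<Longrightarrow> 3 * card (L T) = card T"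
      "\<And>T u. T \<in> P - Tr \<Longrightarrow> u \<in> L T \<Longrightarrow> nb F u \<subseteq> T \<and> card (nb F u) = 3"
      by metis
    define M where "M T = (if T \<in> Tr then {x T} else L T)" for T
    have M: "M T \<subseteq> T" if "T \<in> P" for T
      using that x[of T] L(1)[of T] by (auto simp: M_def)
    have M3: "3 * card (M T) = card T" if "T \<in> P" for T
      using that TrP(2)[of T] L(3)[of T] by (auto simp: M_def)
    \<comment> \<open>In a larger tile the chosen vertices have degree 3 in \<open>F\<close>,
      whereas those of \<open>B\<close> have degree at most 2.\<close>
    have MB: "u \<notin> B" if "T \<in> P" "u \<in> M T" for T u
    proof
      assume "u \<in> B"
      moreover have "u \<in> F" using that M PF by blast
      ultimately have "card (nb F u) \<le> 2" using low by blast
      then show False using that x[of T] L(4)[of T u] \<open>u \<in> B\<close> by (auto simp: M_def split: if_splits)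
    qed
    let ?J = "\<Union>T\<in>P. M T"
    have "?J \<subseteq> F" using M PF by blast
    moreover have "3 * card ?J = card F"
    proof -
      have "3 * card ?J = 3 * (\<Sum>T\<in>P. card (M T))" using tiling_card_parts[OF P finF M] by simp
      also have "\<dots> = (\<Sum>T\<in>P. card T)" unfolding sum_distrib_left by (rule sum.cong) (auto simp: M3)
      finally show ?thesis using tiling_card[OF P finF] by simp
    qed
    moreover have "indep ?J"
      unfolding indep_def
    proof (intro ballI notI)
      fix u v assume "u \<in> ?J" "v \<in> ?J" and uv: "adj u v"
      then obtain T T' where T: "T \<in> P" "u \<in> M T" "T' \<in> P" "v \<in> M T'" by blast
      have in_blocks: "u \<in> T" "v \<in> T'" "u \<in> F" "v \<in> F" using T M PF by blast+
      show False
      proof (cases "T = T'")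
        case True
        show ?thesis
        proof (cases "T \<in> Tr")
          case True
          then show ?thesis using T \<open>T = T'\<close> uv by (auto simp: M_def)
        next
          case False
          then show ?thesis using T \<open>T = T'\<close> uv L(2)[of T] by (auto simp: M_def indep_def)
        qed
      next
        case False
        have Tr1: "T \<in> Tr"
        proof (rule ccontr)
          assume "T \<notin> Tr"
          then have "nb F u \<subseteq> T" using L(4)[of T u] T by (simp add: M_def)
          then have "v \<in> T" using in_blocks uv by auto
          then show False using uniq[OF T(1,3)] in_blocks False by blast
        qed
        have Tr2: "T' \<in> Tr"
        proof (rule ccontr)
          assume "T' \<notin> Tr"
          then have "nb F v \<subseteq> T'" using L(4)[of T' v] T by (simp add: M_def)
          then have "u \<in> T'" using in_blocks adj_sym[OF uv] by auto
          then show False using uniq[OF T(1,3)] in_blocks False by blast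
        qed
        have ux: "u = x T" "v = x T'" using T Tr1 Tr2 by (auto simp: M_def)
        have "v \<notin> T''" if "T'' \<in> P" "u \<in> T''" for T''
          using uniq[OF that(1) T(1) that(2) in_blocks(1)] uniq[OF T(1,3) _ in_blocks(2)] False by blast
        then have v_out: "v \<in> out u" using in_blocks(4) uv by (auto simp: out_def)
        have u_out: "u \<in> out v" by (rule out_sym[OF T(1) in_blocks(1) T(3) in_blocks(2) v_out])
        have "out u = {v}" using out1[OF Tr1 in_blocks(1)] v_out by blast
        moreover have "out v = {u}" using out1[OF Tr2 in_blocks(2)] u_out by blast
        ultimately have "\<rho> u = \<rho> v" by (auto simp: \<rho>_def)
        then have "f T = f T'" using x[OF Tr1] x[OF Tr2] ux by simp
        then show False using f(1) Tr1 Tr2 False by (auto dest: inj_onD)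
      qed
    qed
    ultimately have "?J \<inter> B \<noteq> {}" using no by blast
    then show False using MB by blast
  qed
  then obtain K where K: "K \<subseteq> Tr" "card (\<Union>((\<lambda>T. \<rho> ` (T - B)) ` K)) < card K" by blast
  define X where "X = \<Union>K - B"
  have finK: "finite K" using K(1) finTr finite_subset by blast
  have KP: "K \<subseteq> P" using K(1) TrP by blast
  have finUK: "finite (\<Union>K)" using finK KP finT by blast
  have finX: "finite X" using finUK by (simp add: X_def)
  have "\<rho> ` X = \<Union>((\<lambda>T. \<rho> ` (T - B)) ` K)" unfolding X_def by blast
  then have \<rho>X: "card (\<rho> ` X) < card K" using K(2) by simp
  have cX: "card X \<le> 2 * card (\<rho> ` X)"
  proof (rule card_le_2_fibres[OF finX])
    fix x assume "x \<in> X"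
    then obtain T where T: "T \<in> Tr" "x \<in> T" using K(1) unfolding X_def by blast
    have "{y \<in> X. \<rho> y = \<rho> x} \<subseteq> \<rho> x" unfolding \<rho>_def by blast
    then show "card {y \<in> X. \<rho> y = \<rho> x} \<le> 2"
      using card_\<rho>[OF T] card_mono order_trans by meson
  qed
  have cUK: "card (\<Union>K) = 3 * card K"
  proof -
    have "card (\<Union>K) = (\<Sum>T\<in>K. card T)"
    proof (rule card_Union_disjoint)
      show "pairwise disjnt K" using P KP unfolding tiling_def by (meson pairwise_subset)
    qed (use KP finT in blast)
    also have "\<dots> = (\<Sum>T\<in>K. 3)" by (rule sum.cong) (use K(1) TrP in auto)
    finally show ?thesis by simp
  qed
  have split: "card (\<Union>K) = card X + card (\<Union>K \<inter> B)"
    unfolding X_def using finUK by (metis card_Diff_subset_Int card_mono finite_Int inf_le1 le_add_diff_inverse2 Int_commute)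
  have cKB: "card (\<Union>K \<inter> B) \<le> card B" using B(1) by (intro card_mono) auto
  \<comment> \<open>The count is 3 |K| \<le> 2 (|K| - 1) + 4: each value of \<open>\<rho>\<close>
    comes from at most two vertices of \<open>X\<close>, there are fewer values than triangles, and
    \<open>B\<close> covers at most four vertices.\<close>
  have "card K \<le> 2" using split cUK cX \<rho>X cKB B(2) by linarith
  moreover have "card K \<ge> 1" using \<rho>X by linarith
  ultimately consider "card K = 1" | "card K = 2" by linarith
  then show ?thesis
  proof cases
    case 1
    then obtain T where KT: "K = {T}" by (auto simp: card_1_singleton_iff)
    have "X = {}" using 1 \<rho>X finX by simp
    then have "T \<subseteq> B" using KT by (auto simp: X_def)
    moreover have "T \<in> Tr" using KT K(1) by blast
    ultimately show ?thesis using one[of T] TrP by blast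
  next
    case 2
    then obtain T1 T2 where KT: "K = {T1, T2}" "T1 \<noteq> T2" by (auto simp: card_2_iff)
    have Tr12: "T1 \<in> Tr" "T2 \<in> Tr" using KT K(1) by auto
    have c1: "card (\<rho> ` X) \<le> 1" using 2 \<rho>X by linarith
    \<comment> \<open>Two triangles make the count an equality: exactly two of the six vertices
      escape \<open>B\<close>, and as they share their value of \<open>\<rho>\<close> they are
      adjacent.\<close>
    have cX2: "card X = 2" and cB: "card (\<Union>K \<inter> B) = card B"
      using split cUK cX c1 cKB B(2) 2 by linarith+
    have BK: "B \<subseteq> \<Union>K" using cB B(1) by (metis card_subset_eq inf_le1 inf_commute inf_le2)
    obtain s1 s2 where s: "X = {s1, s2}" "s1 \<noteq> s2" using cX2 unfolding card_2_iff by blast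
    have "\<rho> s1 \<in> \<rho> ` X" "\<rho> s2 \<in> \<rho> ` X" using s(1) by simp_all
    then have "\<rho> s1 = \<rho> s2"
      using c1 card_le_Suc0_iff_eq[OF finite_imageI[OF finX], of \<rho>] unfolding One_nat_def by blast
    then have "s2 \<in> insert s1 (out s1)" unfolding \<rho>_def by (metis insertI1)
    then have o: "s2 \<in> out s1" using s(2) by simp
    have sK: "s1 \<in> T1 \<union> T2" "s2 \<in> T1 \<union> T2" using s KT by (auto simp: X_def)
    have a: "adj s1 s2" using o by (simp add: out_def)
    have nT: "s2 \<notin> T" if "s1 \<in> T" "T \<in> {T1, T2}" for T
      using o that TrP Tr12 unfolding out_def by blast
    have BX: "B = T1 \<union> T2 - {s1, s2}" using BK KT s unfolding X_def by auto
    show ?thesis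
    proof (cases "s1 \<in> T1")
      case True
      then have "s2 \<in> T2" using nT sK by blast
      then show ?thesis using two[of T1 T2 s1 s2] TrP Tr12 KT True a BX by blast
    next
      case False
      then have s12: "s1 \<in> T2" "s2 \<in> T1" using nT sK by blast+
      have "B = T1 \<union> T2 - {s2, s1}" using BX by auto
      then show ?thesis using two[of T1 T2 s2 s1] TrP Tr12 KT s12 adj_sym[OF a] by blast
    qed
  qed
qed

end

section \<open>Tight sets without cubic components\<close>

context sgraph begin

lemma card_nb_outside:
  assumes "subcubic U" "F \<subseteq> U" "b \<in> U" "x \<in> U - F" "adj b x"
  shows "card (nb F b) \<le> 2"
proof -
  have "insert x (nb F b) \<subseteq> nb U b" using assms by auto
  then have "card (insert x (nb F b)) \<le> card (nb U b)"
    using assms(1) by (intro card_mono finite_nb subcubic_finite)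
  moreover have "finite (nb F b)" using assms by (meson finite_nb finite_subset subcubic_finite)
  ultimately show ?thesis using assms by (auto simp: subcubic_def)
qed

text \<open>Four vertices have to be covered by \<open>a1\<close> and \<open>a2\<close>, each with
  at most two neighbours in \<open>F\<close>, so each takes exactly two. Whether these two lie in
  the same triangle decides between the two gadgets on nine vertices.\<close>

lemma nine_config:
  assumes U: "subcubic U" and sub: "{v, a1, a2} \<union> T1 \<union> T2 \<subseteq> U" "T1 \<union> T2 \<subseteq> F"
    and v: "adj v a1" "adj v a2" "a1 \<noteq> a2" "v \<notin> F" "a1 \<notin> F" "a2 \<notin> F"
    and T: "gadget T1" "gadget T2" "card T1 = 3" "card T2 = 3" "T1 \<inter> T2 = {}"
    and r: "r1 \<in> T1" "r2 \<in> T2" "adj r1 r2"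
    and B: "T1 \<union> T2 - {r1, r2} \<subseteq> nb F a1 \<union> nb F a2" "card (nb F a1) \<le> 2" "card (nb F a2) \<le> 2"
    and fin: "finite F"
  shows "gadget ({v, a1, a2} \<union> T1 \<union> T2)"
proof -
  have "card (T1 - {r1}) = 2" "card (T2 - {r2}) = 2" using T(3,4) r by auto
  then obtain p1 q1 p2 q2 where pq: "T1 - {r1} = {p1, q1}" "p1 \<noteq> q1" "T2 - {r2} = {p2, q2}" "p2 \<noteq> q2"
    by (auto simp: card_2_iff)
  have T1: "T1 = {p1, q1, r1}" "p1 \<noteq> r1" "q1 \<noteq> r1" using pq(1) r(1) by auto
  have T2: "T2 = {p2, q2, r2}" "p2 \<noteq> r2" "q2 \<noteq> r2" using pq(3) r(2) by auto
  note tri = triangle_gadget[OF T(1,3)] triangle_gadget[OF T(2,4)]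
  have e1: "adj p1 q1" "adj q1 r1" "adj p1 r1" by (rule tri(1); use T1 pq in simp)+
  have e2: "adj p2 q2" "adj q2 r2" "adj p2 r2" by (rule tri(2); use T2 pq in simp)+
  have dj: "p1 \<noteq> p2" "p1 \<noteq> q2" "p1 \<noteq> r2" "q1 \<noteq> p2" "q1 \<noteq> q2" "q1 \<noteq> r2" "r1 \<noteq> p2" "r1 \<noteq> q2" "r1 \<noteq> r2"
    using T(5) T1 T2 by auto
  have "T1 \<union> T2 - {r1, r2} = {p1, q1, p2, q2}" using T1 T2 dj pq(2,4) by auto
  then have cov0: "adj a1 w \<or> adj a2 w" if "w \<in> {p1, q1, p2, q2}" for w
    using B(1) that nb_iff by (metis UnE subsetD)
  have main: "gadget ({v, x, y} \<union> T1 \<union> T2)"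
    \<comment> \<open>By symmetry x is the one of \<open>a1\<close>, \<open>a2\<close> that is
      adjacent to \<open>p1\<close>; three choices remain for its second neighbour.\<close>
    if xy: "{x, y} = {a1, a2}" "adj x p1" for x y
  proof -
    have vx: "adj v x" "adj v y" "x \<noteq> y" "x \<notin> F" "y \<notin> F" using xy v by (auto simp: doubleton_eq_iff)
    have Fpq: "p1 \<in> F" "q1 \<in> F" "p2 \<in> F" "q2 \<in> F" "r1 \<in> F" "r2 \<in> F" using sub(2) T1 T2 by auto
    have cov: "adj x w \<or> adj y w" if "w \<in> {q1, p2, q2}" for w
      using cov0[of w] that xy(1) by (auto simp: doubleton_eq_iff)
    have c: "card (nb F x) \<le> 2" "card (nb F y) \<le> 2" using B(2,3) xy(1) by (auto simp: doubleton_eq_iff)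
    have not3: "\<not> (adj w s1 \<and> adj w s2 \<and> adj w s3)"
      if "card (nb F w) \<le> 2" "s1 \<in> F" "s2 \<in> F" "s3 \<in> F" "s1 \<noteq> s2" "s1 \<noteq> s3" "s2 \<noteq> s3" for w s1 s2 s3
    proof
      assume "adj w s1 \<and> adj w s2 \<and> adj w s3"
      then have "card {s1, s2, s3} \<le> card (nb F w)" using that fin by (intro card_mono finite_nb) auto
      then show False using that by simp
    qed
    have ins: "v \<noteq> x" "v \<noteq> y" using vx by auto
    have d: "distinct [v, x, y, p1, q1, r1, p2, q2, r2]" "distinct [v, x, y, q1, p1, r1, p2, q2, r2]"
      "distinct [v, x, y, p1, q1, r1, q2, p2, r2]"
      using ins vx Fpq v(4) T1 T2 pq dj by auto
    have s: "{v, x, y, p1, q1, r1, p2, q2, r2} = {v, x, y} \<union> T1 \<union> T2"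
      "{v, x, y, p1, q1, r1, q2, p2, r2} = {v, x, y} \<union> T1 \<union> T2" using T1 T2 by auto
    have sU: "{v, x, y} \<union> T1 \<union> T2 \<subseteq> U" using sub(1) xy(1) by (auto simp: doubleton_eq_iff)
    have yy: "adj x q1 \<and> adj y p2 \<and> adj y q2 \<or> adj x q2 \<and> adj y q1 \<and> adj y p2 \<or> adj x p2 \<and> adj y q1 \<and> adj y q2"
    proof -
      have "\<not> (adj y q1 \<and> adj y p2 \<and> adj y q2)" by (rule not3[OF c(2)]) (use Fpq pq dj in auto)
      moreover have "\<not> (adj x p1 \<and> adj x q1 \<and> adj x p2)" by (rule not3[OF c(1)]) (use Fpq pq dj in auto)
      moreover have "\<not> (adj x p1 \<and> adj x q1 \<and> adj x q2)" by (rule not3[OF c(1)]) (use Fpq pq dj in auto)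
      moreover have "\<not> (adj x p1 \<and> adj x p2 \<and> adj x q2)" by (rule not3[OF c(1)]) (use Fpq pq dj in auto)
      ultimately show ?thesis using cov[of q1] cov[of p2] cov[of q2] xy(2) by auto
    qed
    then consider "adj x q1" "adj y p2" "adj y q2" | "adj x q2" "adj y q1" "adj y p2"
      | "adj x p2" "adj y q1" "adj y q2" by blast
    then show ?thesis
    proof cases
      case 1
      show ?thesis unfolding s(1)[symmetric]
        by (rule nine_gadgetI[OF U]) (use s sU d vx e1 e2 r(3) 1 xy(2) in simp_all)
    next
      case 2
      show ?thesis unfolding s(1)[symmetric]
        by (rule nine_gadgetI[OF U]) (use s sU d vx e1 e2 r(3) 2 xy(2) in simp_all)
    next
      case 3
      \<comment> \<open>The crossing case again, with the names \<open>p2\<close> and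
        \<open>q2\<close> exchanged.\<close>
      have "adj q2 p2" using e2(1) by (rule adj_sym)
      then show ?thesis unfolding s(2)[symmetric]
        by (intro nine_gadgetI[OF U]) (use s sU d vx e1 e2 r(3) 3 xy(2) in simp_all)
    qed
  qed
  consider "adj a1 p1" | "adj a2 p1" using cov0[of p1] by auto
  then show ?thesis
  proof cases
    case 1
    then show ?thesis using main[of a1 a2] by simp
  next
    case 2
    then show ?thesis using main[of a2 a1] by (simp add: insert_commute)
  qed
qed

text \<open>A vertex v of low degree and its two neighbours complete exactly one gadget. Adjacent
  neighbours give a triangle, one blocked triangle gives a subdivided K4 with v as a subdivision
  vertex, and two blocked triangles give a gadget on nine vertices with v as its attachment
  vertex.\<close>

lemma tight_deficient_tiled:
  assumes "subcubic U" "deficient U" "tight U"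
  shows "tiled U"
  using assms
proof (induction "card U" arbitrary: U rule: less_induct)
  case less
  note U = less.prems(1) and dU = less.prems(2) and tU = less.prems(3)
  have fin: "finite U" using U by (rule subcubic_finite)
  show ?case
  proof (cases "U = {}")
    case True
    then show ?thesis by (simp add: tiled_empty)
  next
    case False
    then obtain v where v: "v \<in> U" "card (nb U v) < 3" using dU deficient_low_vertex by blast
    define F where "F = U - insert v (nb U v)"
    have FU: "F \<subseteq> U" "v \<notin> F" by (auto simp: F_def)
    have sF: "subcubic F" using U FU(1) by (rule subcubic_mono)
    have dF: "deficient F" using U dU FU(1) by (rule deficient_mono)
    have finF: "finite F" using sF by (rule subcubic_finite)
    have cF: "card F + (card (nb U v) + 1) = card U"
      unfolding F_def using card_closed_nb[OF fin v(1)] .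
    have ext: "3 * (card J + 1) \<le> card U" if "J \<subseteq> F" "indep J" for J
    proof -
      have "indep (insert v J)" using that by (auto simp: indep_insert F_def)
      moreover have "insert v J \<subseteq> U" using that v FU by auto
      ultimately have "3 * card (insert v J) \<le> card U" using tU unfolding tight_def by blast
      moreover have "card (insert v J) = card J + 1"
        using that finF FU(2) by (subst card_insert_disjoint) (auto intro: finite_subset)
      ultimately show ?thesis by simp
    qed
    obtain J where J: "J \<subseteq> F" "indep J" "card F \<le> 3 * card J"
      using deficient_third[OF sF dF] by blast
    \<comment> \<open>With degree at most 1, v together with an independent third of
      \<open>F\<close> would exceed a third of \<open>U\<close>, since only two vertices or fewer
      are removed.\<close>
    have deg2: "card (nb U v) = 2"
    proof (rule antisym)
      show "card (nb U v) \<le> 2" using v(2) by simp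
      have "2 \<le> d" if "3 * (j + 1) \<le> u" "f \<le> 3 * j" "f + (d + 1) = u" for d j u f :: nat
        using that by presburger
      from this[OF ext[OF J(1,2)] J(3) cF] show "2 \<le> card (nb U v)" .
    qed
    then obtain u w where uw: "nb U v = {u, w}" "u \<noteq> w" by (auto simp: card_2_iff)
    have uwU: "u \<in> U" "w \<in> U" "adj v u" "adj v w" using uw(1) nb_iff[of _ U v] by blast+
    have uF: "u \<notin> F" "w \<notin> F" by (auto simp: F_def uw(1))
    have UF: "U = {v, u, w} \<union> F" using uwU v(1) uw(1) by (auto simp: F_def)
    have vuw: "v \<noteq> u" "v \<noteq> w" using uwU by auto
    have cU: "card U = card F + 3" using cF deg2 by simp
    have tF: "tight F" unfolding tight_def
    proof (intro allI impI)
      fix I assume "I \<subseteq> F" "indep I"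
      then show "3 * card I \<le> card F" using ext[of I] cU by simp
    qed
    have "tiled F" using less.hyps[OF _ sF dF tF] cU by simp
    then obtain P where P: "tiling F P" unfolding tiled_def by blast
    have dis: "{v, u, w} \<inter> F = {}" using uF FU by auto
    show ?thesis
    proof (cases "adj u w")
      case True
      have "gadget {v, u, w}" by (rule tri_gadgetI) (use uwU True in auto)
      then show ?thesis
        using tiled_replace[OF P, of "{}" "{v, u, w}"] dis UF by simp
    next
      case False
      define B where "B = nb F u \<union> nb F w"
      have c2: "card (nb F u) \<le> 2" "card (nb F w) \<le> 2"
        using card_nb_outside[OF U FU(1) uwU(1), of v] card_nb_outside[OF U FU(1) uwU(2), of v]
          v(1) FU(2) adj_sym[OF uwU(3)] adj_sym[OF uwU(4)] by auto
      have finB: "finite B" using finF by (simp add: B_def finite_nb)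
      have cB: "card B \<le> 4" unfolding B_def using c2 card_Un_le[of "nb F u" "nb F w"] by linarith
      have BF: "B \<subseteq> F" by (auto simp: B_def)
      have low: "card (nb F b) \<le> 2" if "b \<in> B" "b \<in> F" for b
      proof -
        have "adj b u \<or> adj b w" using that by (auto simp: B_def adj_sym)
        then show ?thesis
          using card_nb_outside[OF U FU(1), of b u] card_nb_outside[OF U FU(1), of b w] uwU uF that(2) FU(1)
          by blast
      qed
      \<comment> \<open>Only three vertices lie outside \<open>F\<close>, so they can contribute one
        vertex but not both u and w.\<close>
      have no: "J \<inter> B \<noteq> {}" if J: "J \<subseteq> F" "indep J" "3 * card J = card F" for J
      proof
        assume e: "J \<inter> B = {}"
        have "\<not> adj u j \<and> \<not> adj w j" if "j \<in> J" for j
        proof -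
          have "j \<in> F" "j \<notin> B" using that J(1) e by blast+
          then show ?thesis by (simp add: B_def)
        qed
        then have "indep (insert u (insert w J))" using J(2) False by (simp add: indep_insert)
        moreover have "insert u (insert w J) \<subseteq> U" using J uwU FU by auto
        ultimately have "3 * card (insert u (insert w J)) \<le> card U" using tU unfolding tight_def by blast
        moreover have "card (insert u (insert w J)) = card J + 2"
        proof -
          have "finite J" "u \<notin> J" "w \<notin> J" using J(1) finF uF finite_subset by blast+
          then show ?thesis using uw(2) by simp
        qed
        ultimately show False using J(3) cU by linarith
      qed
      show ?thesis
      proof (rule blocking[OF sF P finB cB])
        show "card (nb F b) \<le> 2" if "b \<in> B" "b \<in> F" for b using low[OF that] .
        show "J \<inter> B \<noteq> {}" if "J \<subseteq> F" "indep J" "3 * card J = card F" for J using no[OF that] .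
      next
        fix T assume one: "T \<in> P" "card T = 3" "T \<subseteq> B"
        obtain x y z where T: "T = {x, y, z}" "x \<noteq> y" "x \<noteq> z" "y \<noteq> z"
          "x \<in> nb F u \<and> y \<in> nb F u \<and> z \<in> nb F w \<or> x \<in> nb F w \<and> y \<in> nb F w \<and> z \<in> nb F u"
          using pigeonhole_three[OF one(2), of "nb F u" "nb F w"] one(3) c2 finF
          by (metis B_def finite_nb)
        have TF: "T \<subseteq> F" using one(3) BF by blast
        note tri = triangle_gadget[OF tilingD(2)[OF P one(1)] one(2)]
        have e: "adj z x" "adj z y" "adj x y" by (rule tri; use T in simp)+
        \<comment> \<open>Here b sees two corners x, y of the triangle and a sees the third corner
          z. The path z a v b replaces the missing edge zb of the K4 on z, b, x, y.\<close>
        have k4: "gadget {z, b, x, y, a, v}"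
          if "{a, b} = {u, w}" "adj b x" "adj b y" "adj a z" for a b
        proof (rule k4star_gadgetI[OF U])
          have ab: "a \<in> U" "b \<in> U" "a \<notin> F" "b \<notin> F" "adj v a" "adj v b" "a \<noteq> b"
            using that(1) uwU uF uw(2) by (auto simp: doubleton_eq_iff)
          show "{z, b, x, y, a, v} \<subseteq> U" using ab TF FU v(1) T(1) by auto
          show "distinct [z, b, x, y, a, v]" using ab TF FU T by auto
          show "adj z a" "adj a v" "adj v b" using ab that adj_sym by blast+
        qed (use e that in auto)
        have "gadget ({v, u, w} \<union> \<Union>{T})"
        proof -
          consider "adj u x" "adj u y" "adj w z" | "adj w x" "adj w y" "adj u z" using T(5) by auto
          then show ?thesis
          proof cases
            case 1
            have "{v, u, w} \<union> \<Union>{T} = {z, u, x, y, w, v}" using T(1) by auto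
            then show ?thesis using k4[of w u] 1 by (simp add: insert_commute)
          next
            case 2
            have "{v, u, w} \<union> \<Union>{T} = {z, w, x, y, u, v}" using T(1) by auto
            then show ?thesis using k4[of u w] 2 by (simp add: insert_commute)
          qed
        qed
        then show ?thesis using tiled_replace[OF P, of "{T}" "{v, u, w}"] one(1) dis UF by simp
      next
        fix T1 T2 r1 r2 assume two: "T1 \<in> P" "T2 \<in> P" "T1 \<noteq> T2" "card T1 = 3" "card T2 = 3"
          "r1 \<in> T1" "r2 \<in> T2" "adj r1 r2" "B = T1 \<union> T2 - {r1, r2}"
        have TF: "T1 \<union> T2 \<subseteq> F" using tilingD(1)[OF P] two(1,2) by blast
        have dj: "T1 \<inter> T2 = {}" using tilingD(4)[OF P two(1,2)] two(3) by blast
        have "gadget ({v, u, w} \<union> T1 \<union> T2)"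
        proof (rule nine_config[OF U _ TF])
          show "{v, u, w} \<union> T1 \<union> T2 \<subseteq> U" using TF UF by blast
          show "T1 \<union> T2 - {r1, r2} \<subseteq> nb F u \<union> nb F w" using two(9) by (simp add: B_def)
        qed (use uwU uw(2) FU uF two dj c2 finF tilingD(2)[OF P] in auto)
        then have "gadget ({v, u, w} \<union> \<Union>{T1, T2})" by (simp add: Un_assoc)
        then show ?thesis using tiled_replace[OF P, of "{T1, T2}" "{v, u, w}"] two(1,2) dis UF by simp
      qed
    qed
  qed
qed

end

section \<open>Cubic graphs\<close>

context sgraph
begin

lemma triangle_nb:
  assumes "subcubic U" "T \<subseteq> U" "gadget T" "card T = 3" "t \<in> T" "s \<in> U - T" "adj t s"
  shows "nb U t = insert s (T - {t})"
proof -
  have finT: "finite T" using assms(3) by (rule gadget_finite)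
  have "card (T - {t}) = 2" using assms(4,5) by simp
  then obtain x y where xy: "T - {t} = {x, y}" "x \<noteq> y" unfolding card_2_iff by blast
  then have xT: "x \<in> T" "y \<in> T" "x \<noteq> t" "y \<noteq> t" by auto
  have "adj t x" "adj t y" using triangle_gadget[OF assms(3,4,5)] xT by auto
  then have "nb U t = {s, x, y}"
    by (intro nb_eq3) (use assms xT xy in auto)
  then show ?thesis using xy by simp
qed

end

text \<open>Connectedness is stated through sets closed under taking neighbours, since it is applied
  either to rule out a cubic component of a proper subset or to conclude that a closed configuration
  is the whole graph.\<close>

locale ccubic = sgraph adj for adj :: "'a \<Rightarrow> 'a \<Rightarrow> bool" +
  fixes V :: "'a set"
  assumes finV: "finite V" and neV: "V \<noteq> {}" and deg3: "v \<in> V \<Longrightarrow> card (nb V v) = 3"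
    and conn: "W \<subseteq> V \<Longrightarrow> W \<noteq> {} \<Longrightarrow> (\<And>w. w \<in> W \<Longrightarrow> nb V w \<subseteq> W) \<Longrightarrow> W = V"
begin

lemma subV: "subcubic V"
  by (simp add: subcubic_def finV deg3)

lemma subU: "U \<subseteq> V \<Longrightarrow> subcubic U"
  using subV by (rule subcubic_mono)

text \<open>A cubic union of components of \<open>U\<close> would be closed under neighbours in the
  whole graph, hence equal to \<open>V\<close>.\<close>

lemma proper_deficient:
  assumes "U \<subset> V"
  shows "deficient U"
  unfolding deficient_def
proof (intro allI impI, rule ccontr)
  fix W assume W: "W \<subseteq> U" "W \<noteq> {}" "\<forall>w\<in>W. nb U w \<subseteq> W" and n: "\<not> (\<exists>w\<in>W. card (nb U w) < 3)"
  have "W = V"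
  proof (rule conn)
    show "W \<subseteq> V" using W assms by blast
    fix w assume w: "w \<in> W"
    have "nb U w \<subseteq> nb V w" using assms by (intro nb_mono) auto
    moreover have "card (nb U w) \<ge> 3" using n w by (meson not_less)
    moreover have "card (nb V w) = 3" "finite (nb V w)" using w W assms by (auto simp: deg3 finV finite_nb)
    ultimately have "nb U w = nb V w" by (metis card_mono card_subset_eq le_antisym)
    then show "nb V w \<subseteq> W" using bspec[OF W(3) w] by metis
  qed (rule W)
  then show False using W assms by blast
qed

lemma proper_third:
  assumes "U \<subset> V"
  obtains I where "I \<subseteq> U" "indep I" "card U \<le> 3 * card I"
  using assms by (meson deficient_third proper_deficient psubset_imp_subset subU)

lemma proper_tiled: "U \<subset> V \<Longrightarrow> tight U \<Longrightarrow> tiled U"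
  by (meson proper_deficient psubset_imp_subset subU tight_deficient_tiled)

lemma nb3:
  assumes "v \<in> V" "x \<in> V" "y \<in> V" "z \<in> V" "adj v x" "adj v y" "adj v z"
    "x \<noteq> y" "x \<noteq> z" "y \<noteq> z"
  shows "nb V v = {x, y, z}"
  using nb_eq3[OF subV] assms by blast

lemma third_nb:
  assumes "v \<in> V" "x \<in> V" "y \<in> V" "adj v x" "adj v y" "x \<noteq> y"
  obtains z where "nb V v = {x, y, z}" "z \<noteq> x" "z \<noteq> y" "z \<in> V" "adj v z" "z \<noteq> v"
proof -
  have "card (nb V v - {x, y}) = 1"
    using assms by (subst card_Diff_subset) (auto simp: deg3)
  then obtain z where z: "nb V v - {x, y} = {z}" by (auto simp: card_1_singleton_iff)
  have zz: "z \<in> nb V v" "z \<noteq> x" "z \<noteq> y" using z by blast+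
  have "{x, y} \<subseteq> nb V v" using assms by simp
  then have "nb V v = {x, y, z}" using z by blast
  moreover have "z \<in> V" "adj v z" using zz by simp_all
  moreover have "z \<noteq> v" using \<open>adj v z\<close> by auto
  ultimately show ?thesis using that zz by blast
qed

lemma card_le_tight: "tight V \<Longrightarrow> I \<subseteq> V \<Longrightarrow> indep I \<Longrightarrow> 3 * card I \<le> card V"
  by (simp add: tight_def)

lemma card_V_Diff: "X \<subseteq> V \<Longrightarrow> card (V - X) + card X = card V"
  using finV by (simp add: card_Diff_subset card_mono finite_subset)

text \<open>If every independent set is smaller than a third, then removing one vertex v leaves a
  tight, hence tiled set, and the neighbours of v block all its independent thirds. Three blockers
  suffice only for a single triangle, and then the graph is K4.\<close>

lemma brooks:
  assumes "card V \<noteq> 4"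
  obtains I where "I \<subseteq> V" "indep I" "card V \<le> 3 * card I"
proof -
  have "\<exists>I\<subseteq>V. indep I \<and> card V \<le> 3 * card I"
  proof (rule ccontr)
    assume "\<not> ?thesis"
    then have less: "3 * card I < card V" if "I \<subseteq> V" "indep I" for I
      using that by (meson not_less)
    obtain v where v: "v \<in> V" using neV by blast
    define F where "F = V - {v}"
    have FV: "F \<subset> V" "F \<subseteq> V" using v by (auto simp: F_def)
    have cF: "card F + 1 = card V" using card_V_Diff[of "{v}"] v by (simp add: F_def)
    obtain I where I: "I \<subseteq> F" "indep I" "card F \<le> 3 * card I" using proper_third[OF FV(1)] .
    \<comment> \<open>The strict inequality absorbs the single vertex that is lost.\<close>
    have tF: "tight F" unfolding tight_def
    proof (intro allI impI)
      fix J assume "J \<subseteq> F" "indep J"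
      then have "3 * card J < card V" using less FV by blast
      then show "3 * card J \<le> card F" using cF by linarith
    qed
    obtain P where P: "tiling F P" using proper_tiled[OF FV(1) tF] unfolding tiled_def by blast
    have cB: "card (nb V v) = 3" by (rule deg3[OF v])
    have NF: "nb V v \<subseteq> F" by (auto simp: F_def)
    show False
    proof (rule blocking[OF subU[OF FV(2)] P finite_nb[OF finV]])
      show "card (nb V v) \<le> 4" by (simp add: cB)
      show "card (nb F b) \<le> 2" if "b \<in> nb V v" "b \<in> F" for b
        by (rule card_nb_outside[OF subV FV(2), of b v]) (use that v in \<open>auto simp: F_def adj_sym\<close>)
      show "J \<inter> nb V v \<noteq> {}" if J: "J \<subseteq> F" "indep J" "3 * card J = card F" for J
      proof
        assume e: "J \<inter> nb V v = {}"
        have JV: "J \<subseteq> V" "v \<notin> J" using J by (auto simp: F_def)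
        have "\<not> adj v j" if "j \<in> J" for j
          using e JV(1) that nb_iff[of j V v] by blast
        then have "indep (insert v J)" using J by (simp add: indep_insert)
        then have "3 * card (insert v J) < card V" using less JV v by simp
        moreover have "card (insert v J) = card J + 1" using JV finV finite_subset by fastforce
        ultimately show False using J(3) cF by linarith
      qed
    next
      fix T assume T: "T \<in> P" "card T = 3" "T \<subseteq> nb V v"
      have gT: "gadget T" using tilingD(2)[OF P] T by blast
      have TF: "T \<subseteq> F" using tilingD(1)[OF P] T by blast
      have Tn: "T = nb V v" using T cB finV by (metis card_subset_eq finite_nb)
      \<comment> \<open>Each vertex of the triangle on the neighbours of v has v as its third
        neighbour, so these four vertices are closed under neighbours.\<close>
      have "insert v T = V"
      proof (rule conn)
        show "insert v T \<subseteq> V" using TF FV v by blast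
        fix w assume w: "w \<in> insert v T"
        show "nb V w \<subseteq> insert v T"
        proof (cases "w = v")
          case False
          then have wT: "w \<in> T" using w by simp
          have "adj w v" using wT T(3) adj_sym by auto
          moreover have "v \<in> V - T" using v TF by (auto simp: F_def)
          ultimately have "nb V w = insert v (T - {w})"
            using triangle_nb[OF subV _ gT T(2) wT] TF FV by blast
          then show ?thesis by blast
        qed (use Tn in auto)
      qed simp
      moreover have "v \<notin> T" using TF by (auto simp: F_def)
      then have "card (insert v T) = 4" using gadget_finite[OF gT] T(2) by simp
      ultimately have "card V = 4" by simp
      then show False using assms by simp
    next
      fix T1 T2 r1 r2 assume T: "T1 \<in> P" "T2 \<in> P" "T1 \<noteq> T2" "card T1 = 3" "card T2 = 3"
        "r1 \<in> T1" "r2 \<in> T2" "nb V v = T1 \<union> T2 - {r1, r2}"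
      \<comment> \<open>At least four blocked vertices would be needed, but v has only three
        neighbours.\<close>
      have fin: "finite T1" "finite T2" using tilingD(2)[OF P] T gadget_finite by blast+
      have "T1 \<inter> T2 = {}" using tilingD(4)[OF P T(1,2)] T(3) by blast
      then have "card (T1 \<union> T2) = 6" using fin T by (simp add: card_Un_disjoint)
      moreover have "card {r1, r2} \<le> 2" by (simp add: card_insert_if)
      moreover have "card (T1 \<union> T2) - card {r1, r2} \<le> card (T1 \<union> T2 - {r1, r2})"
        by (rule diff_card_le_card_Diff) simp
      ultimately show False using cB T(8) by simp
    qed
  qed
  then show ?thesis using that by blast
qed

text \<open>In a triangle-free graph, exchanges against a maximum independent set \<open>I\<close>
  of size n/3 determine the neighbourhoods so completely that a last exchange of three vertices for
  four becomes possible.\<close>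

lemma exists_triangle:
  assumes tV: "tight V" and I: "I \<subseteq> V" "indep I" "3 * card I = card V"
  obtains a b c where "a \<in> V" "b \<in> V" "c \<in> V" "adj a b" "adj b c" "adj a c"
proof -
  have False if nt: "\<And>a b c. a \<in> V \<Longrightarrow> b \<in> V \<Longrightarrow> c \<in> V \<Longrightarrow> adj a b \<Longrightarrow> adj b c \<Longrightarrow> \<not> adj a c"
  proof -
    have finI: "finite I" using I finV finite_subset by blast
    \<comment> \<open>Replacing \<open>N\<close> by \<open>B\<close> would enlarge \<open>I\<close>.
      All contradictions in this proof are instances of this exchange.\<close>
    have exch: False if B: "B \<subseteq> V - I" "indep B" "N \<subseteq> I" "\<And>b. b \<in> B \<Longrightarrow> nb I b \<subseteq> N" "card N < card B" for B N
    proof -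
      have fin: "finite B" "finite N" using B finV finI by (meson finite_Diff finite_subset)+
      have "indep ((I - N) \<union> B)"
        unfolding indep_Un
      proof (intro conjI ballI)
        show "indep (I - N)" using I(2) by (rule indep_subset) blast
        fix u v assume "u \<in> I - N" "v \<in> B"
        then show "\<not> adj u v" using B(4)[of v] adj_sym[of u v] by auto
      qed (rule B)
      then have "3 * card ((I - N) \<union> B) \<le> card V" using B I by (intro card_le_tight[OF tV]) auto
      moreover have "card ((I - N) \<union> B) = card (I - N) + card B"
        using fin finI B by (intro card_Un_disjoint) auto
      moreover have "card (I - N) + card N = card I"
        using fin finI B by (simp add: card_Diff_subset card_mono)
      ultimately show False using B(5) I(3) by linarith
    qed
    define Z where "Z = V - I"
    have finZ: "finite Z" using finV by (simp add: Z_def)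
    define k where "k x = card (nb I x)" for x
    have k1: "k x \<ge> 1" if "x \<in> Z" for x
    proof (rule ccontr)
      assume "\<not> ?thesis"
      then have "card (nb I x) = 0" unfolding k_def by linarith
      then have e: "nb I x = {}" using finite_nb[OF finI, of x] by simp
      show False
        by (rule exch[of "{x}" "{}"]) (use e that in \<open>simp_all add: Z_def indep_def\<close>)
    qed
    have sumk: "(\<Sum>x\<in>Z. k x) = 3 * card I"
    proof -
      have "(\<Sum>x\<in>Z. k x) = (\<Sum>x\<in>Z. \<Sum>w\<in>I. if adj x w then 1 else 0)"
        using finI by (simp add: k_def nb_def sum.If_cases Int_def)
      also have "\<dots> = (\<Sum>w\<in>I. \<Sum>x\<in>Z. if adj w x then 1 else 0)"
        by (subst sum.swap) (simp add: adj_commute)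
      also have "\<dots> = (\<Sum>w\<in>I. card (nb Z w))"
        using finZ by (simp add: nb_def sum.If_cases Int_def)
      also have "\<dots> = (\<Sum>w\<in>I. 3)"
      proof (rule sum.cong)
        fix w assume w: "w \<in> I"
        have "nb Z w = nb V w" using I w by (auto simp: Z_def indep_def)
        then show "card (nb Z w) = 3" using deg3 w I by auto
      qed simp
      finally show ?thesis by simp
    qed
    have cZ: "card Z = 2 * card I" using card_V_Diff[OF I(1)] I(3) by (simp add: Z_def)
    \<comment> \<open>These are the private neighbours: outside \<open>I\<close>, with a single
      neighbour \<open>pw x\<close> in \<open>I\<close>.\<close>
    define Pr where "Pr = {x \<in> Z. k x = 1}"
    have finPr: "finite Pr" using finZ by (simp add: Pr_def)
    define pw where "pw x = (THE w. nb I x = {w})" for x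
    have pw: "nb I x = {pw x}" if "x \<in> Pr" for x
    proof -
      have "card (nb I x) = 1" using that by (simp add: Pr_def k_def)
      then obtain w where "nb I x = {w}" by (rule card_1_singletonE)
      then show ?thesis by (simp add: pw_def)
    qed
    have pwI: "pw x \<in> I" "adj x (pw x)" if "x \<in> Pr" for x
      using pw[OF that] nb_iff[of "pw x" I x] by auto
    have PrV: "x \<in> V" "x \<notin> I" "x \<in> V - I" if "x \<in> Pr" for x using that by (auto simp: Pr_def Z_def)
    \<comment> \<open>Two private neighbours of w are nonadjacent, as there is no triangle, and
      could replace w.\<close>
    have inj: "inj_on pw Pr"
    proof (rule inj_onI, rule ccontr)
      fix x y assume xy: "x \<in> Pr" "y \<in> Pr" "pw x = pw y" "x \<noteq> y"
      have "\<not> adj x y" using nt[of x y "pw x"] pwI[OF xy(1)] pwI[OF xy(2)] xy PrV I(1) by auto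
      then have "indep {x, y}" by (simp add: indep_insert)
      moreover have "nb I b \<subseteq> {pw x}" if "b \<in> {x, y}" for b
        using that pw[OF xy(1)] pw[OF xy(2)] xy(3) by auto
      ultimately show False
        using exch[of "{x, y}" "{pw x}"] xy pwI[OF xy(1)] PrV by auto
    qed
    have cPr: "card Pr \<le> card I"
      using card_inj_on_le[OF inj _ finI] pwI by blast
    \<comment> \<open>The 3 |I| edges leaving \<open>I\<close> meet 2 |I| vertices. At most |I| of
      these receive only one edge and all others at least two, so that both bounds are
      attained.\<close>
    have lower: "card Pr = card I \<and> (\<forall>x\<in>Z - Pr. k x = 2)"
    proof -
      have k2: "k x \<ge> 2" if "x \<in> Z - Pr" for x using k1[of x] that by (auto simp: Pr_def)
      have PZ: "Pr \<subseteq> Z" by (auto simp: Pr_def)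
      have s: "(\<Sum>x\<in>Z. k x) = (\<Sum>x\<in>Z - Pr. k x) + (\<Sum>x\<in>Pr. k x)"
        by (rule sum.subset_diff[OF PZ finZ])
      have p: "(\<Sum>x\<in>Pr. k x) = card Pr" by (simp add: Pr_def)
      have c: "card (Z - Pr) + card Pr = card Z"
        using PZ finZ finPr by (simp add: card_Diff_subset card_mono)
      have ge: "(\<Sum>x\<in>Z - Pr. 2) \<le> (\<Sum>x\<in>Z - Pr. k x)" by (rule sum_mono) (rule k2)
      then have ge': "2 * card (Z - Pr) \<le> (\<Sum>x\<in>Z - Pr. k x)" by simp
      have eq: "card Pr = card I" "(\<Sum>x\<in>Z - Pr. k x) = 2 * card (Z - Pr)"
        using s p c ge' cPr sumk cZ by linarith+
      have "k x = 2" if x: "x \<in> Z - Pr" for x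
      proof (rule ccontr)
        assume "k x \<noteq> 2"
        then have "2 < k x" using k2[OF x] by simp
        then have "(\<Sum>x\<in>Z - Pr. 2) < (\<Sum>x\<in>Z - Pr. k x)"
          using k2 x finZ by (intro sum_strict_mono_ex1) auto
        then show False using eq by simp
      qed
      then show ?thesis using eq by blast
    qed
    have "pw ` Pr \<subseteq> I" using pwI by blast
    moreover have "card (pw ` Pr) = card I" using inj lower by (simp add: card_image)
    ultimately have surj: "pw ` Pr = I" using finI by (metis card_subset_eq)
    have nin: "adj w x \<Longrightarrow> w \<in> I \<Longrightarrow> x \<in> V \<Longrightarrow> x \<notin> I" for w x using I(2) by (auto simp: indep_def)
    \<comment> \<open>Around w lie its private neighbour x and two shared ones e, f, which also see
      w1 and w2 in \<open>I\<close>. The point is that x is adjacent to the private neighbours of w1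
      and w2, which fills up its degree.\<close>
    have local: "\<exists>e f w1 w2 x1 x2. nb V w = {x, e, f} \<and> x \<noteq> e \<and> x \<noteq> f \<and> e \<noteq> f \<and> e \<in> Z - Pr \<and> f \<in> Z - Pr \<and>
        w1 \<noteq> w2 \<and> w1 \<noteq> w \<and> w2 \<noteq> w \<and> nb I e = {w, w1} \<and> nb I f = {w, w2} \<and> w1 \<in> I \<and> w2 \<in> I \<and>
        x1 \<in> Pr \<and> x2 \<in> Pr \<and> pw x1 = w1 \<and> pw x2 = w2 \<and> nb V x = {w, x1, x2}"
      if x: "x \<in> Pr" and w: "w = pw x" for x w
    proof -
      have wI: "w \<in> I" "adj w x" "w \<in> V" using pwI[OF x] w adj_sym I(1) by auto
      have cw: "card (nb V w - {x}) = 2" using deg3[OF wI(3)] wI x PrV by simp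
      then obtain e f where ef: "nb V w - {x} = {e, f}" "e \<noteq> f" unfolding card_2_iff by blast
      have "x \<in> nb V w" using wI(2) PrV(1)[OF x] by simp
      then have nw: "nb V w = {x, e, f}" using ef(1) by (metis insert_Diff)
      have efx: "x \<noteq> e" "x \<noteq> f" using ef(1) by blast+
      have efV: "e \<in> V" "f \<in> V" "adj w e" "adj w f" using nw nb_iff[of _ V w] by blast+
      have efZ: "e \<in> Z - Pr" "f \<in> Z - Pr"
      proof -
        have "y \<in> Z - Pr" if y: "y \<in> V" "adj w y" "y \<noteq> x" for y
        proof -
          have "y \<notin> Pr"
          proof
            assume yP: "y \<in> Pr"
            have "w \<in> nb I y" using wI y adj_sym by auto
            then have "pw y = pw x" using pw[OF yP] w by simp
            then show False using inj yP x y(3) by (auto dest: inj_onD)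
          qed
          then show ?thesis using nin[OF y(2) wI(1) y(1)] y(1) by (simp add: Z_def)
        qed
        then show "e \<in> Z - Pr" "f \<in> Z - Pr" using efV efx by auto
      qed
      have other: "\<exists>w'. nb I y = {w, w'} \<and> w' \<noteq> w \<and> w' \<in> I \<and> adj y w'" if y: "y \<in> Z - Pr" "adj w y" for y
      proof -
        have "card (nb I y) = 2" using lower y by (simp add: k_def)
        moreover have "w \<in> nb I y" using wI y adj_sym by auto
        ultimately have "card (nb I y - {w}) = 1" by simp
        then obtain w' where "nb I y - {w} = {w'}" by (rule card_1_singletonE)
        then have "nb I y = {w, w'}" "w' \<noteq> w" "w' \<in> nb I y" using \<open>w \<in> nb I y\<close> by blast+
        then show ?thesis using nb_iff[of w' I y] by blast
      qed
      obtain w1 where w1: "nb I e = {w, w1}" "w1 \<noteq> w" "w1 \<in> I" "adj e w1" using other[OF efZ(1) efV(3)] by blast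
      obtain w2 where w2: "nb I f = {w, w2}" "w2 \<noteq> w" "w2 \<in> I" "adj f w2" using other[OF efZ(2) efV(4)] by blast
      have nadj: "\<not> adj e f" "\<not> adj e x" "\<not> adj f x" "\<not> adj x e" "\<not> adj x f"
        using nt[of e w f] nt[of e w x] nt[of f w x] nt[of x w e] nt[of x w f] efV wI adj_sym PrV(1)[OF x] by blast+
      have nx: "nb I x = {w}" using pw[OF x] w by simp
      have w12: "w1 \<noteq> w2"
      proof
        assume e: "w1 = w2"
        have "indep {e, f, x}" using nadj by (simp add: indep_insert)
        moreover have "nb I b \<subseteq> {w, w1}" if "b \<in> {e, f, x}" for b using that w1 w2 nx e by auto
        \<comment> \<open>If w1 = w2, the independent triple e, f, x could replace the pair w,
          w1.\<close>
        moreover have "card {w, w1} < card {e, f, x}" using ef efx w1(2) by simp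
        ultimately show False using exch[of "{e, f, x}" "{w, w1}"] efZ PrV[OF x] wI w1 by (simp add: Z_def)
      qed
      \<comment> \<open>Otherwise the shared neighbour g and the two private neighbours x, y are
        independent and could replace w and w'.\<close>
      have step: "adj x y" if y: "y \<in> Pr" "pw y = w'" and w': "w' \<noteq> w" "w' \<in> I" "adj g w'" and g: "nb I g = {w, w'}" "g \<in> Z - Pr" "adj w g" for y w' g
      proof (rule ccontr)
        assume n: "\<not> adj x y"
        have yw: "adj y w'" "nb I y = {w'}" using pwI[OF y(1)] pw[OF y(1)] y by auto
        have V3: "w' \<in> V" "g \<in> V" "y \<in> V" "x \<in> V" using w' I g PrV(1) y x by (auto simp: Z_def)
        have "\<not> adj g y" using nt[of g w' y] V3 w' yw adj_sym by blast
        moreover have "\<not> adj g x" using nt[of g w x] V3 wI g adj_sym by blast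
        ultimately have "indep {g, x, y}" using n by (simp add: indep_insert)
        moreover have "nb I b \<subseteq> {w, w'}" if "b \<in> {g, x, y}" for b using that g nx yw by auto
        moreover have "card {w, w'} < card {g, x, y}"
        proof -
          have "x \<noteq> y" using w y w' by auto
          moreover have "g \<noteq> x" "g \<noteq> y" using g x y by auto
          ultimately show ?thesis using w' by simp
        qed
        ultimately show False using exch[of "{g, x, y}" "{w, w'}"] g PrV[OF x] PrV[OF y(1)] wI w' by (simp add: Z_def)
      qed
      obtain x1 where x1: "x1 \<in> Pr" "pw x1 = w1" using surj w1(3) by blast
      obtain x2 where x2: "x2 \<in> Pr" "pw x2 = w2" using surj w2(3) by blast
      have a: "adj x x1" by (rule step[OF x1 w1(2,3,4,1) efZ(1) efV(3)])
      have b: "adj x x2" by (rule step[OF x2 w2(2,3,4,1) efZ(2) efV(4)])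
      have "nb V x = {w, x1, x2}"
        by (rule nb3) (use PrV[OF x] PrV[OF x1(1)] PrV[OF x2(1)] wI a b adj_sym x1 x2 w12 in auto)
      then show ?thesis using nw efx ef(2) efZ w12 w1 w2 x1 x2 by blast
    qed
    \<comment> \<open>The neighbours of a private vertex are its vertex in \<open>I\<close> and two
      further private vertices.\<close>
    have np: "\<not> adj e x" if xP: "x \<in> Pr" and eZ: "e \<in> Z - Pr" for e x
    proof
      assume a: "adj e x"
      obtain x1 x2 where n: "nb V x = {pw x, x1, x2}" "x1 \<in> Pr" "x2 \<in> Pr" using local[OF xP refl] by (elim exE conjE)
      have "e \<in> nb V x" using adj_sym[OF a] eZ by (simp add: Z_def)
      moreover have "e \<notin> I" "e \<notin> Pr" using eZ by (auto simp: Z_def)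
      moreover have "e \<in> {pw x, x1, x2}" using calculation(1) unfolding n(1) .
      ultimately show False using n(2,3) pwI(1)[OF xP] by auto
    qed
    have "I \<noteq> {}" using I(3) neV finV by auto
    then obtain x where x: "x \<in> Pr" using surj by blast
    define w where "w = pw x"
    from local[OF x w_def] obtain e f w1 w2 x1 x2 where l0: "nb V w = {x, e, f} \<and> x \<noteq> e \<and> x \<noteq> f \<and> e \<noteq> f \<and> e \<in> Z - Pr \<and> f \<in> Z - Pr \<and>
        w1 \<noteq> w2 \<and> w1 \<noteq> w \<and> w2 \<noteq> w \<and> nb I e = {w, w1} \<and> nb I f = {w, w2} \<and> w1 \<in> I \<and> w2 \<in> I \<and>
        x1 \<in> Pr \<and> x2 \<in> Pr \<and> pw x1 = w1 \<and> pw x2 = w2 \<and> nb V x = {w, x1, x2}"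
      by (elim exE)
    have l: "nb V w = {x, e, f}" "e \<noteq> f" "e \<in> Z - Pr" "f \<in> Z - Pr"
      "w1 \<noteq> w2" "nb I e = {w, w1}" "nb I f = {w, w2}" "w1 \<noteq> w" "w2 \<noteq> w" "w1 \<in> I" "w2 \<in> I"
      "x1 \<in> Pr" "x2 \<in> Pr" "pw x1 = w1" "pw x2 = w2" "nb V x = {w, x1, x2}"
      using l0 by blast+
    have wI: "w \<in> I" "w \<in> V" using pwI[OF x] I by (auto simp: w_def)
    have efV: "e \<in> V" "f \<in> V" "adj w e" "adj w f" using l(1) nb_iff[of _ V w] by blast+
    have xx: "adj x x1" "adj x x2" using l(16) nb_iff[of _ V x] by blast+
    have n1: "\<not> adj e f" using nt[of e w f] efV wI adj_sym by blast
    have n2: "\<not> adj x1 x2" using nt[of x1 x x2] xx adj_sym PrV(1)[OF x] PrV(1)[OF l(12)] PrV(1)[OF l(13)] by blast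
    \<comment> \<open>These four vertices see only w, w1, w2 in \<open>I\<close>, which makes the
      last exchange possible.\<close>
    have "indep {e, f, x1, x2}" using n1 n2 np l(3,4,12,13) by (simp add: indep_insert)
    moreover have "nb I b \<subseteq> {w, w1, w2}" if "b \<in> {e, f, x1, x2}" for b
      using that l pw[OF l(12)] pw[OF l(13)] by auto
    moreover have "card {w, w1, w2} < card {e, f, x1, x2}"
    proof -
      have "x1 \<noteq> x2" using l(5,14,15) by auto
      moreover have "e \<noteq> x1" "e \<noteq> x2" "f \<noteq> x1" "f \<noteq> x2" using l(3,4,12,13) by auto
      ultimately show ?thesis using l(2,5,8,9) by simp
    qed
    moreover have "{e, f, x1, x2} \<subseteq> V - I" "{w, w1, w2} \<subseteq> I"
      using l(3,4,10,11) PrV(3)[OF l(12)] PrV(3)[OF l(13)] wI by (auto simp: Z_def)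
    ultimately show False using exch[of "{e, f, x1, x2}" "{w, w1, w2}"] by blast
  qed
  then show ?thesis using that by blast
qed

end

section \<open>Critical edges of the gadgets\<close>

text \<open>Sets that become independent once the edge ij is deleted. One with
  \<open>gadget_alpha d + 1\<close> elements shows that this edge is critical.\<close>

definition near_indep :: "nat \<Rightarrow> bool \<Rightarrow> nat \<Rightarrow> nat \<Rightarrow> nat set \<Rightarrow> bool" where
  "near_indep d b i j L \<longleftrightarrow> L \<subseteq> gadget_verts d \<and> i \<in> L \<and> j \<in> L \<and>
     (\<forall>x\<in>L. \<forall>y\<in>L. y \<in> gnb d b x \<longrightarrow> {x, y} = {i, j})"

lemma near_indep_sym: "near_indep d b i j L \<Longrightarrow> near_indep d b j i L"
  by (auto simp: near_indep_def insert_commute)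

lemma near_indep_nine_true:
  "near_indep (Suc 0) True 0 (Suc 0) {0,Suc 0,5,6}"
  "near_indep (Suc 0) True 0 2 {0,2,3,8}"
  "near_indep (Suc 0) True 3 4 {0,3,4,6}"
  "near_indep (Suc 0) True 4 5 {0,4,5,6}"
  "near_indep (Suc 0) True 3 5 {0,3,5,6}"
  "near_indep (Suc 0) True 6 7 {0,3,6,7}"
  "near_indep (Suc 0) True 7 8 {0,3,7,8}"
  "near_indep (Suc 0) True 6 8 {0,3,6,8}"
  "near_indep (Suc 0) True 5 8 {Suc 0,2,5,8}"
  "near_indep (Suc 0) True (Suc 0) 3 {Suc 0,2,3,8}"
  "near_indep (Suc 0) True (Suc 0) 4 {Suc 0,2,4,8}"
  "near_indep (Suc 0) True 2 6 {Suc 0,2,5,6}"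
  "near_indep (Suc 0) True 2 7 {Suc 0,2,5,7}"
  by (auto simp: near_indep_def gadget_verts_simps gnb_simps)

lemma near_indep_nine_false:
  "near_indep (Suc 0) False 0 (Suc 0) {0,Suc 0,4,6}"
  "near_indep (Suc 0) False 0 2 {0,2,3,7}"
  "near_indep (Suc 0) False 3 4 {0,3,4,6}"
  "near_indep (Suc 0) False 4 5 {0,4,5,6}"
  "near_indep (Suc 0) False 3 5 {0,3,5,6}"
  "near_indep (Suc 0) False 6 7 {0,3,6,7}"
  "near_indep (Suc 0) False 7 8 {0,3,7,8}"
  "near_indep (Suc 0) False 6 8 {0,3,6,8}"
  "near_indep (Suc 0) False 5 8 {Suc 0,2,5,8}"
  "near_indep (Suc 0) False (Suc 0) 3 {Suc 0,2,3,8}"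
  "near_indep (Suc 0) False (Suc 0) 7 {Suc 0,2,5,7}"
  "near_indep (Suc 0) False 2 6 {Suc 0,2,5,6}"
  "near_indep (Suc 0) False 2 4 {Suc 0,2,4,8}"
  by (auto simp: near_indep_def gadget_verts_simps gnb_simps)

text \<open>Seven of the eight edges; the edge between the subdivision vertices is excluded later by
  the absence of diamonds. The edge 2 3 has two witnesses, so that either subdivision vertex can be
  avoided.\<close>

lemma near_indep_k4star:
  "near_indep 2 b 0 2 {0,2,5}"
  "near_indep 2 b 0 3 {0,3,5}"
  "near_indep 2 b (Suc 0) 2 {Suc 0,2,4}"
  "near_indep 2 b (Suc 0) 3 {Suc 0,3,4}"
  "near_indep 2 b 2 3 {2,3,4}"
  "near_indep 2 b 2 3 {2,3,5}"
  "near_indep 2 b 0 4 {0,Suc 0,4}"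
  "near_indep 2 b (Suc 0) 5 {0,Suc 0,5}"
  by (auto simp: near_indep_def gadget_verts_simps gnb_simps)

text \<open>Every edge of both gadgets on nine vertices is critical, with one witness from the
  tables for each of the 13 edges.\<close>

lemma critical_nine:
  assumes "i \<in> gadget_verts (Suc 0)" "j \<in> gnb (Suc 0) b i"
  shows "\<exists>L. near_indep (Suc 0) b i j L \<and> card L = 4"
proof -
  have *: "near_indep (Suc 0) b i j {x, y, z, w} \<or> near_indep (Suc 0) b j i {x, y, z, w} \<Longrightarrow> card {x, y, z, w} = 4 \<Longrightarrow> ?thesis"
    for x y z w using near_indep_sym by blast
  show ?thesis
  proof (cases b)
    case True
    have j: "j \<in> gnb (Suc 0) True i" using assms(2) True by simp
    consider "i = 0" "j = Suc 0"
      | "i = Suc 0" "j = 0"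
      | "i = 0" "j = 2"
      | "i = 2" "j = 0"
      | "i = 3" "j = 4"
      | "i = 4" "j = 3"
      | "i = 4" "j = 5"
      | "i = 5" "j = 4"
      | "i = 3" "j = 5"
      | "i = 5" "j = 3"
      | "i = 6" "j = 7"
      | "i = 7" "j = 6"
      | "i = 7" "j = 8"
      | "i = 8" "j = 7"
      | "i = 6" "j = 8"
      | "i = 8" "j = 6"
      | "i = 5" "j = 8"
      | "i = 8" "j = 5"
      | "i = Suc 0" "j = 3"
      | "i = 3" "j = Suc 0"
      | "i = Suc 0" "j = 4"
      | "i = 4" "j = Suc 0"
      | "i = 2" "j = 6"
      | "i = 6" "j = 2"
      | "i = 2" "j = 7"
      | "i = 7" "j = 2"
      using assms(1) j by (auto simp: gadget_verts_simps gnb_simps)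
    then show ?thesis
    proof cases
      case 1 then show ?thesis using True near_indep_nine_true *[of "0" "Suc 0" "5" "6"] by simp
    next
      case 2 then show ?thesis using True near_indep_nine_true *[of "0" "Suc 0" "5" "6"] by simp
    next
      case 3 then show ?thesis using True near_indep_nine_true *[of "0" "2" "3" "8"] by simp
    next
      case 4 then show ?thesis using True near_indep_nine_true *[of "0" "2" "3" "8"] by simp
    next
      case 5 then show ?thesis using True near_indep_nine_true *[of "0" "3" "4" "6"] by simp
    next
      case 6 then show ?thesis using True near_indep_nine_true *[of "0" "3" "4" "6"] by simp
    next
      case 7 then show ?thesis using True near_indep_nine_true *[of "0" "4" "5" "6"] by simp
    next
      case 8 then show ?thesis using True near_indep_nine_true *[of "0" "4" "5" "6"] by simp
    next
      case 9 then show ?thesis using True near_indep_nine_true *[of "0" "3" "5" "6"] by simp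
    next
      case 10 then show ?thesis using True near_indep_nine_true *[of "0" "3" "5" "6"] by simp
    next
      case 11 then show ?thesis using True near_indep_nine_true *[of "0" "3" "6" "7"] by simp
    next
      case 12 then show ?thesis using True near_indep_nine_true *[of "0" "3" "6" "7"] by simp
    next
      case 13 then show ?thesis using True near_indep_nine_true *[of "0" "3" "7" "8"] by simp
    next
      case 14 then show ?thesis using True near_indep_nine_true *[of "0" "3" "7" "8"] by simp
    next
      case 15 then show ?thesis using True near_indep_nine_true *[of "0" "3" "6" "8"] by simp
    next
      case 16 then show ?thesis using True near_indep_nine_true *[of "0" "3" "6" "8"] by simp
    next
      case 17 then show ?thesis using True near_indep_nine_true *[of "Suc 0" "2" "5" "8"] by simp
    next
      case 18 then show ?thesis using True near_indep_nine_true *[of "Suc 0" "2" "5" "8"] by simp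
    next
      case 19 then show ?thesis using True near_indep_nine_true *[of "Suc 0" "2" "3" "8"] by simp
    next
      case 20 then show ?thesis using True near_indep_nine_true *[of "Suc 0" "2" "3" "8"] by simp
    next
      case 21 then show ?thesis using True near_indep_nine_true *[of "Suc 0" "2" "4" "8"] by simp
    next
      case 22 then show ?thesis using True near_indep_nine_true *[of "Suc 0" "2" "4" "8"] by simp
    next
      case 23 then show ?thesis using True near_indep_nine_true *[of "Suc 0" "2" "5" "6"] by simp
    next
      case 24 then show ?thesis using True near_indep_nine_true *[of "Suc 0" "2" "5" "6"] by simp
    next
      case 25 then show ?thesis using True near_indep_nine_true *[of "Suc 0" "2" "5" "7"] by simp
    next
      case 26 then show ?thesis using True near_indep_nine_true *[of "Suc 0" "2" "5" "7"] by simp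
    qed
  next
    case False
    have j: "j \<in> gnb (Suc 0) False i" using assms(2) False by simp
    consider "i = 0" "j = Suc 0"
      | "i = Suc 0" "j = 0"
      | "i = 0" "j = 2"
      | "i = 2" "j = 0"
      | "i = 3" "j = 4"
      | "i = 4" "j = 3"
      | "i = 4" "j = 5"
      | "i = 5" "j = 4"
      | "i = 3" "j = 5"
      | "i = 5" "j = 3"
      | "i = 6" "j = 7"
      | "i = 7" "j = 6"
      | "i = 7" "j = 8"
      | "i = 8" "j = 7"
      | "i = 6" "j = 8"
      | "i = 8" "j = 6"
      | "i = 5" "j = 8"
      | "i = 8" "j = 5"
      | "i = Suc 0" "j = 3"
      | "i = 3" "j = Suc 0"
      | "i = Suc 0" "j = 7"
      | "i = 7" "j = Suc 0"
      | "i = 2" "j = 6"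
      | "i = 6" "j = 2"
      | "i = 2" "j = 4"
      | "i = 4" "j = 2"
      using assms(1) j by (auto simp: gadget_verts_simps gnb_simps)
    then show ?thesis
    proof cases
      case 1 then show ?thesis using False near_indep_nine_false *[of "0" "Suc 0" "4" "6"] by simp
    next
      case 2 then show ?thesis using False near_indep_nine_false *[of "0" "Suc 0" "4" "6"] by simp
    next
      case 3 then show ?thesis using False near_indep_nine_false *[of "0" "2" "3" "7"] by simp
    next
      case 4 then show ?thesis using False near_indep_nine_false *[of "0" "2" "3" "7"] by simp
    next
      case 5 then show ?thesis using False near_indep_nine_false *[of "0" "3" "4" "6"] by simp
    next
      case 6 then show ?thesis using False near_indep_nine_false *[of "0" "3" "4" "6"] by simp
    next
      case 7 then show ?thesis using False near_indep_nine_false *[of "0" "4" "5" "6"] by simp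
    next
      case 8 then show ?thesis using False near_indep_nine_false *[of "0" "4" "5" "6"] by simp
    next
      case 9 then show ?thesis using False near_indep_nine_false *[of "0" "3" "5" "6"] by simp
    next
      case 10 then show ?thesis using False near_indep_nine_false *[of "0" "3" "5" "6"] by simp
    next
      case 11 then show ?thesis using False near_indep_nine_false *[of "0" "3" "6" "7"] by simp
    next
      case 12 then show ?thesis using False near_indep_nine_false *[of "0" "3" "6" "7"] by simp
    next
      case 13 then show ?thesis using False near_indep_nine_false *[of "0" "3" "7" "8"] by simp
    next
      case 14 then show ?thesis using False near_indep_nine_false *[of "0" "3" "7" "8"] by simp
    next
      case 15 then show ?thesis using False near_indep_nine_false *[of "0" "3" "6" "8"] by simp
    next
      case 16 then show ?thesis using False near_indep_nine_false *[of "0" "3" "6" "8"] by simp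
    next
      case 17 then show ?thesis using False near_indep_nine_false *[of "Suc 0" "2" "5" "8"] by simp
    next
      case 18 then show ?thesis using False near_indep_nine_false *[of "Suc 0" "2" "5" "8"] by simp
    next
      case 19 then show ?thesis using False near_indep_nine_false *[of "Suc 0" "2" "3" "8"] by simp
    next
      case 20 then show ?thesis using False near_indep_nine_false *[of "Suc 0" "2" "3" "8"] by simp
    next
      case 21 then show ?thesis using False near_indep_nine_false *[of "Suc 0" "2" "5" "7"] by simp
    next
      case 22 then show ?thesis using False near_indep_nine_false *[of "Suc 0" "2" "5" "7"] by simp
    next
      case 23 then show ?thesis using False near_indep_nine_false *[of "Suc 0" "2" "5" "6"] by simp
    next
      case 24 then show ?thesis using False near_indep_nine_false *[of "Suc 0" "2" "5" "6"] by simp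
    next
      case 25 then show ?thesis using False near_indep_nine_false *[of "Suc 0" "2" "4" "8"] by simp
    next
      case 26 then show ?thesis using False near_indep_nine_false *[of "Suc 0" "2" "4" "8"] by simp
    qed
  qed
qed

text \<open>A witness is wanted that avoids the prescribed label t and uses only one subdivision
  vertex. For an edge joining an end of the subdivided edge to 2 or 3 the third vertex of the
  witness is forced, namely the far subdivision vertex; these positions are excluded by the
  assumptions on t.\<close>

lemma critical_k4star:
  assumes "i \<in> gadget_verts 2" "j \<in> gnb 2 b i" "{i, j} \<noteq> {4, 5}" "t \<noteq> i" "t \<noteq> j"
    and "t = 5 \<Longrightarrow> {i, j} \<noteq> {0, 2} \<and> {i, j} \<noteq> {0, 3}"
    and "t = 4 \<Longrightarrow> {i, j} \<noteq> {1, 2} \<and> {i, j} \<noteq> {1, 3}"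
    and "t \<notin> {0, 1, 2, 3}"
  shows "\<exists>L. near_indep 2 b i j L \<and> card L = 3 \<and> t \<notin> L \<and> card (L \<inter> {4, 5}) = 1"
proof -
  have *: "near_indep 2 b i j {x, y, z} \<or> near_indep 2 b j i {x, y, z} \<Longrightarrow> card {x, y, z} = 3 \<Longrightarrow>
     t \<notin> {x, y, z} \<Longrightarrow> card ({x, y, z} \<inter> {4, 5}) = 1 \<Longrightarrow> ?thesis"
    for x y z using near_indep_sym by blast
  consider "i = 0" "j = 2"
    | "i = 2" "j = 0"
    | "i = 0" "j = 3"
    | "i = 3" "j = 0"
    | "i = Suc 0" "j = 2"
    | "i = 2" "j = Suc 0"
    | "i = Suc 0" "j = 3"
    | "i = 3" "j = Suc 0"
    | "i = 2" "j = 3"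
    | "i = 3" "j = 2"
    | "i = 0" "j = 4"
    | "i = 4" "j = 0"
    | "i = Suc 0" "j = 5"
    | "i = 5" "j = Suc 0"
    using assms(1-3) by (auto simp: gadget_verts_simps gnb_simps)
  then show ?thesis
  proof cases
    case 1
    have "t \<noteq> 5" using assms(4-7) 1 by (auto simp: doubleton_eq_iff)
    then show ?thesis using near_indep_k4star *[of "0" "2" "5"] assms(8) 1 by simp
  next
    case 2
    have "t \<noteq> 5" using assms(4-7) 2 by (auto simp: doubleton_eq_iff)
    then show ?thesis using near_indep_k4star *[of "0" "2" "5"] assms(8) 2 by simp
  next
    case 3
    have "t \<noteq> 5" using assms(4-7) 3 by (auto simp: doubleton_eq_iff)
    then show ?thesis using near_indep_k4star *[of "0" "3" "5"] assms(8) 3 by simp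
  next
    case 4
    have "t \<noteq> 5" using assms(4-7) 4 by (auto simp: doubleton_eq_iff)
    then show ?thesis using near_indep_k4star *[of "0" "3" "5"] assms(8) 4 by simp
  next
    case 5
    have "t \<noteq> 4" using assms(4-7) 5 by (auto simp: doubleton_eq_iff)
    then show ?thesis using near_indep_k4star *[of "Suc 0" "2" "4"] assms(8) 5 by simp
  next
    case 6
    have "t \<noteq> 4" using assms(4-7) 6 by (auto simp: doubleton_eq_iff)
    then show ?thesis using near_indep_k4star *[of "Suc 0" "2" "4"] assms(8) 6 by simp
  next
    case 7
    have "t \<noteq> 4" using assms(4-7) 7 by (auto simp: doubleton_eq_iff)
    then show ?thesis using near_indep_k4star *[of "Suc 0" "3" "4"] assms(8) 7 by simp
  next
    case 8
    have "t \<noteq> 4" using assms(4-7) 8 by (auto simp: doubleton_eq_iff)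
    then show ?thesis using near_indep_k4star *[of "Suc 0" "3" "4"] assms(8) 8 by simp
  next
    case 9 then show ?thesis using near_indep_k4star *[of 2 3 4] *[of 2 3 5] assms(8) by (cases "t = 4") simp_all
  next
    case 10 then show ?thesis using near_indep_k4star *[of 2 3 4] *[of 2 3 5] assms(8) by (cases "t = 4") simp_all
  next
    case 11
    have "t \<noteq> 4" using assms(4-7) 11 by (auto simp: doubleton_eq_iff)
    then show ?thesis using near_indep_k4star *[of "0" "Suc 0" "4"] assms(8) 11 by simp
  next
    case 12
    have "t \<noteq> 4" using assms(4-7) 12 by (auto simp: doubleton_eq_iff)
    then show ?thesis using near_indep_k4star *[of "0" "Suc 0" "4"] assms(8) 12 by simp
  next
    case 13
    have "t \<noteq> 5" using assms(4-7) 13 by (auto simp: doubleton_eq_iff)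
    then show ?thesis using near_indep_k4star *[of "0" "Suc 0" "5"] assms(8) 13 by simp
  next
    case 14
    have "t \<noteq> 5" using assms(4-7) 14 by (auto simp: doubleton_eq_iff)
    then show ?thesis using near_indep_k4star *[of "0" "Suc 0" "5"] assms(8) 14 by simp
  qed
qed

section \<open>The first step in a tight cubic graph: diamonds, bridges, triangles\<close>

context ccubic
begin

lemma mod3_nat: "n mod 3 = 0 \<or> n mod 3 = 1 \<or> n mod 3 = (2::nat)"
  by arith

lemma tiled_replace_V:
  assumes "tiling (V - N) P" "Q \<subseteq> P" "gadget (N \<union> \<Union>Q)" "N \<subseteq> V"
  shows "tiled V"
proof -
  have "tiled (N \<union> (V - N))" using assms(1-3) by (rule tiled_replace) blast
  moreover have "N \<union> (V - N) = V" using assms(4) by blast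
  ultimately show ?thesis by simp
qed

text \<open>The vertices c and d with their neighbours form six vertices \<open>X\<close>, of which
  \<open>{c, d}\<close> is an independent third. If the outer neighbours c', d' are adjacent,
  \<open>X\<close> is a subdivided K4; if they block one triangle, it joins \<open>X\<close> in a
  gadget on nine vertices; if they block two, the graph closes up with 12 vertices.\<close>

lemma diamond_tiled:
  assumes tV: "tight V" and n3: "3 dvd card V" and n12: "card V \<noteq> 12"
    and abcd: "a \<in> V" "b \<in> V" "c \<in> V" "d \<in> V" "c \<noteq> d"
      "adj a b" "adj a c" "adj b c" "adj a d" "adj b d"
  shows "tiled V"
proof -
  have ne: "a \<noteq> b" "a \<noteq> c" "b \<noteq> c" "a \<noteq> d" "b \<noteq> d" using abcd by auto
  note sym = abcd(6-10)[THEN adj_sym]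
  have na: "nb V a = {b, c, d}" and nb: "nb V b = {a, c, d}"
    by (rule nb3; use abcd ne sym in simp)+
  obtain c' where c': "nb V c = {a, b, c'}" "c' \<noteq> a" "c' \<noteq> b" "c' \<in> V" "adj c c'" "c' \<noteq> c"
    using third_nb[OF abcd(3,1,2) sym(2,3) ne(1)] .
  obtain d' where d': "nb V d = {a, b, d'}" "d' \<noteq> a" "d' \<noteq> b" "d' \<in> V" "adj d d'" "d' \<noteq> d"
    using third_nb[OF abcd(4,1,2) sym(4,5) ne(1)] .
  \<comment> \<open>Otherwise the four vertices form K4, and 3 does not divide 4.\<close>
  have ncd: "\<not> adj c d"
  proof
    assume cd: "adj c d"
    then have "d \<in> nb V c" "c \<in> nb V d" using abcd adj_sym by auto
    then have e: "c' = d" "d' = c" using c'(1) d'(1) ne abcd(5) by auto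
    have "{a, b, c, d} = V"
    proof (rule conn)
      show "{a, b, c, d} \<subseteq> V" using abcd by simp
      fix w assume "w \<in> {a, b, c, d}"
      then show "nb V w \<subseteq> {a, b, c, d}" using na nb c'(1) d'(1) e by auto
    qed simp
    moreover have "card {a, b, c, d} = 4" using ne abcd(5) by simp
    ultimately show False using n3 by simp
  qed
  have cd': "c' \<noteq> d" "d' \<noteq> c" using ncd c'(5) d'(5) adj_sym by auto
  have third: False if X: "X \<subset> V" "S \<subseteq> X" "indep S" "\<And>s. s \<in> S \<Longrightarrow> nb V s \<subseteq> X" "card X < 3 * card S" for X S
  proof -
    have "V - X \<subset> V"
    proof -
      have "S \<noteq> {}" using X(5) by auto
      then show ?thesis using X(1,2) by blast
    qed
    then obtain J where J: "J \<subseteq> V - X" "indep J" "card (V - X) \<le> 3 * card J" by (rule proper_third)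
    have fin: "finite S" "finite J" using X J finV by (meson finite_Diff finite_subset psubset_imp_subset)+
    have "\<not> adj s j" if "s \<in> S" "j \<in> J" for s j using X(4)[OF that(1)] J(1) that(2) nb_iff[of j V s] by blast
    then have "indep (S \<union> J)" using X(3) J(2) by (auto simp: indep_Un)
    moreover have "S \<union> J \<subseteq> V" using X J by blast
    ultimately have "3 * card (S \<union> J) \<le> card V" using tV card_le_tight by blast
    moreover have "card (S \<union> J) = card S + card J" using fin X J by (intro card_Un_disjoint) auto
    ultimately show False using card_V_Diff[of X] X J by (simp add: psubset_imp_subset)
  qed
  \<comment> \<open>A common outer neighbour would leave only five vertices for the two independent
    ones, better than a third.\<close>
  have c'd': "c' \<noteq> d'"
  proof
    assume e: "c' = d'"
    have 5: "card {a, b, c, d, c'} = 5" using ne abcd(5) c' cd' by simp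
    show False
    proof (rule third)
      show "{a, b, c, d, c'} \<subset> V"
      proof -
        have "{a, b, c, d, c'} \<noteq> V" using 5 n3 by auto
        then show ?thesis using abcd c' by blast
      qed
      show "{c, d} \<subseteq> {a, b, c, d, c'}" by simp
      show "indep {c, d}" using ncd by (simp add: indep_insert)
      show "nb V s \<subseteq> {a, b, c, d, c'}" if "s \<in> {c, d}" for s using that c'(1) d'(1) e by auto
      show "card {a, b, c, d, c'} < 3 * card {c, d}" using 5 abcd(5) by simp
    qed
  qed
  define X where "X = {a, b, c, d, c', d'}"
  define F where "F = V - X"
  have XV: "X \<subseteq> V" using abcd c' d' by (simp add: X_def)
  have cX: "card X = 6" using ne abcd(5) c' d' cd' c'd' by (simp add: X_def)
  have FV: "F \<subset> V" "F \<subseteq> V" using abcd by (auto simp: F_def X_def)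
  have finF: "finite F" using finV by (simp add: F_def)
  have tF: "tight F" unfolding F_def
  proof (rule tight_split[OF finV tV XV])
    show "{c, d} \<subseteq> X" by (simp add: X_def)
    show "indep {c, d}" using ncd by (simp add: indep_insert)
    show "card X = 3 * card {c, d}" using cX abcd(5) by simp
    show "\<not> adj s u" if "s \<in> {c, d}" "u \<in> V - X" for s u
    proof -
      have "nb V s \<subseteq> X" using that(1) c'(1) d'(1) by (auto simp: X_def)
      then show ?thesis using that(2) nb_iff[of u V s] by blast
    qed
  qed
  obtain P where P: "tiling F P" using proper_tiled[OF FV(1) tF] unfolding tiled_def by blast
  have disX: "X \<inter> F = {}" "X \<union> F = V" using XV by (auto simp: F_def)
  have sc: "adj c' c" "adj d' d" using c' d' adj_sym by auto
  show ?thesis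
  proof (cases "adj c' d'")
    case True
    have "gadget {c, d, a, b, c', d'}"
      by (rule k4star_gadgetI[OF subV]) (use XV abcd sym ne c' d' cd' c'd' sc True in \<open>simp_all add: X_def\<close>)
    moreover have "{c, d, a, b, c', d'} = X" by (auto simp: X_def)
    ultimately have "tiled (X \<union> F)" using tiled_replace[OF P, of "{}" X] disX by simp
    then show ?thesis using disX by simp
  next
    case False
    define B where "B = nb F c' \<union> nb F d'"
    have c2: "card (nb F c') \<le> 2" "card (nb F d') \<le> 2"
      using card_nb_outside[OF subV FV(2) c'(4) _ sc(1)] card_nb_outside[OF subV FV(2) d'(4) _ sc(2)] abcd
      by (auto simp: F_def X_def)
    have finB: "finite B" using finF by (simp add: B_def finite_nb)
    have cB: "card B \<le> 4" unfolding B_def using c2 card_Un_le[of "nb F c'" "nb F d'"] by linarith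
    have BF: "B \<subseteq> F" by (auto simp: B_def)
    show ?thesis
    proof (rule blocking[OF subU[OF FV(2)] P finB cB])
      fix x assume x: "x \<in> B" "x \<in> F"
      then have "adj x c' \<or> adj x d'" using adj_sym by (auto simp: B_def)
      moreover have "c' \<in> V - F" "d' \<in> V - F" "x \<in> V" using c' d' x FV by (auto simp: F_def X_def)
      ultimately show "card (nb F x) \<le> 2" using card_nb_outside[OF subV FV(2)] by blast
    next
      fix J assume J: "J \<subseteq> F" "indep J" "3 * card J = card F"
      show "J \<inter> B \<noteq> {}"
      proof
        assume e: "J \<inter> B = {}"
        have j: "\<not> adj c' j \<and> \<not> adj d' j \<and> \<not> adj a j" if "j \<in> J" for j
        proof -
          have "j \<in> F" "j \<notin> B" using that J(1) e by blast+
          then have "\<not> adj c' j" "\<not> adj d' j" by (auto simp: B_def)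
          moreover have "j \<notin> nb V a" using \<open>j \<in> F\<close> unfolding na by (auto simp: F_def X_def)
          ultimately show ?thesis using \<open>j \<in> F\<close> FV by auto
        qed
        \<comment> \<open>The triple a, c', d' competes with the pair c, d. As all neighbours of a
          lie in \<open>X\<close>, nothing outside \<open>B\<close> can prevent its use.\<close>
        have "\<not> adj a c'" "\<not> adj a d'" using na c' d' cd' nb_iff[of _ V a] by auto
        then have "indep ({a, c', d'} \<union> J)" unfolding indep_Un
          using J(2) False j adj_sym by (auto simp: indep_insert)
        then have "3 * card ({a, c', d'} \<union> J) \<le> card V"
          using J(1) FV XV by (intro card_le_tight[OF tV]) (auto simp: X_def)
        moreover have "card ({a, c', d'} \<union> J) = card {a, c', d'} + card J"
        proof (rule card_Un_disjoint)
          show "finite J" using J(1) finF by (rule finite_subset)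
          show "{a, c', d'} \<inter> J = {}" using J(1) by (auto simp: F_def X_def)
        qed simp
        moreover have "card {a, c', d'} = 3" using c' d' c'd' by simp
        moreover have "card F + 6 = card V" using card_V_Diff[OF XV] cX by (simp add: F_def)
        ultimately show False using J(3) by linarith
      qed
    next
      fix T assume T: "T \<in> P" "card T = 3" "T \<subseteq> B"
      have TF: "T \<subseteq> F" using T(3) BF by blast
      obtain x y z where xyz: "T = {x, y, z}" "x \<noteq> y" "x \<noteq> z" "y \<noteq> z"
        "x \<in> nb F c' \<and> y \<in> nb F c' \<and> z \<in> nb F d' \<or> x \<in> nb F d' \<and> y \<in> nb F d' \<and> z \<in> nb F c'"
        using pigeonhole_three[OF T(2), of "nb F c'" "nb F d'"] T(3) c2 finF
        by (metis B_def finite_nb)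
      note tri = triangle_gadget[OF tilingD(2)[OF P T(1)] T(2)]
      have e: "adj z x" "adj z y" "adj x y" by (rule tri; use xyz in simp)+
      have notX: "w \<notin> X" if "w \<in> {x, y, z}" for w using that TF xyz(1) by (auto simp: F_def)
      have dT: "distinct [x, y, z]" "x \<notin> X" "y \<notin> X" "z \<notin> X" "{x, y, z} \<subseteq> V"
        using xyz notX TF FV by auto
      \<comment> \<open>The two triangles of the gadget are a b v and x y v', joined by the edge
        vv'. Here u' is the attachment vertex and u, z are its neighbours, each seeing two vertices
        of one triangle.\<close>
      have nine: "gadget {u', u, z, a, b, v, x, y, v'}"
        if uv: "u = c \<and> u' = c' \<and> v = d \<and> v' = d' \<or> u = d \<and> u' = d' \<and> v = c \<and> v' = c'"
          and ad: "adj v' x" "adj v' y" "adj u' z" for u u' v v'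
      proof (rule nine_gadgetI[OF subV])
        show "{u', u, z, a, b, v, x, y, v'} \<subseteq> V" using uv XV dT by (auto simp: X_def)
        show "distinct [u', u, z, a, b, v, x, y, v']"
          using uv dT ne abcd(5) c' d' cd' c'd' by (auto simp: X_def)
        show "adj u' u" "adj u a" "adj a v" "adj b v" "adj v v'" "adj u b \<and> adj z y \<or> adj u y \<and> adj z b"
          using uv abcd sym c' d' sc e by auto
        show "adj y v'" "adj x v'" using ad adj_sym by auto
      qed (use ad e abcd in auto)
      have "gadget (X \<union> \<Union>{T})"
      proof -
        consider "adj c' x" "adj c' y" "adj d' z" | "adj d' x" "adj d' y" "adj c' z" using xyz(5) by auto
        then show ?thesis
        proof cases
          case 1
          have "{d', d, z, a, b, c, x, y, c'} = X \<union> \<Union>{T}" using xyz(1) by (auto simp: X_def)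
          then show ?thesis using nine[of d d' c c'] 1 by simp
        next
          case 2
          have "{c', c, z, a, b, d, x, y, d'} = X \<union> \<Union>{T}" using xyz(1) by (auto simp: X_def)
          then show ?thesis using nine[of c c' d d'] 2 by simp
        qed
      qed
      then have "tiled (X \<union> F)" using tiled_replace[OF P, of "{T}" X] T(1) disX by simp
      then show ?thesis using disX by simp
    next
      fix T1 T2 r1 r2 assume T: "T1 \<in> P" "T2 \<in> P" "T1 \<noteq> T2" "card T1 = 3" "card T2 = 3"
        "r1 \<in> T1" "r2 \<in> T2" "adj r1 r2" "B = T1 \<union> T2 - {r1, r2}"
      have TF: "T1 \<subseteq> F" "T2 \<subseteq> F" using tilingD(1)[OF P] T(1,2) by blast+
      have gT: "gadget T1" "gadget T2" using tilingD(2)[OF P] T(1,2) by blast+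
      have dj: "T1 \<inter> T2 = {}" using tilingD(4)[OF P T(1,2)] T(3) by blast
      let ?W = "X \<union> (T1 \<union> T2)"
      \<comment> \<open>Blocked vertices see c' or d', and r1, r2 see each other. So every vertex of
        the two triangles has its outer neighbour in \<open>?W\<close>, which is therefore the whole
        graph.\<close>
      have out: "\<exists>s\<in>?W. s \<notin> T \<and> adj t s" if t: "t \<in> T" "T = T1 \<or> T = T2" for t T
      proof (cases "t \<in> B")
        case True
        then have "adj t c' \<or> adj t d'" using adj_sym by (auto simp: B_def)
        moreover have "c' \<notin> T" "d' \<notin> T" using t TF by (auto simp: F_def X_def)
        ultimately show ?thesis by (auto simp: X_def)
      next
        case False
        then have "t = r1 \<and> T = T1 \<or> t = r2 \<and> T = T2" using t T dj by blast
        then show ?thesis using T(6-8) adj_sym dj by blast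
      qed
      have "?W = V"
      proof (rule conn)
        show "?W \<subseteq> V" using TF FV XV by blast
        fix w assume w: "w \<in> ?W"
        show "nb V w \<subseteq> ?W"
        proof (cases "w \<in> T1 \<union> T2")
          case True
          then obtain T where wT: "w \<in> T" "T = T1 \<or> T = T2" by blast
          obtain s where s: "s \<in> ?W" "s \<notin> T" "adj w s" using out[OF wT] by blast
          have TV: "T \<subseteq> V" "gadget T" "card T = 3" using wT(2) TF FV gT T(4,5) by auto
          have "s \<in> V - T" using s TF FV XV by blast
          then have "nb V w = insert s (T - {w})" using triangle_nb[OF subV TV wT(1)] s(3) by blast
          moreover have "insert s (T - {w}) \<subseteq> ?W" using s(1) wT(2) by blast
          ultimately show ?thesis by metis
        next
          case False
          then have wX: "w \<in> X" using w by blast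
          have "nb F c' \<subseteq> ?W" "nb F d' \<subseteq> ?W" using T(9) unfolding B_def by blast+
          moreover have "nb V w \<subseteq> X \<union> nb F w" using disX(2) by auto
          ultimately show ?thesis using wX na nb c'(1) d'(1) by (auto simp: X_def)
        qed
      qed (simp add: X_def)
      moreover have "card ?W = 12"
      proof -
        have "finite T1" "finite T2" using gT gadget_finite by blast+
        then have "card (T1 \<union> T2) = 6" "finite (T1 \<union> T2)" using dj T(4,5) by (simp_all add: card_Un_disjoint)
        moreover have "X \<inter> (T1 \<union> T2) = {}" using TF disX by blast
        moreover have "finite X" by (simp add: X_def)
        ultimately show ?thesis using cX by (simp add: card_Un_disjoint)
      qed
      ultimately show ?thesis using n12 by simp
    qed
  qed
qed

text \<open>Conflicts along the only possible edge aa' between the two sides are avoided by giving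
  up a or a', at the cost of one vertex. Since both sides turn out to have orders divisible by 3,
  rounding cancels this loss and both sides are tight.\<close>

lemma bridge_tiled:
  assumes tV: "tight V" and n3: "3 dvd card V" and A: "A \<subset> V" "A \<noteq> {}"
    and cross: "\<And>x y. x \<in> A \<Longrightarrow> y \<in> V - A \<Longrightarrow> adj x y \<Longrightarrow> x = a \<and> y = a'"
  shows "tiled V"
proof -
  define Z where "Z = V - A"
  have Z: "Z \<subset> V" "Z \<subseteq> V" "A \<subseteq> V" using A by (auto simp: Z_def)
  have cAZ: "card Z + card A = card V" using card_V_Diff[OF Z(3)] by (simp add: Z_def)
  have fin: "finite A" "finite Z" using Z finV finite_subset by blast+
  have join: "3 * (card I + card J) \<le> card V"
    if "I \<subseteq> A" "indep I" "J \<subseteq> Z" "indep J" "a \<notin> I \<or> a' \<notin> J" for I J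
  proof -
    have "indep (I \<union> J)" unfolding indep_Un
    proof (intro conjI ballI notI that(2,4))
      fix u v assume uv: "u \<in> I" "v \<in> J" "adj u v"
      have "u \<in> A" "v \<in> V - A" using uv that(1,3) by (auto simp: Z_def)
      then show False using cross[OF _ _ uv(3)] uv that(5) by blast
    qed
    moreover have "I \<union> J \<subseteq> V" using that Z by blast
    ultimately have "3 * card (I \<union> J) \<le> card V" using tV card_le_tight by blast
    moreover have "card (I \<union> J) = card I + card J"
    proof (rule card_Un_disjoint)
      show "finite I" "finite J" using that fin finite_subset by blast+
      show "I \<inter> J = {}" using that by (auto simp: Z_def)
    qed
    ultimately show ?thesis by simp
  qed
  have less1: "\<exists>I\<subseteq>U. indep I \<and> x \<notin> I \<and> card U \<le> 3 * card I + 1" if U: "U \<subset> V" for U x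
  proof -
    obtain I where I: "I \<subseteq> U - {x}" "indep I" "card (U - {x}) \<le> 3 * card I"
      using proper_third[of "U - {x}"] U by blast
    have "card U \<le> card (U - {x}) + 1" by (auto simp: card_Diff_singleton_if)
    then show ?thesis using I by (intro exI[of _ I]) auto
  qed
  obtain I1 where I1: "I1 \<subseteq> A" "indep I1" "card A \<le> 3 * card I1" using proper_third[OF A(1)] .
  obtain J1 where J1: "J1 \<subseteq> Z" "indep J1" "card Z \<le> 3 * card J1" using proper_third[OF Z(1)] .
  obtain I2 where I2: "I2 \<subseteq> A" "indep I2" "a \<notin> I2" "card A \<le> 3 * card I2 + 1" using less1[OF A(1)] by blast
  obtain J2 where J2: "J2 \<subseteq> Z" "indep J2" "a' \<notin> J2" "card Z \<le> 3 * card J2 + 1" using less1[OF Z(1)] by blast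
  have j12: "3 * (card I1 + card J2) \<le> card V" using join I1 J2 by blast
  have j21: "3 * (card I2 + card J1) \<le> card V" using join I2 J1 by blast
  obtain m where m: "card V = 3 * m" using n3 by blast
  \<comment> \<open>If the residues were 1 and 2, both sides would round up, even with the end of
    the bridge avoided on the side of residue 2. Together they would exceed n/3 by one.\<close>
  have arith: "z mod 3 = 0 \<and> x mod 3 = 0"
    if "x \<le> 3 * i1" "z \<le> 3 * j1" "x \<le> 3 * i2 + 1" "z \<le> 3 * j2 + 1" "3 * (i1 + j2) \<le> 3 * m"
      "3 * (i2 + j1) \<le> 3 * m" "z + x = 3 * m" for x z i1 i2 j1 j2 :: nat
  proof -
    obtain p r where x: "x = 3 * p + r" "r = 0 \<or> r = 1 \<or> r = 2" 
      by (metis mod_mult_div_eq add.commute mod3_nat)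
    obtain q s where z: "z = 3 * q + s" "s = 0 \<or> s = 1 \<or> s = 2"
      by (metis mod_mult_div_eq add.commute mod3_nat)
    have rs: "r = 0 \<and> s = 0 \<or> r = 1 \<and> s = 2 \<or> r = 2 \<and> s = 1"
      using x(2) z(2) that(7) unfolding x(1) z(1) by presburger
    have m: "i1 + j2 \<le> m" "i2 + j1 \<le> m" using that(5,6) by simp_all
    have False if r: "r = 1" "s = 2"
    proof -
      have "p + 1 \<le> i1" "q + 1 \<le> j2" "m = p + q + 1"
        using \<open>x \<le> 3 * i1\<close> \<open>z \<le> 3 * j2 + 1\<close> \<open>z + x = 3 * m\<close> r unfolding x(1) z(1) by presburger+
      then show False using m by linarith
    qed
    moreover have False if r: "r = 2" "s = 1"
    proof -
      have "p + 1 \<le> i2" "q + 1 \<le> j1" "m = p + q + 1"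
        using \<open>x \<le> 3 * i2 + 1\<close> \<open>z \<le> 3 * j1\<close> \<open>z + x = 3 * m\<close> r unfolding x(1) z(1) by presburger+
      then show False using m by linarith
    qed
    ultimately show ?thesis using rs x(1) z(1) by auto
  qed
  have mods: "card Z mod 3 = 0 \<and> card A mod 3 = 0"
    by (rule arith[OF I1(3) J1(3) I2(4) J2(4)]) (use j12 j21 cAZ m in auto)
  \<comment> \<open>For z divisible by 3, the bound z \<le> 3j + 1 already gives z \<le> 3j: an
    independent third of one side can avoid the bridge and be combined with any independent set of
    the other side.\<close>
  have up: "3 * i \<le> x" if h: "3 * (i + j) \<le> n" "z \<le> 3 * j + 1" "z mod 3 = 0" "z + x = n" for i j x z n :: nat
  proof -
    obtain q where z: "z = 3 * q" using h(3) by (metis mod_0_imp_dvd dvdE)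
    then have "q \<le> j" using h(2) by presburger
    moreover have "3 * i + 3 * j \<le> 3 * q + x" using h(1) unfolding h(4)[symmetric] z by (simp add: distrib_left)
    ultimately show ?thesis by linarith
  qed
  have "tight A" unfolding tight_def
    by (intro allI impI up[OF join[OF _ _ J2(1,2)] J2(4) _ cAZ]) (use J2(3) mods in auto)
  moreover have "tight Z" unfolding tight_def
  proof (intro allI impI)
    fix J assume J: "J \<subseteq> Z" "indep J"
    have "3 * (card J + card I2) \<le> card V" using join[OF I2(1,2) J] I2(3) by (simp add: add.commute)
    then show "3 * card J \<le> card Z" by (rule up[OF _ I2(4)]) (use mods cAZ in auto)
  qed
  ultimately have "tiled A" "tiled Z" using proper_tiled A Z by blast+
  then have "tiled (A \<union> Z)" by (rule tiled_Un) (auto simp: Z_def)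
  moreover have "A \<union> Z = V" using Z by (auto simp: Z_def)
  ultimately show ?thesis by simp
qed

text \<open>The case to be settled is that both ends of the added edge lie in one tile
  \<open>K\<close>. A triangle \<open>K\<close> forms a gadget on nine vertices with
  \<open>T\<close> and a further triangle. A subdivided K4 either forms one with \<open>T\<close>
  alone or leaves too large an independent set. A tile on nine vertices can occur only if
  \<open>V = T \<union> K\<close>, which has 12 vertices.\<close>

lemma triangle_tiled:
  assumes tV: "tight V" and n3: "3 dvd card V" and n12: "card V \<noteq> 12"
    and nodia: "\<And>a b c d. \<lbrakk>a \<in> V; b \<in> V; c \<in> V; d \<in> V; adj a b; adj a c; adj b c; adj a d; adj b d\<rbrakk> \<Longrightarrow> c = d"
    and abc: "a \<in> V" "b \<in> V" "c \<in> V" "adj a b" "adj b c" "adj a c"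
  shows "tiled V"
proof -
  have ne: "a \<noteq> b" "a \<noteq> c" "b \<noteq> c" using abc by auto
  note sym = abc(4-6)[THEN adj_sym]
  obtain a' where a': "nb V a = {b, c, a'}" "a' \<noteq> b" "a' \<noteq> c" "a' \<in> V" "adj a a'" "a' \<noteq> a"
    using third_nb[OF abc(1,2,3,4,6) ne(3)] .
  obtain b' where b': "nb V b = {a, c, b'}" "b' \<noteq> a" "b' \<noteq> c" "b' \<in> V" "adj b b'" "b' \<noteq> b"
    using third_nb[OF abc(2,1,3) sym(1) abc(5) ne(2)] .
  obtain c' where c': "nb V c = {a, b, c'}" "c' \<noteq> a" "c' \<noteq> b" "c' \<in> V" "adj c c'" "c' \<noteq> c"
    using third_nb[OF abc(3,1,2) sym(3,2) ne(1)] .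
  note sym' = a'(5)[THEN adj_sym] b'(5)[THEN adj_sym] c'(5)[THEN adj_sym]
  have ne': "a' \<noteq> b'" "a' \<noteq> c'" "b' \<noteq> c'"
    using nodia[of a b c a'] nodia[of a c b a'] nodia[of b c a b'] abc a' b' c' sym by blast+
  define T where "T = {a, b, c}"
  define Y where "Y = V - T"
  have TV: "T \<subseteq> V" using abc by (simp add: T_def)
  have cT: "card T = 3" using ne by (simp add: T_def)
  have YV: "Y \<subset> V" "Y \<subseteq> V" using abc by (auto simp: Y_def T_def)
  have finY: "finite Y" using finV by (simp add: Y_def)
  have cY: "card Y + 3 = card V" using card_V_Diff[OF TV] cT by (simp add: Y_def)
  have abcY: "a \<notin> Y" "b \<notin> Y" "c \<notin> Y" "a' \<in> Y" "b' \<in> Y" "c' \<in> Y"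
    using a' b' c' by (auto simp: Y_def T_def)
  have gT: "gadget T" unfolding T_def by (rule tri_gadgetI[OF abc(4-6)])
  have TY: "T \<inter> Y = {}" "T \<union> Y = V" using TV by (auto simp: Y_def)
  have finish: "tiled Y \<Longrightarrow> tiled V"
    using tiled_Un[OF tiled_gadget[OF gT] _ TY(1)] TY(2) by metis
  \<comment> \<open>If an outer neighbour were missing, the corresponding corner of \<open>T\<close>
    could be added to \<open>I\<close>, which would then exceed a third of \<open>V\<close>.\<close>
  have forced: "a' \<in> I \<and> b' \<in> I \<and> c' \<in> I" if I: "I \<subseteq> Y" "indep I" "\<not> 3 * card I \<le> card Y" for I
  proof -
    have finI: "finite I" using I(1) finY by (rule finite_subset)
    have "t' \<in> I" if t: "t \<in> T" "t' \<in> Y" "\<And>y. y \<in> Y \<Longrightarrow> adj t y \<Longrightarrow> y = t'" for t t'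
    proof (rule ccontr)
      assume n: "t' \<notin> I"
      have "\<not> adj t y" if "y \<in> I" for y using t(3)[of y] that I(1) n by blast
      then have "indep (insert t I)" using I(2) by (simp add: indep_insert)
      moreover have "insert t I \<subseteq> V" using t(1) TV I(1) YV by blast
      ultimately have "3 * card (insert t I) \<le> card V" using card_le_tight[OF tV] by blast
      moreover have "t \<notin> I" using t(1) I(1) TY by blast
      ultimately show False using I(3) finI cY n3 by simp
    qed
    moreover have "y = a'" if "y \<in> Y" "adj a y" for y using that a'(1) abcY nb_iff[of y V a] YV by auto
    moreover have "y = b'" if "y \<in> Y" "adj b y" for y using that b'(1) abcY nb_iff[of y V b] YV by auto
    moreover have "y = c'" if "y \<in> Y" "adj c y" for y using that c'(1) abcY nb_iff[of y V c] YV by auto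
    ultimately show ?thesis using abcY by (metis T_def insertCI)
  qed
  show ?thesis
  proof (cases "adj a' b' \<or> adj a' c' \<or> adj b' c'")
    case True
    have "tight Y" unfolding tight_def
    proof (intro allI impI, rule ccontr)
      fix I assume "I \<subseteq> Y" "indep I" "\<not> 3 * card I \<le> card Y"
      then show False using forced[of I] True by (auto simp: indep_def)
    qed
    then show ?thesis using finish proper_tiled YV by blast
  next
    case False
    then have nadj: "\<not> adj a' b'" "\<not> adj a' c'" "\<not> adj b' c'" by auto
    \<comment> \<open>Both b' and c' have lost a neighbour in \<open>T\<close>, so \<open>Y\<close>
      stays subcubic. By \<open>forced\<close>, the new edge makes \<open>Y\<close> tight.\<close>
    define adj' where "adj' x y \<longleftrightarrow> adj x y \<or> x = b' \<and> y = c' \<or> x = c' \<and> y = b'" for x y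
    interpret S: sgraph adj'
      by unfold_locales (use ne'(3) adj_sym in \<open>auto simp: adj'_def\<close>)
    have Snb: "S.nb U x = nb U x" if "x \<noteq> b'" "x \<noteq> c'" for U x
      using that by (auto simp: adj'_def)
    have nb_S: "nb U x \<subseteq> S.nb U x" for U x by (auto simp: adj'_def)
    have Sb: "S.nb U b' \<subseteq> insert c' (nb U b')" "S.nb U c' \<subseteq> insert b' (nb U c')" for U
      using ne' by (auto simp: adj'_def)
    have c2: "card (nb Y t') \<le> 2" if "t \<in> T" "t' \<in> V" "adj t' t" for t t'
      using card_nb_outside[OF subV YV(2) that(2) _ that(3)] that(1) TV TY by blast
    have S_sub: "S.subcubic Y"
      unfolding S.subcubic_def
    proof (intro conjI ballI finY)
      fix y assume y: "y \<in> Y"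
      have fin: "finite (nb Y y)" for y using finY by (rule finite_nb)
      consider "y = b'" | "y = c'" | "y \<noteq> b'" "y \<noteq> c'" by blast
      then show "card (S.nb Y y) \<le> 3"
      proof cases
        case 1
        have "card (S.nb Y y) \<le> card (insert c' (nb Y b'))" using Sb 1 fin by (intro card_mono) auto
        also have "\<dots> \<le> 3" using c2[of b b'] b' sym' fin by (auto simp: card_insert_if T_def)
        finally show ?thesis .
      next
        case 2
        have "card (S.nb Y y) \<le> card (insert b' (nb Y c'))" using Sb 2 fin by (intro card_mono) auto
        also have "\<dots> \<le> 3" using c2[of c c'] c' sym' fin by (auto simp: card_insert_if T_def)
        finally show ?thesis .
      next
        case 3
        then show ?thesis using Snb[OF 3] subU[OF YV(2)] y by (simp add: subcubic_def)
      qed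
    qed
    have S_indep: "indep I" if "S.indep I" for I
      using that by (auto simp: S.indep_def indep_def adj'_def)
    have S_tight: "S.tight Y" unfolding S.tight_def
    proof (intro allI impI, rule ccontr)
      fix I assume I: "I \<subseteq> Y" "S.indep I" "\<not> 3 * card I \<le> card Y"
      then have "b' \<in> I" "c' \<in> I" using forced S_indep by blast+
      then show False using I(2) by (auto simp: S.indep_def adj'_def)
    qed
    show ?thesis
    proof (cases "S.deficient Y")
      case False
      \<comment> \<open>A cubic union of components must contain b' and c', since the added edge
        made it cubic, but not a', which has degree at most 2. So the edge aa' is a bridge between
        \<open>W \<union> T\<close> and the rest.\<close>
      then obtain W where W: "W \<subseteq> Y" "W \<noteq> {}" "\<And>w. w \<in> W \<Longrightarrow> S.nb Y w \<subseteq> W"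
        "\<And>w. w \<in> W \<Longrightarrow> card (S.nb Y w) \<ge> 3"
        unfolding S.deficient_def by (meson not_less)
      have a'W: "a' \<notin> W"
      proof
        assume "a' \<in> W"
        then have "card (S.nb Y a') \<ge> 3" by (rule W(4))
        moreover have "card (nb Y a') \<le> 2" using c2[of a a'] a' sym' by (simp add: T_def)
        ultimately show False using Snb ne' by simp
      qed
      have bcW: "b' \<in> W" "c' \<in> W"
      proof -
        have "b' \<in> W \<or> c' \<in> W"
        proof (rule ccontr)
          assume n: "\<not> ?thesis"
          have "W = V"
          proof (rule conn)
            show "W \<subseteq> V" using W YV by blast
            fix w assume w: "w \<in> W"
            have e: "S.nb Y w = nb Y w" using Snb[of w] n w by blast
            have wV: "w \<in> V" using w W YV by blast
            have "nb Y w = nb V w"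
            proof (rule card_subset_eq)
              show "card (nb Y w) = card (nb V w)"
              proof (rule antisym)
                show "card (nb Y w) \<le> card (nb V w)" using nb_mono[OF YV(2)] finV by (intro card_mono finite_nb)
                show "card (nb V w) \<le> card (nb Y w)" using W(4)[OF w] e deg3[OF wV] by simp
              qed
            qed (use finV nb_mono[OF YV(2)] in \<open>auto simp: finite_nb\<close>)
            then show "nb V w \<subseteq> W" using W(3)[OF w] e by metis
          qed (rule W)
          then show False using W abcY abc by blast
        qed
        moreover have "c' \<in> S.nb Y b'" "b' \<in> S.nb Y c'" using abcY by (auto simp: adj'_def)
        ultimately show "b' \<in> W" "c' \<in> W" using W(3) by blast+
      qed
      show ?thesis
      proof (rule bridge_tiled[OF tV n3, of "W \<union> T" a a'])
        have "a' \<notin> T" using abcY TY by blast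
        then show "W \<union> T \<subset> V" using W YV TV a'W a'(4) by blast
        show "W \<union> T \<noteq> {}" using W by blast
        fix x y assume xy: "x \<in> W \<union> T" "y \<in> V - (W \<union> T)" "adj x y"
        have yV: "y \<in> V" "y \<notin> W" "y \<notin> T" "y \<in> Y" using xy TY by blast+
        have "x \<notin> W"
        proof
          assume "x \<in> W"
          moreover have "y \<in> S.nb Y x" using yV xy(3) by (simp add: adj'_def)
          ultimately show False using W(3) yV by blast
        qed
        then consider "x = a" | "x = b" | "x = c" using xy(1) by (auto simp: T_def)
        then show "x = a \<and> y = a'"
        proof cases
          case 1
          then have "y \<in> {b, c, a'}" using a'(1) yV xy(3) nb_iff[of y V a] by simp
          then show ?thesis using 1 yV by (auto simp: T_def)
        next
          case 2
          then have "y \<in> {a, c, b'}" using b'(1) yV xy(3) nb_iff[of y V b] by simp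
          then show ?thesis using yV bcW by (auto simp: T_def)
        next
          case 3
          then have "y \<in> {a, b, c'}" using c'(1) yV xy(3) nb_iff[of y V c] by simp
          then show ?thesis using yV bcW by (auto simp: T_def)
        qed
      qed
    next
      case True
      obtain P where P: "S.tiling Y P"
        using S.tight_deficient_tiled[OF S_sub True S_tight] unfolding S.tiled_def by blast
      have gad: "gadget B" if BP: "B \<in> P" and nB: "b' \<notin> B \<or> c' \<notin> B" for B
      proof -
        obtain d \<beta> g where g: "S.gadget_at d \<beta> g B" using S.tilingD(2)[OF P BP] by (auto simp: S.gadget_def)
        have "adj' (g i) (g j) \<longleftrightarrow> adj (g i) (g j)" if "i \<in> gadget_verts d" "j \<in> gadget_verts d" for i j
        proof -
          have "g i \<in> B" "g j \<in> B" using S.gadget_atD(4)[OF g] that by auto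
          then show ?thesis using nB by (auto simp: adj'_def)
        qed
        then have "gadget_at d \<beta> g B" using g by (simp add: S.gadget_at_def gadget_at_def)
        then show ?thesis by (auto simp: gadget_def)
      qed
      have pwP: "\<Union>P = Y" "pairwise disjnt P" using P by (auto simp: S.tiling_def)
      obtain K where K: "K \<in> P" "b' \<in> K" using pwP abcY by blast
      show ?thesis
      proof (cases "c' \<in> K")
        case False
        have "gadget B" if "B \<in> P" for B
          using gad[OF that] S.tilingD(4)[OF P that K(1)] K(2) False by blast
        then have "tiled Y" using pwP unfolding tiled_def tiling_def by blast
        then show ?thesis by (rule finish)
      next
        case c'K: True
        define F where "F = Y - K"
        have KY: "K \<subseteq> Y" using S.tilingD(1)[OF P K(1)] .
        have KV: "K \<subseteq> V" "K \<inter> T = {}" using KY YV TY by blast+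
        have FV: "F \<subset> V" "F \<subseteq> V" "F \<subseteq> Y" using YV by (auto simp: F_def)
        have finF: "finite F" using finY by (simp add: F_def)
        have PF: "tiling F (P - {K})" unfolding tiling_def
        proof (intro conjI ballI)
          show "pairwise disjnt (P - {K})" using pwP(2) by (rule pairwise_subset) blast
          show "\<Union>(P - {K}) = F"
          proof (rule set_eqI)
            fix x
            show "x \<in> \<Union>(P - {K}) \<longleftrightarrow> x \<in> F"
              using S.tilingD(4)[OF P _ K(1), of _ x] pwP(1) unfolding F_def by blast
          qed
          fix B assume "B \<in> P - {K}"
          then show "gadget B" using gad[of B] S.tilingD(4)[OF P _ K(1), of B b'] K(2) by blast
        qed
        have FK: "F = V - (T \<union> K)" by (auto simp: F_def Y_def)
        have TKV: "T \<union> K \<subseteq> V" using TV KV by blast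
        obtain d \<beta> g where g: "S.gadget_at d \<beta> g K" using S.tilingD(2)[OF P K(1)] by (auto simp: S.gadget_def)
        note gK = S.gadget_atD[OF g]
        have finK: "finite K" using S.gadget_finite S.tilingD(2)[OF P K(1)] .
        have cF: "card F + (card K + 3) = card V"
        proof -
          have "card (T \<union> K) = card K + 3" using finK cT KV by (subst card_Un_disjoint) (auto simp: T_def)
          then show ?thesis using card_V_Diff[OF TKV] FK by simp
        qed
        obtain i j where i: "i \<in> gadget_verts d" "g i = b'" and j0: "j \<in> gadget_verts d" "g j = c'"
          using K(2) c'K gK(4) by auto
        have j: "j \<in> gnb d \<beta> i" using gK(5)[OF i(1) j0(1)] i j0 by (simp add: adj'_def)
        have ij: "i \<noteq> j" using i j0 ne'(3) by auto
        have adjK: "adj (g x) (g y)"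
          if "x \<in> gadget_verts d" "y \<in> gnb d \<beta> x" "{x, y} \<noteq> {i, j}" for x y
        proof -
          have y: "y \<in> gadget_verts d" using that(2) by (simp add: gnb_def)
          have "adj' (g x) (g y)" using gK(5)[OF that(1) y] that by simp
          moreover have "\<not> (g x = b' \<and> g y = c')" "\<not> (g x = c' \<and> g y = b')"
            using gK(3) that y i j0 unfolding inj_on_def by (metis insert_commute)+
          ultimately show ?thesis by (auto simp: adj'_def)
        qed
        have nbF: "nb F (g x) = {}" if "x \<in> gadget_verts d - attach_verts d" for x
        proof -
          have "S.nb Y (g x) \<subseteq> K" by (rule S.gadget_inner_nb[OF g that S_sub KY])
          then have "nb Y (g x) \<subseteq> K" using nb_S[of Y "g x"] by (rule subset_trans[rotated])
          moreover have "nb F (g x) \<subseteq> nb Y (g x)" by (rule nb_mono[OF FV(3)])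
          moreover have "nb F (g x) \<inter> K = {}" by (auto simp: F_def)
          ultimately show ?thesis by blast
        qed
        have nbF1: "card (nb F (g x)) \<le> 1" if x: "x \<in> attach_verts d" for x
        proof -
          have xv: "x \<in> gadget_verts d" using x attach_subset by blast
          then have xY: "g x \<in> Y" using gK(4) KY by blast
          have "card (S.nb K (g x)) = 2" using S.gadget_card_nb[OF g xv] x by simp
          moreover have "card (S.nb K (g x)) + card (nb F (g x)) = card (S.nb K (g x) \<union> nb F (g x))"
            using finK finF by (intro card_Un_disjoint[symmetric] finite_nb S.finite_nb) (auto simp: F_def)
          moreover have "card (S.nb K (g x) \<union> nb F (g x)) \<le> card (S.nb Y (g x))"
            using KY finY by (intro card_mono S.finite_nb) (auto simp: F_def adj'_def)
          moreover have "card (S.nb Y (g x)) \<le> 3" using S_sub xY by (simp add: S.subcubic_def)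
          ultimately show ?thesis by linarith
        qed
        text \<open>Deleting the added edge frees one more vertex in its gadget, and a vertex of the
          new triangle on top of that; this is too much unless a triangle blocks it.\<close>
        have key: "\<exists>T'\<in>P - {K}. card T' = 3 \<and> T' \<subseteq> insert a' (\<Union>l\<in>L. nb F (g l)) \<and> card (L \<inter> attach_verts d) \<ge> 2"
          if L: "near_indep d \<beta> i j L" "card L = gadget_alpha d + 1" "a' \<notin> g ` L"
            "card (L \<inter> attach_verts d) \<le> 2" for L
        proof -
          have Lv: "L \<subseteq> gadget_verts d" using L(1) by (simp add: near_indep_def)
          have finL: "finite L" using Lv finite_gadget_verts finite_subset by blast
          define N where "N = (\<Union>l\<in>L. nb F (g l))"
          have N: "N = (\<Union>l\<in>L \<inter> attach_verts d. nb F (g l))"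
            unfolding N_def using nbF Lv by blast
          have "card N \<le> (\<Sum>l\<in>L \<inter> attach_verts d. card (nb F (g l)))"
            unfolding N using finL by (intro card_UN_le) simp
          also have "\<dots> \<le> (\<Sum>l\<in>L \<inter> attach_verts d. 1)" by (rule sum_mono) (use nbF1 in auto)
          finally have cN: "card N \<le> card (L \<inter> attach_verts d)" by simp
          have finN: "finite N" using finL finF by (simp add: N_def finite_nb)
          define B where "B = insert a' N"
          have cB: "card B \<le> card (L \<inter> attach_verts d) + 1" using cN finN by (simp add: B_def card_insert_if)
          have gLK: "g ` L \<subseteq> K" using gK(4) Lv by blast
          have gL: "card (g ` L) = gadget_alpha d + 1"
            using gK(3) Lv L(2) by (metis card_image inj_on_subset)
          have indL: "indep (g ` L)" unfolding indep_def
          proof (intro ballI notI)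
            fix u v assume "u \<in> g ` L" "v \<in> g ` L" and uv: "adj u v"
            then obtain x y where xy: "x \<in> L" "y \<in> L" "u = g x" "v = g y" by blast
            have "y \<in> gnb d \<beta> x" using gK(5)[of x y] uv xy Lv by (auto simp: adj'_def)
            then have "{x, y} = {i, j}" using L(1) xy by (auto simp: near_indep_def)
            then have "adj b' c'" using uv xy i j0 adj_sym by (auto simp: doubleton_eq_iff)
            then show False using nadj by simp
          qed
          have noa: "\<not> adj a y" if "y \<in> Y" "y \<noteq> a'" for y
            using that a'(1) abcY nb_iff[of y V a] YV by auto
          show ?thesis
          proof (rule blocking[OF subU[OF FV(2)] PF, of B])
            show "finite B" using finN by (simp add: B_def)
            show "card B \<le> 4" using cB L(4) by linarith
          next
            fix x assume x: "x \<in> B" "x \<in> F"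
            have xV: "x \<in> V" using x FV by blast
            have "\<exists>s\<in>V - F. adj x s"
            proof (cases "x = a'")
              case True
              then show ?thesis using sym'(1) abc(1) abcY FV by blast
            next
              case False
              then obtain l where "l \<in> L" "x \<in> nb F (g l)" using x by (auto simp: B_def N_def)
              moreover have "g l \<in> K" using \<open>l \<in> L\<close> gLK by blast
              ultimately show ?thesis using adj_sym KV by (auto simp: F_def)
            qed
            then show "card (nb F x) \<le> 2" using card_nb_outside[OF subV FV(2) xV] by blast
          next
            fix J assume J: "J \<subseteq> F" "indep J" "3 * card J = card F"
            show "J \<inter> B \<noteq> {}"
            proof
              assume e: "J \<inter> B = {}"
              have JY: "J \<subseteq> Y" "J \<inter> K = {}" using J(1) by (auto simp: F_def)
              have finJ: "finite J" using J(1) finF by (rule finite_subset)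
              have a1: "\<not> adj a y" if "y \<in> g ` L \<union> J" for y
                by (rule noa) (use that gLK KY JY e L(3) in \<open>auto simp: B_def\<close>)
              have a2: "\<not> adj u y" if u: "u \<in> g ` L" and y: "y \<in> J" for u y
              proof
                assume "adj u y"
                then have "y \<in> B" using u y J(1) by (auto simp: B_def N_def)
                then show False using e y by blast
              qed
              have "indep (g ` L \<union> J)" unfolding indep_Un using indL J(2) a2 by blast
              then have "indep (insert a (g ` L \<union> J))" using a1 by (simp add: indep_insert)
              moreover have "insert a (g ` L \<union> J) \<subseteq> V" using abc gLK KV JY YV by blast
              ultimately have "3 * card (insert a (g ` L \<union> J)) \<le> card V" using card_le_tight[OF tV] by blast
              moreover have "card (insert a (g ` L \<union> J)) = gadget_alpha d + 1 + card J + 1"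
              proof -
                have "card (g ` L \<union> J) = card (g ` L) + card J"
                  using finL finJ JY(2) gLK by (intro card_Un_disjoint) auto
                moreover have "a \<notin> g ` L \<union> J" using abcY gLK KY JY by blast
                ultimately show ?thesis using gL finL finJ by simp
              qed
              \<comment> \<open>The set has |F|/3 + |K|/3 + 2 vertices, whereas |V|/3 is only |F|/3
                + |K|/3 + 1.\<close>
              ultimately show False using J(3) cF S.gadget_card[OF g] by linarith
            qed
          next
            fix T' assume T': "T' \<in> P - {K}" "card T' = 3" "T' \<subseteq> B"
            \<comment> \<open>The blockers are a' and at most one neighbour for each attachment
              vertex in \<open>L\<close>, so a blocked triangle requires two such vertices.\<close>
            have "3 \<le> card B" using card_mono[of B T'] T' finN by (simp add: B_def)
            then have "card (L \<inter> attach_verts d) \<ge> 2" using cB by linarith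
            then show ?thesis using T' by (auto simp: B_def N_def)
          next
            fix T1 T2 r1 r2 assume T12: "T1 \<in> P - {K}" "T2 \<in> P - {K}" "T1 \<noteq> T2" "card T1 = 3" "card T2 = 3"
              "B = T1 \<union> T2 - {r1, r2}"
            \<comment> \<open>Blocking two triangles takes four vertices, but there are at most
              three blockers.\<close>
            have fin: "finite T1" "finite T2" using tilingD(2)[OF PF] T12 gadget_finite by blast+
            have "T1 \<inter> T2 = {}" using tilingD(4)[OF PF T12(1,2)] T12(3) by blast
            then have "card (T1 \<union> T2) = 6" using fin T12 by (simp add: card_Un_disjoint)
            moreover have "card {r1, r2} \<le> 2" by (simp add: card_insert_if)
            moreover have "card (T1 \<union> T2) - card {r1, r2} \<le> card (T1 \<union> T2 - {r1, r2})"
              by (rule diff_card_le_card_Diff) simp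
            ultimately show ?thesis using cB L(4) T12(6) by simp
          qed
        qed
        \<comment> \<open>Without its neighbour a, the vertex a' has degree at most 2 in
          \<open>Y\<close>, too small for an inner vertex of a tile.\<close>
        have a'K: "\<exists>t\<in>attach_verts d. a' = g t" if a'inK: "a' \<in> K"
        proof (rule ccontr)
          assume n: "\<not> ?thesis"
          obtain t where t: "t \<in> gadget_verts d" "a' = g t" using a'inK gK(4) by blast
          have "card (S.nb K a') = 3" using S.gadget_card_nb[OF g t(1)] n t by auto
          moreover have "card (S.nb K a') \<le> card (nb Y a')"
            unfolding Snb[OF ne'(1,2)] using finY KY by (intro card_mono finite_nb nb_mono)
          moreover have "card (nb Y a') \<le> 2" using c2[of a a'] a' sym' by (simp add: T_def)
          ultimately show False by simp
        qed
        have FV': "V - (T \<union> K) = F" using FK by simp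
        consider "d = 3" | "d = 2" | "d = Suc 0" using gK(1) by auto
        then show ?thesis
        proof cases
          case 1
          obtain k where k: "k \<in> gadget_verts 3" "k \<noteq> i" "k \<noteq> j" "gadget_verts 3 = {i, j, k}"
          proof -
            have "i \<in> {0,1,2}" "j \<in> {0,1,2}" using i j0 1 by (auto simp: gadget_verts_simps)
            then show ?thesis using that[of "3 - i - j"] ij by (auto simp: gadget_verts_simps insert_commute)
          qed
          define e where "e = g k"
          have Ke: "K = {b', c', e}" using gK(4) k(4) i j0 1 by (auto simp: e_def)
          have ebc: "e \<noteq> b'" "e \<noteq> c'" using gK(3) k i j0 1 unfolding inj_on_def e_def by metis+
          have eV: "e \<in> V" "e \<in> Y" "e \<notin> T" using Ke KY YV TY by auto
          have eadj: "adj e b'" "adj e c'"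
          proof -
            have "y \<in> gnb d \<beta> k" if "y \<in> {i, j}" for y
              using attach_adjacent[of d k y \<beta>] k that 1 i j0 by (auto simp: gadget_verts_simps attach_verts_simps)
            then show "adj e b'" "adj e c'" using adjK[of k i] adjK[of k j] k i j0 1
              by (auto simp: e_def doubleton_eq_iff)
          qed
          have nearL: "near_indep d \<beta> i j {i, j}"
            using i j0 gnb_irrefl by (auto simp: near_indep_def)
          have "\<exists>T'\<in>P - {K}. card T' = 3 \<and> T' \<subseteq> insert a' (\<Union>l\<in>{i, j}. nb F (g l)) \<and> card ({i, j} \<inter> attach_verts d) \<ge> 2"
          proof (rule key[OF nearL])
            show "card {i, j} = gadget_alpha d + 1" using ij 1 by (simp add: gadget_alpha_def)
            show "a' \<notin> g ` {i, j}" using i j0 ne' by auto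
            have "card ({i, j} \<inter> attach_verts d) \<le> card {i, j}" by (intro card_mono) auto
            then show "card ({i, j} \<inter> attach_verts d) \<le> 2" using ij by simp
          qed
          then obtain T' where T': "T' \<in> P - {K}" "card T' = 3" "T' \<subseteq> insert a' (nb F b' \<union> nb F c')"
            using i j0 by auto
          have gT': "gadget T'" and T'F: "T' \<subseteq> F" using tilingD(1,2)[OF PF] T' by blast+
          have c1: "card (nb F b') \<le> 1" "card (nb F c') \<le> 1"
            using nbF1[of i] nbF1[of j] i j0 1 by (auto simp: gadget_verts_simps attach_verts_simps)
          have finb: "finite (nb F b')" "finite (nb F c')" using finF by (auto simp: finite_nb)
          \<comment> \<open>On their own, b' and c' block at most one vertex each.\<close>
          have a'T: "a' \<in> T'"
          proof (rule ccontr)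
            assume "a' \<notin> T'"
            then have "T' \<subseteq> nb F b' \<union> nb F c'" using T'(3) by blast
            then have "card T' \<le> card (nb F b' \<union> nb F c')" using finb by (intro card_mono) auto
            then show False using T'(2) c1 card_Un_le[of "nb F b'" "nb F c'"] by linarith
          qed
          have "card (T' - {a'}) = 2" using T'(2) a'T by simp
          then obtain x y where xy: "T' - {a'} = {x, y}" "x \<noteq> y" unfolding card_2_iff by blast
          have T'xy: "T' = {a', x, y}" "x \<noteq> a'" "y \<noteq> a'" using xy(1) a'T by blast+
          have pw: "\<not> (adj b' x \<and> adj b' y)" "\<not> (adj c' x \<and> adj c' y)"
          proof -
            have xyF: "x \<in> F" "y \<in> F" using T'xy T'F by auto
            show "\<not> (adj b' x \<and> adj b' y)"
            proof
              assume "adj b' x \<and> adj b' y"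
              then have "card {x, y} \<le> card (nb F b')" using xyF finb by (intro card_mono) auto
              then show False using c1 xy(2) by simp
            qed
            show "\<not> (adj c' x \<and> adj c' y)"
            proof
              assume "adj c' x \<and> adj c' y"
              then have "card {x, y} \<le> card (nb F c')" using xyF finb by (intro card_mono) auto
              then show False using c1 xy(2) by simp
            qed
          qed
          have cov: "adj b' x \<or> adj c' x" "adj b' y \<or> adj c' y"
            using T'(3) T'xy by auto
          obtain u v where uv: "T' = {a', u, v}" "u \<noteq> v" "u \<noteq> a'" "v \<noteq> a'" "adj b' u" "adj c' v"
          proof (cases "adj b' x")
            case True
            then show ?thesis using that[of x y] T'xy xy(2) pw cov by blast
          next
            case False
            then have "adj c' x" "adj b' y" using cov pw by blast+
            moreover have "T' = {a', y, x}" using T'xy by auto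
            ultimately show ?thesis using that[of y x] T'xy xy(2) by blast
          qed
          note tri = triangle_gadget[OF gT' T'(2)]
          have tr: "adj v u" "adj u a'" "adj v a'" by (rule tri; use uv in simp)+
          have uvF: "u \<in> F" "v \<in> F" "a' \<in> F" using uv(1) T'F by auto
          \<comment> \<open>The third vertex e of \<open>K\<close> becomes the attachment vertex,
            with neighbours b' and c'. Each of these sees one vertex of \<open>T\<close> and one of
            \<open>T'\<close>, and aa' joins the two triangles.\<close>
          have "gadget {e, b', c', b, c, a, v, u, a'}"
          proof (rule nine_gadgetI[OF subV])
            show "{e, b', c', b, c, a, v, u, a'} \<subseteq> V" using eV abc b' c' uvF FV by auto
            show "distinct [e, b', c', b, c, a, v, u, a']"
              using eV ebc abcY ne ne' uv uvF Ke by (auto simp: F_def T_def)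
          qed (use eadj abc sym sym' a' b' c' tr uv in auto)
          moreover have "{e, b', c', b, c, a, v, u, a'} = (T \<union> K) \<union> \<Union>{T'}"
            using uv(1) Ke by (auto simp: T_def)
          ultimately show ?thesis
            using tiled_replace_V[of "T \<union> K" "P - {K}" "{T'}"] PF FV' T'(1) TKV by simp
        next
          case 2
          have i6: "i \<in> {0,1,2,3,4,5}" using i 2 by (simp add: gadget_verts_simps)
          have gKV: "x \<in> {0,1,2,3,4,5} \<Longrightarrow> g x \<in> V" for x using gK(4) KV 2 by (auto simp: gadget_verts_simps)
          have e2: "adj (g x) (g y)" if "x \<in> {0,1,2,3,4,5}" "y \<in> gnb 2 \<beta> x" "{x, y} \<noteq> {i, j}" for x y
            using adjK[of x y] that 2 by (simp add: gadget_verts_simps)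
          have inj2: "inj_on g {0,1,2,3,4,5}" using gK(3) 2 by (simp add: gadget_verts_simps)
          have g01: "g 0 \<noteq> g 1" using inj2 by (auto simp: inj_on_def)
          \<comment> \<open>If the added edge joined the subdivision vertices, the rest of
            \<open>K\<close> would be a diamond of the original graph.\<close>
          have ij45: "{i, j} \<noteq> {4, 5}"
          proof
            assume e: "{i, j} = {4, 5}"
            have "g 0 = g 1"
            proof (rule nodia[of "g 2" "g 3"])
              show "adj (g 2) (g 3)" "adj (g 2) (g 0)" "adj (g 3) (g 0)" "adj (g 2) (g 1)" "adj (g 3) (g 1)"
                unfolding One_nat_def by (rule e2; simp add: e gnb_simps doubleton_eq_iff)+
            qed (use gKV in simp_all)
            then show False using g01 by simp
          qed
          \<comment> \<open>The label of a' in \<open>K\<close>; the value 9 is no label of this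
            gadget and means that a' lies elsewhere.\<close>
          define t where "t = (if a' = g 4 then 4 else if a' = g 5 then 5 else (9::nat))"
          have t: "t \<noteq> i" "t \<noteq> j" "t \<notin> {0, 1, 2, 3}"
            using i j0 ne' 2 by (auto simp: t_def gadget_verts_simps)
          have a't: "x = t" if "x \<in> {0,1,2,3,4,5}" "a' = g x" for x
          proof -
            have "a' \<in> K" using that gK(4) 2 by (auto simp: gadget_verts_simps)
            then obtain s where s: "s \<in> {4,5}" "a' = g s" using a'K 2 by (auto simp: attach_verts_simps)
            then have "x = s" using inj2 that by (auto simp: inj_on_def)
            then show ?thesis using s inj2 by (auto simp: t_def inj_on_def)
          qed
          \<comment> \<open>The positions without a suitable witness: the added edge AC joins an end
            A of the subdivided edge to C, and a' is the subdivision vertex far from A. Deleting AC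
            leaves the triangle B' C D, which together with \<open>T\<close>, with A and a', and
            with X as attachment vertex forms a gadget on nine vertices.\<close>
          have special: "tiled V"
            if s: "{A, B', C, D, X, t} = {0,1,2,3,4,5}" "distinct [A, B', C, D, X, t]" "{i, j} = {A, C}"
              "D \<in> gnb 2 \<beta> A" "C \<in> gnb 2 \<beta> B'" "D \<in> gnb 2 \<beta> B'" "D \<in> gnb 2 \<beta> C" "X \<in> gnb 2 \<beta> A" "t \<in> gnb 2 \<beta> X"
              "B' \<in> gnb 2 \<beta> t" for A B' C D X
          proof -
            have mem: "A \<in> {0,1,2,3,4,5}" "B' \<in> {0,1,2,3,4,5}" "C \<in> {0,1,2,3,4,5}" "X \<in> {0,1,2,3,4,5}"
              "D \<in> {0,1,2,3,4,5}" "t \<in> {0,1,2,3,4,5}"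
              using s(1) by blast+
            have a't': "a' = g t" using mem(6) by (auto simp: t_def split: if_splits)
            have dn: "A \<noteq> B'" "A \<noteq> C" "A \<noteq> D" "A \<noteq> X" "A \<noteq> t" "B' \<noteq> C" "B' \<noteq> D" "C \<noteq> D" "C \<noteq> X" "C \<noteq> t"
              using s(2) by simp_all
            have ed: "adj (g A) (g D)" "adj (g B') (g C)" "adj (g B') (g D)" "adj (g C) (g D)" "adj (g A) (g X)"
              "adj (g X) (g t)" "adj (g t) (g B')"
              using e2[OF mem(1) s(4)] e2[OF mem(2) s(5)] e2[OF mem(2) s(6)] e2[OF mem(3) s(7)]
                e2[OF mem(1) s(8)] e2[OF mem(4) s(9)] e2[OF mem(6) s(10)] dn s(3)
              by (simp_all add: doubleton_eq_iff)
            have "distinct (map g [A, B', C, D, X, t])"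
              unfolding distinct_map using s(2) inj2 by (simp only: list.set s(1) simp_thms)
            then have dist: "distinct [g A, g B', g C, g D, g X, g t]" by (simp only: list.map)
            have inY: "g x \<in> Y" "g x \<in> K" "g x \<in> V" "g x \<noteq> a" "g x \<noteq> b" "g x \<noteq> c" if "x \<in> {0,1,2,3,4,5}" for x
            proof -
              have "x \<in> gadget_verts d" using that 2 by (simp add: gadget_verts_simps)
              then show "g x \<in> K" using gK(4) by blast
              then show "g x \<in> Y" using KY by blast
              then show "g x \<in> V" "g x \<noteq> a" "g x \<noteq> b" "g x \<noteq> c" using YV abcY by blast+
            qed
            define \<gamma> where "\<gamma> = (if g A = b' then c else b)"
            define \<delta> where "\<delta> = (if g A = b' then b else c)"
            have gd: "adj (g A) \<delta>" "adj (g C) \<gamma>" "{\<gamma>, \<delta>} = {b, c}" "\<gamma> \<noteq> \<delta>"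
              using s(3) i j0 sym' ne' ne by (auto simp: \<gamma>_def \<delta>_def doubleton_eq_iff)
            have gd2: "adj a \<delta>" "adj \<delta> \<gamma>" "adj a \<gamma>" using abc sym by (auto simp: \<gamma>_def \<delta>_def)
            have bc: "\<gamma> \<in> {b, c}" "\<delta> \<in> {b, c}" by (auto simp: \<gamma>_def \<delta>_def)
            have "gadget {g X, g A, g t, g D, g B', g C, a, \<delta>, \<gamma>}"
            proof (rule nine_gadgetI[OF subV])
              note m = inY[OF mem(1)] inY[OF mem(2)] inY[OF mem(3)] inY[OF mem(4)] inY[OF mem(5)] inY[OF mem(6)]
              have \<gamma>\<delta>: "\<gamma> = b \<and> \<delta> = c \<or> \<gamma> = c \<and> \<delta> = b" using bc gd(4) by auto
              then show "{g X, g A, g t, g D, g B', g C, a, \<delta>, \<gamma>} \<subseteq> V" using m abc by simp metis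
              show "distinct [g X, g A, g t, g D, g B', g C, a, \<delta>, \<gamma>]"
                using \<gamma>\<delta>
              proof
                assume "\<gamma> = b \<and> \<delta> = c"
                then show ?thesis using dist ne m by (simp; metis)
              next
                assume "\<gamma> = c \<and> \<delta> = b"
                then show ?thesis using dist ne m by (simp; metis)
              qed
              show "adj (g t) a" using a't' sym' by simp
              show "adj (g X) (g A)" "adj (g D) (g B')" "adj (g D) (g C)" using ed adj_sym by blast+
              show "adj (g A) (g B') \<and> adj (g t) \<delta> \<or> adj (g A) \<delta> \<and> adj (g t) (g B')" using gd ed by blast
            qed (use ed gd gd2 in auto)
            moreover have "{g X, g A, g t, g D, g B', g C, a, \<delta>, \<gamma>} = T \<union> K"
            proof -
              have "K = g ` {A, B', C, D, X, t}" using gK(4) 2 s(1) by (simp add: gadget_verts_simps)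
              moreover have "T = {a, \<delta>, \<gamma>}" using gd(3) by (auto simp: T_def doubleton_eq_iff)
              ultimately show ?thesis by auto
            qed
            ultimately show ?thesis
              using tiled_replace_V[of "T \<union> K" "P - {K}" "{}"] PF FV' TKV by simp
          qed
          show ?thesis
          proof (cases "(t = 5 \<and> {i, j} = {0, 2}) \<or> (t = 5 \<and> {i, j} = {0, 3}) \<or> (t = 4 \<and> {i, j} = {1, 2}) \<or> (t = 4 \<and> {i, j} = {1, 3})")
            case True
            then show ?thesis
            proof (elim disjE)
              assume "t = 5 \<and> {i, j} = {0, 2}"
              then have e: "t = 5" "{i, j} = {0, 2}" by simp_all
              show ?thesis by (rule special[of 0 1 2 3 4]) (simp_all add: e gnb_simps insert_commute)
            next
              assume "t = 5 \<and> {i, j} = {0, 3}"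
              then have e: "t = 5" "{i, j} = {0, 3}" by simp_all
              show ?thesis by (rule special[of 0 1 3 2 4]) (simp_all add: e gnb_simps insert_commute)
            next
              assume "t = 4 \<and> {i, j} = {1, 2}"
              then have e: "t = 4" "{i, j} = {1, 2}" by simp_all
              show ?thesis by (rule special[of 1 0 2 3 5]) (simp_all add: e gnb_simps insert_commute)
            next
              assume "t = 4 \<and> {i, j} = {1, 3}"
              then have e: "t = 4" "{i, j} = {1, 3}" by simp_all
              show ?thesis by (rule special[of 1 0 3 2 5]) (simp_all add: e gnb_simps insert_commute)
            qed
          next
            case False
            obtain L where L: "near_indep 2 \<beta> i j L" "card L = 3" "t \<notin> L" "card (L \<inter> {4, 5}) = 1"
            proof -
              have "\<exists>L. near_indep 2 \<beta> i j L \<and> card L = 3 \<and> t \<notin> L \<and> card (L \<inter> {4, 5}) = 1"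
                by (rule critical_k4star) (use i(1) j 2 ij45 t False in simp_all)
              then show ?thesis using that by blast
            qed
            have L6: "L \<subseteq> {0,1,2,3,4,5}" using L(1) by (simp add: near_indep_def gadget_verts_simps)
            have "a' \<notin> g ` L"
            proof
              assume "a' \<in> g ` L"
              then obtain x where "x \<in> L" "a' = g x" by blast
              then show False using a't[of x] L6 L(3) by blast
            qed
            \<comment> \<open>This is contradictory, as \<open>L\<close> contains only one
              attachment vertex.\<close>
            then have "\<exists>T'\<in>P - {K}. card T' = 3 \<and> T' \<subseteq> insert a' (\<Union>l\<in>L. nb F (g l)) \<and> card (L \<inter> attach_verts d) \<ge> 2"
              by (intro key) (use L 2 in \<open>simp_all add: gadget_alpha_def attach_verts_simps\<close>)
            then show ?thesis using L(4) 2 by (auto simp: attach_verts_simps)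
          qed
        next
          case 3
          show ?thesis
          proof (cases "a' \<in> K")
            case True
            then have a'0: "a' = g 0" using a'K 3 by (auto simp: attach_verts_simps)
            \<comment> \<open>The only attachment vertex of \<open>K\<close> is a', whose third
              neighbour is a, so nothing leads out of \<open>T \<union> K\<close>.\<close>
            have "T \<union> K = V"
            proof (rule conn)
              show "T \<union> K \<subseteq> V" by (rule TKV)
              show "T \<union> K \<noteq> {}" by (simp add: T_def)
              fix w assume "w \<in> T \<union> K"
              then consider "w = a'" | "w \<in> T" | "w \<in> K" "w \<noteq> a'" by blast
              then show "nb V w \<subseteq> T \<union> K"
              proof cases
                case 1
                have v: "0 \<in> gadget_verts d" using 3 by (simp add: gadget_verts_simps)
                have "nb K a' = g ` gnb d \<beta> 0"
                  using S.gadget_nb[OF g v] Snb[OF ne'(1,2)] a'0 by simp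
                then have nK: "nb K a' = {g 1, g 2}" using 3 by (simp add: gnb_simps)
                then have "g 1 \<in> nb K a'" "g 2 \<in> nb K a'" by auto
                then have g12: "g 1 \<in> K" "adj a' (g 1)" "g 2 \<in> K" "adj a' (g 2)" by auto
                have "g 1 \<noteq> g 2" using gK(3) 3 by (auto simp: inj_on_def gadget_verts_simps)
                moreover have "a \<notin> K" using KY abcY by blast
                ultimately have "nb V a' = {a, g 1, g 2}"
                  using g12 a'(4) abc(1) KV sym'(1) by (intro nb3) auto
                then show ?thesis using g12 1 by (simp add: T_def)
              next
                case 2
                then show ?thesis using a'(1) b'(1) c'(1) True K(2) c'K by (auto simp: T_def)
              next
                case 3
                then obtain x where x: "x \<in> gadget_verts d" "w = g x" using gK(4) by blast
                then have "x \<noteq> 0" using 3(2) a'0 by (cases "x = 0") simp_all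
                then have "nb F w = {}" using nbF[of x] x \<open>d = Suc 0\<close> by (simp add: attach_verts_simps)
                moreover have "nb V w \<subseteq> T \<union> K \<union> nb F w" using FK by auto
                ultimately show ?thesis by simp
              qed
            qed
            then have "F = {}" using FK by blast
            then have "card V = card K + 3" using cF by simp
            also have "card K = 9" using S.gadget_card[OF g] 3 by (simp add: gadget_alpha_def)
            finally show ?thesis using n12 by simp
          next
            case False
            obtain L where L: "near_indep (Suc 0) \<beta> i j L" "card L = 4"
              using critical_nine[of i j \<beta>] i j 3 by auto
            have Lg: "g ` L \<subseteq> K" using L(1) gK(4) 3 by (auto simp: near_indep_def)
            have c01: "card (L \<inter> {0}) \<le> 1" by (rule order_trans[OF card_mono[of "{0}"]]) auto
            have "\<exists>T'\<in>P - {K}. card T' = 3 \<and> T' \<subseteq> insert a' (\<Union>l\<in>L. nb F (g l)) \<and> card (L \<inter> attach_verts d) \<ge> 2"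
              by (intro key) (use L 3 Lg False c01 in \<open>auto simp: gadget_alpha_def attach_verts_simps\<close>)
            then show ?thesis using c01 3 by (auto simp: attach_verts_simps)
          qed
        qed
      qed
    qed
  qed
qed

theorem cubic_tight_tiled:
  assumes "tight V" "I \<subseteq> V" "indep I" "3 * card I = card V" "card V \<noteq> 12"
  shows "tiled V"
proof -
  have n3: "3 dvd card V" using assms(4) by (metis dvd_triv_left)
  obtain a b c where abc: "a \<in> V" "b \<in> V" "c \<in> V" "adj a b" "adj b c" "adj a c"
    using exists_triangle[OF assms(1-4)] .
  show ?thesis
  proof (rule ccontr)
    assume n: "\<not> tiled V"
    have "c = d" if "a \<in> V" "b \<in> V" "c \<in> V" "d \<in> V" "adj a b" "adj a c" "adj b c" "adj a d" "adj b d" for a b c d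
      using diamond_tiled[OF assms(1) n3 assms(5) that(1-4) _ that(5-9)] n by blast
    then show False using triangle_tiled[OF assms(1) n3 assms(5) _ abc] n by blast
  qed
qed

end

section \<open>Traces of dissociation sets on gadgets\<close>

lemma card_Int_2: "x \<noteq> y \<Longrightarrow> card ({x, y} \<inter> Q) \<le> Suc 0 \<longleftrightarrow> \<not> (x \<in> Q \<and> y \<in> Q)"
  by (auto simp: Int_insert_left)

lemma card_Int_3: "x \<noteq> y \<Longrightarrow> x \<noteq> z \<Longrightarrow> y \<noteq> z \<Longrightarrow> card ({x, y, z} \<inter> Q) = Suc 0 \<longleftrightarrow>
    x \<in> Q \<and> y \<notin> Q \<and> z \<notin> Q \<or> x \<notin> Q \<and> y \<in> Q \<and> z \<notin> Q \<or> x \<notin> Q \<and> y \<notin> Q \<and> z \<in> Q"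
  by (auto simp: Int_insert_left)

lemma card_Diff_2: "x \<noteq> y \<Longrightarrow> card ({x, y} - Q) \<le> Suc 0 \<longleftrightarrow> x \<in> Q \<or> y \<in> Q"
  by (auto simp: insert_Diff_if)

lemma card_Diff_3: "x \<noteq> y \<Longrightarrow> x \<noteq> z \<Longrightarrow> y \<noteq> z \<Longrightarrow> card ({x, y, z} - Q) \<le> Suc 0 \<longleftrightarrow>
    x \<in> Q \<and> y \<in> Q \<or> x \<in> Q \<and> z \<in> Q \<or> y \<in> Q \<and> z \<in> Q"
  by (auto simp: insert_Diff_if)

text \<open>What a gadget sees of a 1-regular D whose complement induces a matching. Inner vertices
  have all their neighbours in the gadget, so for them the count is exact; an attachment vertex may
  find its neighbour in D outside.\<close>

definition local_pattern :: "nat \<Rightarrow> bool \<Rightarrow> nat set \<Rightarrow> bool" where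
  "local_pattern d b Q \<longleftrightarrow> Q \<subseteq> gadget_verts d \<and>
     (\<forall>i\<in>Q. card (gnb d b i \<inter> Q) \<le> 1 \<and> (i \<notin> attach_verts d \<longrightarrow> card (gnb d b i \<inter> Q) = 1)) \<and>
     (\<forall>i\<in>gadget_verts d - Q. card (gnb d b i - Q) \<le> 1)"

lemma local_patternD:
  assumes "local_pattern d b Q"
  shows "i \<in> Q \<Longrightarrow> card (gnb d b i \<inter> Q) \<le> Suc 0"
    "i \<in> Q \<Longrightarrow> i \<notin> attach_verts d \<Longrightarrow> card (gnb d b i \<inter> Q) = Suc 0"
    "i \<in> gadget_verts d \<Longrightarrow> i \<notin> Q \<Longrightarrow> card (gnb d b i - Q) \<le> Suc 0"
  using assms by (auto simp: local_pattern_def)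

lemmas pattern_simps = gadget_verts_simps attach_verts_simps gnb_simps card_Int_2 card_Int_3 card_Diff_2 card_Diff_3

lemmas gadget_simps = gadget_verts_simps attach_verts_simps gnb_simps gadget_alpha_def

text \<open>For each gadget, the neighbour counts become propositional conditions on the membership
  of single labels, and the list of traces is obtained by propositional reasoning.\<close>

lemma pattern_3:
  assumes "local_pattern 3 b Q"
  shows "Q \<in> {{0}, {Suc 0}, {0,Suc 0}, {2}, {0,2}, {Suc 0,2}}"
proof -
  have sub: "Q \<subseteq> gadget_verts 3" using assms by (simp add: local_pattern_def)
  note sub = sub[unfolded gadget_verts_simps]
  note c = local_patternD[OF assms]
  have a1: "0 \<in> Q \<longrightarrow> \<not> (Suc 0 \<in> Q \<and> 2 \<in> Q)"
    using c(1)[of "0"] by (simp add: pattern_simps)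
  have a2: "0 \<notin> Q \<longrightarrow> Suc 0 \<in> Q \<or> 2 \<in> Q"
    using c(3)[of "0"] by (simp add: pattern_simps)
  have a3: "Suc 0 \<in> Q \<longrightarrow> \<not> (0 \<in> Q \<and> 2 \<in> Q)"
    using c(1)[of "Suc 0"] by (simp add: pattern_simps)
  have a4: "Suc 0 \<notin> Q \<longrightarrow> 0 \<in> Q \<or> 2 \<in> Q"
    using c(3)[of "Suc 0"] by (simp add: pattern_simps)
  have a5: "2 \<in> Q \<longrightarrow> \<not> (0 \<in> Q \<and> Suc 0 \<in> Q)"
    using c(1)[of "2"] by (simp add: pattern_simps)
  have a6: "2 \<notin> Q \<longrightarrow> 0 \<in> Q \<or> Suc 0 \<in> Q"
    using c(3)[of "2"] by (simp add: pattern_simps)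
  have "(0 \<in> Q \<and> Suc 0 \<notin> Q \<and> 2 \<notin> Q)
    \<or> (0 \<notin> Q \<and> Suc 0 \<in> Q \<and> 2 \<notin> Q)
    \<or> (0 \<in> Q \<and> Suc 0 \<in> Q \<and> 2 \<notin> Q)
    \<or> (0 \<notin> Q \<and> Suc 0 \<notin> Q \<and> 2 \<in> Q)
    \<or> (0 \<in> Q \<and> Suc 0 \<notin> Q \<and> 2 \<in> Q)
    \<or> (0 \<notin> Q \<and> Suc 0 \<in> Q \<and> 2 \<in> Q)"
    using a1 a2 a3 a4 a5 a6 by argo
  then show ?thesis
  proof (elim disjE)
    assume "0 \<in> Q \<and> Suc 0 \<notin> Q \<and> 2 \<notin> Q"
    then have "Q = {0}" using sub by auto
    then show ?thesis by simp
  next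
    assume "0 \<notin> Q \<and> Suc 0 \<in> Q \<and> 2 \<notin> Q"
    then have "Q = {Suc 0}" using sub by auto
    then show ?thesis by simp
  next
    assume "0 \<in> Q \<and> Suc 0 \<in> Q \<and> 2 \<notin> Q"
    then have "Q = {0,Suc 0}" using sub by auto
    then show ?thesis by simp
  next
    assume "0 \<notin> Q \<and> Suc 0 \<notin> Q \<and> 2 \<in> Q"
    then have "Q = {2}" using sub by auto
    then show ?thesis by simp
  next
    assume "0 \<in> Q \<and> Suc 0 \<notin> Q \<and> 2 \<in> Q"
    then have "Q = {0,2}" using sub by auto
    then show ?thesis by simp
  next
    assume "0 \<notin> Q \<and> Suc 0 \<in> Q \<and> 2 \<in> Q"
    then have "Q = {Suc 0,2}" using sub by auto
    then show ?thesis by simp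
  qed
qed

lemma pattern_2:
  assumes "local_pattern 2 b Q"
  shows "Q \<in> {{Suc 0,2,4}, {Suc 0,3,4}, {2,3,4}, {0,2,5}, {0,3,5}, {2,3,5}, {2,3,4,5}}"
proof -
  have sub: "Q \<subseteq> gadget_verts 2" using assms by (simp add: local_pattern_def)
  note sub = sub[unfolded gadget_verts_simps]
  note c = local_patternD[OF assms]
  have a1: "0 \<in> Q \<longrightarrow> 2 \<in> Q \<and> 3 \<notin> Q \<and> 4 \<notin> Q \<or> 2 \<notin> Q \<and> 3 \<in> Q \<and> 4 \<notin> Q \<or> 2 \<notin> Q \<and> 3 \<notin> Q \<and> 4 \<in> Q"
    using c(2)[of "0"] by (simp add: pattern_simps)
  have a2: "0 \<notin> Q \<longrightarrow> 2 \<in> Q \<and> 3 \<in> Q \<or> 2 \<in> Q \<and> 4 \<in> Q \<or> 3 \<in> Q \<and> 4 \<in> Q"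
    using c(3)[of "0"] by (simp add: pattern_simps)
  have a3: "Suc 0 \<in> Q \<longrightarrow> 2 \<in> Q \<and> 3 \<notin> Q \<and> 5 \<notin> Q \<or> 2 \<notin> Q \<and> 3 \<in> Q \<and> 5 \<notin> Q \<or> 2 \<notin> Q \<and> 3 \<notin> Q \<and> 5 \<in> Q"
    using c(2)[of "Suc 0"] by (simp add: pattern_simps)
  have a4: "Suc 0 \<notin> Q \<longrightarrow> 2 \<in> Q \<and> 3 \<in> Q \<or> 2 \<in> Q \<and> 5 \<in> Q \<or> 3 \<in> Q \<and> 5 \<in> Q"
    using c(3)[of "Suc 0"] by (simp add: pattern_simps)
  have a5: "2 \<in> Q \<longrightarrow> 0 \<in> Q \<and> Suc 0 \<notin> Q \<and> 3 \<notin> Q \<or> 0 \<notin> Q \<and> Suc 0 \<in> Q \<and> 3 \<notin> Q \<or> 0 \<notin> Q \<and> Suc 0 \<notin> Q \<and> 3 \<in> Q"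
    using c(2)[of "2"] by (simp add: pattern_simps)
  have a6: "2 \<notin> Q \<longrightarrow> 0 \<in> Q \<and> Suc 0 \<in> Q \<or> 0 \<in> Q \<and> 3 \<in> Q \<or> Suc 0 \<in> Q \<and> 3 \<in> Q"
    using c(3)[of "2"] by (simp add: pattern_simps)
  have a7: "3 \<in> Q \<longrightarrow> 0 \<in> Q \<and> Suc 0 \<notin> Q \<and> 2 \<notin> Q \<or> 0 \<notin> Q \<and> Suc 0 \<in> Q \<and> 2 \<notin> Q \<or> 0 \<notin> Q \<and> Suc 0 \<notin> Q \<and> 2 \<in> Q"
    using c(2)[of "3"] by (simp add: pattern_simps)
  have a8: "3 \<notin> Q \<longrightarrow> 0 \<in> Q \<and> Suc 0 \<in> Q \<or> 0 \<in> Q \<and> 2 \<in> Q \<or> Suc 0 \<in> Q \<and> 2 \<in> Q"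
    using c(3)[of "3"] by (simp add: pattern_simps)
  have a9: "4 \<in> Q \<longrightarrow> \<not> (0 \<in> Q \<and> 5 \<in> Q)"
    using c(1)[of "4"] by (simp add: pattern_simps)
  have a10: "4 \<notin> Q \<longrightarrow> 0 \<in> Q \<or> 5 \<in> Q"
    using c(3)[of "4"] by (simp add: pattern_simps)
  have a11: "5 \<in> Q \<longrightarrow> \<not> (Suc 0 \<in> Q \<and> 4 \<in> Q)"
    using c(1)[of "5"] by (simp add: pattern_simps)
  have a12: "5 \<notin> Q \<longrightarrow> Suc 0 \<in> Q \<or> 4 \<in> Q"
    using c(3)[of "5"] by (simp add: pattern_simps)
  have "(0 \<notin> Q \<and> Suc 0 \<in> Q \<and> 2 \<in> Q \<and> 3 \<notin> Q \<and> 4 \<in> Q \<and> 5 \<notin> Q)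
    \<or> (0 \<notin> Q \<and> Suc 0 \<in> Q \<and> 2 \<notin> Q \<and> 3 \<in> Q \<and> 4 \<in> Q \<and> 5 \<notin> Q)
    \<or> (0 \<notin> Q \<and> Suc 0 \<notin> Q \<and> 2 \<in> Q \<and> 3 \<in> Q \<and> 4 \<in> Q \<and> 5 \<notin> Q)
    \<or> (0 \<in> Q \<and> Suc 0 \<notin> Q \<and> 2 \<in> Q \<and> 3 \<notin> Q \<and> 4 \<notin> Q \<and> 5 \<in> Q)
    \<or> (0 \<in> Q \<and> Suc 0 \<notin> Q \<and> 2 \<notin> Q \<and> 3 \<in> Q \<and> 4 \<notin> Q \<and> 5 \<in> Q)
    \<or> (0 \<notin> Q \<and> Suc 0 \<notin> Q \<and> 2 \<in> Q \<and> 3 \<in> Q \<and> 4 \<notin> Q \<and> 5 \<in> Q)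
    \<or> (0 \<notin> Q \<and> Suc 0 \<notin> Q \<and> 2 \<in> Q \<and> 3 \<in> Q \<and> 4 \<in> Q \<and> 5 \<in> Q)"
    using a1 a2 a3 a4 a5 a6 a7 a8 a9 a10 a11 a12 by argo
  then show ?thesis
  proof (elim disjE)
    assume "0 \<notin> Q \<and> Suc 0 \<in> Q \<and> 2 \<in> Q \<and> 3 \<notin> Q \<and> 4 \<in> Q \<and> 5 \<notin> Q"
    then have "Q = {Suc 0,2,4}" using sub by auto
    then show ?thesis by simp
  next
    assume "0 \<notin> Q \<and> Suc 0 \<in> Q \<and> 2 \<notin> Q \<and> 3 \<in> Q \<and> 4 \<in> Q \<and> 5 \<notin> Q"
    then have "Q = {Suc 0,3,4}" using sub by auto
    then show ?thesis by simp
  next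
    assume "0 \<notin> Q \<and> Suc 0 \<notin> Q \<and> 2 \<in> Q \<and> 3 \<in> Q \<and> 4 \<in> Q \<and> 5 \<notin> Q"
    then have "Q = {2,3,4}" using sub by auto
    then show ?thesis by simp
  next
    assume "0 \<in> Q \<and> Suc 0 \<notin> Q \<and> 2 \<in> Q \<and> 3 \<notin> Q \<and> 4 \<notin> Q \<and> 5 \<in> Q"
    then have "Q = {0,2,5}" using sub by auto
    then show ?thesis by simp
  next
    assume "0 \<in> Q \<and> Suc 0 \<notin> Q \<and> 2 \<notin> Q \<and> 3 \<in> Q \<and> 4 \<notin> Q \<and> 5 \<in> Q"
    then have "Q = {0,3,5}" using sub by auto
    then show ?thesis by simp
  next
    assume "0 \<notin> Q \<and> Suc 0 \<notin> Q \<and> 2 \<in> Q \<and> 3 \<in> Q \<and> 4 \<notin> Q \<and> 5 \<in> Q"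
    then have "Q = {2,3,5}" using sub by auto
    then show ?thesis by simp
  next
    assume "0 \<notin> Q \<and> Suc 0 \<notin> Q \<and> 2 \<in> Q \<and> 3 \<in> Q \<and> 4 \<in> Q \<and> 5 \<in> Q"
    then have "Q = {2,3,4,5}" using sub by auto
    then show ?thesis by simp
  qed
qed

lemma pattern_1_true:
  assumes "local_pattern (Suc 0) True Q"
  shows "Q \<in> {{0,3,4,6,7}, {0,3,5,6,7}, {0,4,5,6,7}, {0,3,4,6,8}, {0,3,4,7,8}}"
proof -
  have sub: "Q \<subseteq> gadget_verts (Suc 0)" using assms by (simp add: local_pattern_def)
  note sub = sub[unfolded gadget_verts_simps]
  note c = local_patternD[OF assms]
  have a1: "0 \<in> Q \<longrightarrow> \<not> (Suc 0 \<in> Q \<and> 2 \<in> Q)"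
    using c(1)[of "0"] by (simp add: pattern_simps)
  have a2: "0 \<notin> Q \<longrightarrow> Suc 0 \<in> Q \<or> 2 \<in> Q"
    using c(3)[of "0"] by (simp add: pattern_simps)
  have a3: "Suc 0 \<in> Q \<longrightarrow> 0 \<in> Q \<and> 3 \<notin> Q \<and> 4 \<notin> Q \<or> 0 \<notin> Q \<and> 3 \<in> Q \<and> 4 \<notin> Q \<or> 0 \<notin> Q \<and> 3 \<notin> Q \<and> 4 \<in> Q"
    using c(2)[of "Suc 0"] by (simp add: pattern_simps)
  have a4: "Suc 0 \<notin> Q \<longrightarrow> 0 \<in> Q \<and> 3 \<in> Q \<or> 0 \<in> Q \<and> 4 \<in> Q \<or> 3 \<in> Q \<and> 4 \<in> Q"
    using c(3)[of "Suc 0"] by (simp add: pattern_simps)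
  have a5: "2 \<in> Q \<longrightarrow> 0 \<in> Q \<and> 6 \<notin> Q \<and> 7 \<notin> Q \<or> 0 \<notin> Q \<and> 6 \<in> Q \<and> 7 \<notin> Q \<or> 0 \<notin> Q \<and> 6 \<notin> Q \<and> 7 \<in> Q"
    using c(2)[of "2"] by (simp add: pattern_simps)
  have a6: "2 \<notin> Q \<longrightarrow> 0 \<in> Q \<and> 6 \<in> Q \<or> 0 \<in> Q \<and> 7 \<in> Q \<or> 6 \<in> Q \<and> 7 \<in> Q"
    using c(3)[of "2"] by (simp add: pattern_simps)
  have a7: "3 \<in> Q \<longrightarrow> Suc 0 \<in> Q \<and> 4 \<notin> Q \<and> 5 \<notin> Q \<or> Suc 0 \<notin> Q \<and> 4 \<in> Q \<and> 5 \<notin> Q \<or> Suc 0 \<notin> Q \<and> 4 \<notin> Q \<and> 5 \<in> Q"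
    using c(2)[of "3"] by (simp add: pattern_simps)
  have a8: "3 \<notin> Q \<longrightarrow> Suc 0 \<in> Q \<and> 4 \<in> Q \<or> Suc 0 \<in> Q \<and> 5 \<in> Q \<or> 4 \<in> Q \<and> 5 \<in> Q"
    using c(3)[of "3"] by (simp add: pattern_simps)
  have a9: "4 \<in> Q \<longrightarrow> Suc 0 \<in> Q \<and> 3 \<notin> Q \<and> 5 \<notin> Q \<or> Suc 0 \<notin> Q \<and> 3 \<in> Q \<and> 5 \<notin> Q \<or> Suc 0 \<notin> Q \<and> 3 \<notin> Q \<and> 5 \<in> Q"
    using c(2)[of "4"] by (simp add: pattern_simps)
  have a10: "4 \<notin> Q \<longrightarrow> Suc 0 \<in> Q \<and> 3 \<in> Q \<or> Suc 0 \<in> Q \<and> 5 \<in> Q \<or> 3 \<in> Q \<and> 5 \<in> Q"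
    using c(3)[of "4"] by (simp add: pattern_simps)
  have a11: "5 \<in> Q \<longrightarrow> 3 \<in> Q \<and> 4 \<notin> Q \<and> 8 \<notin> Q \<or> 3 \<notin> Q \<and> 4 \<in> Q \<and> 8 \<notin> Q \<or> 3 \<notin> Q \<and> 4 \<notin> Q \<and> 8 \<in> Q"
    using c(2)[of "5"] by (simp add: pattern_simps)
  have a12: "5 \<notin> Q \<longrightarrow> 3 \<in> Q \<and> 4 \<in> Q \<or> 3 \<in> Q \<and> 8 \<in> Q \<or> 4 \<in> Q \<and> 8 \<in> Q"
    using c(3)[of "5"] by (simp add: pattern_simps)
  have a13: "6 \<in> Q \<longrightarrow> 2 \<in> Q \<and> 7 \<notin> Q \<and> 8 \<notin> Q \<or> 2 \<notin> Q \<and> 7 \<in> Q \<and> 8 \<notin> Q \<or> 2 \<notin> Q \<and> 7 \<notin> Q \<and> 8 \<in> Q"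
    using c(2)[of "6"] by (simp add: pattern_simps)
  have a14: "6 \<notin> Q \<longrightarrow> 2 \<in> Q \<and> 7 \<in> Q \<or> 2 \<in> Q \<and> 8 \<in> Q \<or> 7 \<in> Q \<and> 8 \<in> Q"
    using c(3)[of "6"] by (simp add: pattern_simps)
  have a15: "7 \<in> Q \<longrightarrow> 2 \<in> Q \<and> 6 \<notin> Q \<and> 8 \<notin> Q \<or> 2 \<notin> Q \<and> 6 \<in> Q \<and> 8 \<notin> Q \<or> 2 \<notin> Q \<and> 6 \<notin> Q \<and> 8 \<in> Q"
    using c(2)[of "7"] by (simp add: pattern_simps)
  have a16: "7 \<notin> Q \<longrightarrow> 2 \<in> Q \<and> 6 \<in> Q \<or> 2 \<in> Q \<and> 8 \<in> Q \<or> 6 \<in> Q \<and> 8 \<in> Q"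
    using c(3)[of "7"] by (simp add: pattern_simps)
  have a17: "8 \<in> Q \<longrightarrow> 5 \<in> Q \<and> 6 \<notin> Q \<and> 7 \<notin> Q \<or> 5 \<notin> Q \<and> 6 \<in> Q \<and> 7 \<notin> Q \<or> 5 \<notin> Q \<and> 6 \<notin> Q \<and> 7 \<in> Q"
    using c(2)[of "8"] by (simp add: pattern_simps)
  have a18: "8 \<notin> Q \<longrightarrow> 5 \<in> Q \<and> 6 \<in> Q \<or> 5 \<in> Q \<and> 7 \<in> Q \<or> 6 \<in> Q \<and> 7 \<in> Q"
    using c(3)[of "8"] by (simp add: pattern_simps)
  have "(0 \<in> Q \<and> Suc 0 \<notin> Q \<and> 2 \<notin> Q \<and> 3 \<in> Q \<and> 4 \<in> Q \<and> 5 \<notin> Q \<and> 6 \<in> Q \<and> 7 \<in> Q \<and> 8 \<notin> Q)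
    \<or> (0 \<in> Q \<and> Suc 0 \<notin> Q \<and> 2 \<notin> Q \<and> 3 \<in> Q \<and> 4 \<notin> Q \<and> 5 \<in> Q \<and> 6 \<in> Q \<and> 7 \<in> Q \<and> 8 \<notin> Q)
    \<or> (0 \<in> Q \<and> Suc 0 \<notin> Q \<and> 2 \<notin> Q \<and> 3 \<notin> Q \<and> 4 \<in> Q \<and> 5 \<in> Q \<and> 6 \<in> Q \<and> 7 \<in> Q \<and> 8 \<notin> Q)
    \<or> (0 \<in> Q \<and> Suc 0 \<notin> Q \<and> 2 \<notin> Q \<and> 3 \<in> Q \<and> 4 \<in> Q \<and> 5 \<notin> Q \<and> 6 \<in> Q \<and> 7 \<notin> Q \<and> 8 \<in> Q)
    \<or> (0 \<in> Q \<and> Suc 0 \<notin> Q \<and> 2 \<notin> Q \<and> 3 \<in> Q \<and> 4 \<in> Q \<and> 5 \<notin> Q \<and> 6 \<notin> Q \<and> 7 \<in> Q \<and> 8 \<in> Q)"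
    using a1 a2 a3 a4 a5 a6 a7 a8 a9 a10 a11 a12 a13 a14 a15 a16 a17 a18 by argo
  then show ?thesis
  proof (elim disjE)
    assume "0 \<in> Q \<and> Suc 0 \<notin> Q \<and> 2 \<notin> Q \<and> 3 \<in> Q \<and> 4 \<in> Q \<and> 5 \<notin> Q \<and> 6 \<in> Q \<and> 7 \<in> Q \<and> 8 \<notin> Q"
    then have "Q = {0,3,4,6,7}" using sub by auto
    then show ?thesis by simp
  next
    assume "0 \<in> Q \<and> Suc 0 \<notin> Q \<and> 2 \<notin> Q \<and> 3 \<in> Q \<and> 4 \<notin> Q \<and> 5 \<in> Q \<and> 6 \<in> Q \<and> 7 \<in> Q \<and> 8 \<notin> Q"
    then have "Q = {0,3,5,6,7}" using sub by auto
    then show ?thesis by simp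
  next
    assume "0 \<in> Q \<and> Suc 0 \<notin> Q \<and> 2 \<notin> Q \<and> 3 \<notin> Q \<and> 4 \<in> Q \<and> 5 \<in> Q \<and> 6 \<in> Q \<and> 7 \<in> Q \<and> 8 \<notin> Q"
    then have "Q = {0,4,5,6,7}" using sub by auto
    then show ?thesis by simp
  next
    assume "0 \<in> Q \<and> Suc 0 \<notin> Q \<and> 2 \<notin> Q \<and> 3 \<in> Q \<and> 4 \<in> Q \<and> 5 \<notin> Q \<and> 6 \<in> Q \<and> 7 \<notin> Q \<and> 8 \<in> Q"
    then have "Q = {0,3,4,6,8}" using sub by auto
    then show ?thesis by simp
  next
    assume "0 \<in> Q \<and> Suc 0 \<notin> Q \<and> 2 \<notin> Q \<and> 3 \<in> Q \<and> 4 \<in> Q \<and> 5 \<notin> Q \<and> 6 \<notin> Q \<and> 7 \<in> Q \<and> 8 \<in> Q"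
    then have "Q = {0,3,4,7,8}" using sub by auto
    then show ?thesis by simp
  qed
qed

lemma pattern_1_false:
  assumes "local_pattern (Suc 0) False Q"
  shows "Q \<in> {{0,3,4,6,7}, {0,3,5,6,7}, {0,4,5,6,7}, {0,3,4,6,8}, {0,3,4,7,8}}"
proof -
  have sub: "Q \<subseteq> gadget_verts (Suc 0)" using assms by (simp add: local_pattern_def)
  note sub = sub[unfolded gadget_verts_simps]
  note c = local_patternD[OF assms]
  have a1: "0 \<in> Q \<longrightarrow> \<not> (Suc 0 \<in> Q \<and> 2 \<in> Q)"
    using c(1)[of "0"] by (simp add: pattern_simps)
  have a2: "0 \<notin> Q \<longrightarrow> Suc 0 \<in> Q \<or> 2 \<in> Q"
    using c(3)[of "0"] by (simp add: pattern_simps)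
  have a3: "Suc 0 \<in> Q \<longrightarrow> 0 \<in> Q \<and> 3 \<notin> Q \<and> 7 \<notin> Q \<or> 0 \<notin> Q \<and> 3 \<in> Q \<and> 7 \<notin> Q \<or> 0 \<notin> Q \<and> 3 \<notin> Q \<and> 7 \<in> Q"
    using c(2)[of "Suc 0"] by (simp add: pattern_simps)
  have a4: "Suc 0 \<notin> Q \<longrightarrow> 0 \<in> Q \<and> 3 \<in> Q \<or> 0 \<in> Q \<and> 7 \<in> Q \<or> 3 \<in> Q \<and> 7 \<in> Q"
    using c(3)[of "Suc 0"] by (simp add: pattern_simps)
  have a5: "2 \<in> Q \<longrightarrow> 0 \<in> Q \<and> 6 \<notin> Q \<and> 4 \<notin> Q \<or> 0 \<notin> Q \<and> 6 \<in> Q \<and> 4 \<notin> Q \<or> 0 \<notin> Q \<and> 6 \<notin> Q \<and> 4 \<in> Q"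
    using c(2)[of "2"] by (simp add: pattern_simps)
  have a6: "2 \<notin> Q \<longrightarrow> 0 \<in> Q \<and> 6 \<in> Q \<or> 0 \<in> Q \<and> 4 \<in> Q \<or> 6 \<in> Q \<and> 4 \<in> Q"
    using c(3)[of "2"] by (simp add: pattern_simps)
  have a7: "3 \<in> Q \<longrightarrow> Suc 0 \<in> Q \<and> 4 \<notin> Q \<and> 5 \<notin> Q \<or> Suc 0 \<notin> Q \<and> 4 \<in> Q \<and> 5 \<notin> Q \<or> Suc 0 \<notin> Q \<and> 4 \<notin> Q \<and> 5 \<in> Q"
    using c(2)[of "3"] by (simp add: pattern_simps)
  have a8: "3 \<notin> Q \<longrightarrow> Suc 0 \<in> Q \<and> 4 \<in> Q \<or> Suc 0 \<in> Q \<and> 5 \<in> Q \<or> 4 \<in> Q \<and> 5 \<in> Q"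
    using c(3)[of "3"] by (simp add: pattern_simps)
  have a9: "4 \<in> Q \<longrightarrow> 2 \<in> Q \<and> 3 \<notin> Q \<and> 5 \<notin> Q \<or> 2 \<notin> Q \<and> 3 \<in> Q \<and> 5 \<notin> Q \<or> 2 \<notin> Q \<and> 3 \<notin> Q \<and> 5 \<in> Q"
    using c(2)[of "4"] by (simp add: pattern_simps)
  have a10: "4 \<notin> Q \<longrightarrow> 2 \<in> Q \<and> 3 \<in> Q \<or> 2 \<in> Q \<and> 5 \<in> Q \<or> 3 \<in> Q \<and> 5 \<in> Q"
    using c(3)[of "4"] by (simp add: pattern_simps)
  have a11: "5 \<in> Q \<longrightarrow> 3 \<in> Q \<and> 4 \<notin> Q \<and> 8 \<notin> Q \<or> 3 \<notin> Q \<and> 4 \<in> Q \<and> 8 \<notin> Q \<or> 3 \<notin> Q \<and> 4 \<notin> Q \<and> 8 \<in> Q"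
    using c(2)[of "5"] by (simp add: pattern_simps)
  have a12: "5 \<notin> Q \<longrightarrow> 3 \<in> Q \<and> 4 \<in> Q \<or> 3 \<in> Q \<and> 8 \<in> Q \<or> 4 \<in> Q \<and> 8 \<in> Q"
    using c(3)[of "5"] by (simp add: pattern_simps)
  have a13: "6 \<in> Q \<longrightarrow> 2 \<in> Q \<and> 7 \<notin> Q \<and> 8 \<notin> Q \<or> 2 \<notin> Q \<and> 7 \<in> Q \<and> 8 \<notin> Q \<or> 2 \<notin> Q \<and> 7 \<notin> Q \<and> 8 \<in> Q"
    using c(2)[of "6"] by (simp add: pattern_simps)
  have a14: "6 \<notin> Q \<longrightarrow> 2 \<in> Q \<and> 7 \<in> Q \<or> 2 \<in> Q \<and> 8 \<in> Q \<or> 7 \<in> Q \<and> 8 \<in> Q"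
    using c(3)[of "6"] by (simp add: pattern_simps)
  have a15: "7 \<in> Q \<longrightarrow> Suc 0 \<in> Q \<and> 6 \<notin> Q \<and> 8 \<notin> Q \<or> Suc 0 \<notin> Q \<and> 6 \<in> Q \<and> 8 \<notin> Q \<or> Suc 0 \<notin> Q \<and> 6 \<notin> Q \<and> 8 \<in> Q"
    using c(2)[of "7"] by (simp add: pattern_simps)
  have a16: "7 \<notin> Q \<longrightarrow> Suc 0 \<in> Q \<and> 6 \<in> Q \<or> Suc 0 \<in> Q \<and> 8 \<in> Q \<or> 6 \<in> Q \<and> 8 \<in> Q"
    using c(3)[of "7"] by (simp add: pattern_simps)
  have a17: "8 \<in> Q \<longrightarrow> 5 \<in> Q \<and> 6 \<notin> Q \<and> 7 \<notin> Q \<or> 5 \<notin> Q \<and> 6 \<in> Q \<and> 7 \<notin> Q \<or> 5 \<notin> Q \<and> 6 \<notin> Q \<and> 7 \<in> Q"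
    using c(2)[of "8"] by (simp add: pattern_simps)
  have a18: "8 \<notin> Q \<longrightarrow> 5 \<in> Q \<and> 6 \<in> Q \<or> 5 \<in> Q \<and> 7 \<in> Q \<or> 6 \<in> Q \<and> 7 \<in> Q"
    using c(3)[of "8"] by (simp add: pattern_simps)
  have "(0 \<in> Q \<and> Suc 0 \<notin> Q \<and> 2 \<notin> Q \<and> 3 \<in> Q \<and> 4 \<in> Q \<and> 5 \<notin> Q \<and> 6 \<in> Q \<and> 7 \<in> Q \<and> 8 \<notin> Q)
    \<or> (0 \<in> Q \<and> Suc 0 \<notin> Q \<and> 2 \<notin> Q \<and> 3 \<in> Q \<and> 4 \<notin> Q \<and> 5 \<in> Q \<and> 6 \<in> Q \<and> 7 \<in> Q \<and> 8 \<notin> Q)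
    \<or> (0 \<in> Q \<and> Suc 0 \<notin> Q \<and> 2 \<notin> Q \<and> 3 \<notin> Q \<and> 4 \<in> Q \<and> 5 \<in> Q \<and> 6 \<in> Q \<and> 7 \<in> Q \<and> 8 \<notin> Q)
    \<or> (0 \<in> Q \<and> Suc 0 \<notin> Q \<and> 2 \<notin> Q \<and> 3 \<in> Q \<and> 4 \<in> Q \<and> 5 \<notin> Q \<and> 6 \<in> Q \<and> 7 \<notin> Q \<and> 8 \<in> Q)
    \<or> (0 \<in> Q \<and> Suc 0 \<notin> Q \<and> 2 \<notin> Q \<and> 3 \<in> Q \<and> 4 \<in> Q \<and> 5 \<notin> Q \<and> 6 \<notin> Q \<and> 7 \<in> Q \<and> 8 \<in> Q)"
    using a1 a2 a3 a4 a5 a6 a7 a8 a9 a10 a11 a12 a13 a14 a15 a16 a17 a18 by argo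
  then show ?thesis
  proof (elim disjE)
    assume "0 \<in> Q \<and> Suc 0 \<notin> Q \<and> 2 \<notin> Q \<and> 3 \<in> Q \<and> 4 \<in> Q \<and> 5 \<notin> Q \<and> 6 \<in> Q \<and> 7 \<in> Q \<and> 8 \<notin> Q"
    then have "Q = {0,3,4,6,7}" using sub by auto
    then show ?thesis by simp
  next
    assume "0 \<in> Q \<and> Suc 0 \<notin> Q \<and> 2 \<notin> Q \<and> 3 \<in> Q \<and> 4 \<notin> Q \<and> 5 \<in> Q \<and> 6 \<in> Q \<and> 7 \<in> Q \<and> 8 \<notin> Q"
    then have "Q = {0,3,5,6,7}" using sub by auto
    then show ?thesis by simp
  next
    assume "0 \<in> Q \<and> Suc 0 \<notin> Q \<and> 2 \<notin> Q \<and> 3 \<notin> Q \<and> 4 \<in> Q \<and> 5 \<in> Q \<and> 6 \<in> Q \<and> 7 \<in> Q \<and> 8 \<notin> Q"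
    then have "Q = {0,4,5,6,7}" using sub by auto
    then show ?thesis by simp
  next
    assume "0 \<in> Q \<and> Suc 0 \<notin> Q \<and> 2 \<notin> Q \<and> 3 \<in> Q \<and> 4 \<in> Q \<and> 5 \<notin> Q \<and> 6 \<in> Q \<and> 7 \<notin> Q \<and> 8 \<in> Q"
    then have "Q = {0,3,4,6,8}" using sub by auto
    then show ?thesis by simp
  next
    assume "0 \<in> Q \<and> Suc 0 \<notin> Q \<and> 2 \<notin> Q \<and> 3 \<in> Q \<and> 4 \<in> Q \<and> 5 \<notin> Q \<and> 6 \<notin> Q \<and> 7 \<in> Q \<and> 8 \<in> Q"
    then have "Q = {0,3,4,7,8}" using sub by auto
    then show ?thesis by simp
  qed
qed

text \<open>Traces that are complete in themselves: every vertex of \<open>Q\<close> has its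
  neighbour in \<open>Q\<close> within the gadget, and the complement contains no edge. They take
  two thirds of the gadget. Nine-vertex gadgets have none, which is how degree-1 vertices come to be
  covered by M.\<close>

definition free_pattern :: "nat \<Rightarrow> bool \<Rightarrow> nat set \<Rightarrow> bool" where
  "free_pattern d b Q \<longleftrightarrow> d \<noteq> 1 \<and> card Q = 2 * gadget_alpha d \<and> card (Q \<inter> attach_verts d) = 2 \<and>
     (\<forall>i\<in>Q. gnb d b i \<inter> Q \<noteq> {}) \<and> (\<forall>i\<in>gadget_verts d - Q. gnb d b i \<subseteq> Q)"

text \<open>One vertex below two thirds: the only attachment vertex in \<open>Q\<close> must find
  its neighbour in D across the outer edge. The two exceptional vertices at the end are the ends of
  the one edge of the gadget that avoids \<open>Q\<close>.\<close>

definition matched_pattern :: "nat \<Rightarrow> bool \<Rightarrow> nat set \<Rightarrow> bool" where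
  "matched_pattern d b Q \<longleftrightarrow> card Q + 1 = 2 * gadget_alpha d \<and>
     (\<exists>i. Q \<inter> attach_verts d = {i} \<and> gnb d b i \<inter> Q = {}) \<and>
     card {i \<in> gadget_verts d - Q. \<not> gnb d b i \<subseteq> Q} = 2"

lemma local_pattern_cases:
  assumes "d \<in> {1,2,3}" "local_pattern d b Q"
  shows "free_pattern d b Q \<or> matched_pattern d b Q"
proof -
  \<comment> \<open>The data to be supplied for each trace are the lonely attachment vertex i and
    the ends r, s of the edge avoiding \<open>Q\<close>.\<close>
  have matched: "matched_pattern d b Q"
    if "card Q + 1 = 2 * gadget_alpha d" "Q \<inter> attach_verts d = {i}" "gnb d b i \<inter> Q = {}"
      "\<forall>i\<in>gadget_verts d - Q. gnb d b i \<subseteq> Q \<longleftrightarrow> i \<noteq> r \<and> i \<noteq> s" "{r, s} \<subseteq> gadget_verts d - Q" "r \<noteq> s" for i r s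
  proof -
    have "{i \<in> gadget_verts d - Q. \<not> gnb d b i \<subseteq> Q} = {r, s}" using that(4,5) by blast
    then show ?thesis unfolding matched_pattern_def using that by auto
  qed
  consider "d = 3" | "d = 2" | "d = Suc 0" "b = True" | "d = Suc 0" "b = False" using assms(1) by auto
  then show ?thesis
  proof cases
    assume dd: "d = 3"
    have "Q \<in> {{0}, {Suc 0}, {0,Suc 0}, {2}, {0,2}, {Suc 0,2}}"
      by (rule pattern_3) (use assms(2) dd in simp)
    then show ?thesis
    proof (elim insertE emptyE)
      assume "Q = {0}"
      then have "matched_pattern d b Q"
        by (intro matched[of "0" "Suc 0" "2"]) (simp_all add: dd insert_Diff_if gadget_simps)
      then show ?thesis ..
    next
      assume "Q = {Suc 0}"
      then have "matched_pattern d b Q"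
        by (intro matched[of "Suc 0" "0" "2"]) (simp_all add: dd insert_Diff_if gadget_simps)
      then show ?thesis ..
    next
      assume "Q = {0,Suc 0}"
      then have "free_pattern d b Q" unfolding free_pattern_def dd by (auto simp: gadget_simps)
      then show ?thesis ..
    next
      assume "Q = {2}"
      then have "matched_pattern d b Q"
        by (intro matched[of "2" "0" "Suc 0"]) (simp_all add: dd insert_Diff_if gadget_simps)
      then show ?thesis ..
    next
      assume "Q = {0,2}"
      then have "free_pattern d b Q" unfolding free_pattern_def dd by (auto simp: gadget_simps)
      then show ?thesis ..
    next
      assume "Q = {Suc 0,2}"
      then have "free_pattern d b Q" unfolding free_pattern_def dd by (auto simp: gadget_simps)
      then show ?thesis ..
    qed
  next
    assume dd: "d = 2"
    have "Q \<in> {{Suc 0,2,4}, {Suc 0,3,4}, {2,3,4}, {0,2,5}, {0,3,5}, {2,3,5}, {2,3,4,5}}"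
      by (rule pattern_2) (use assms(2) dd in simp)
    then show ?thesis
    proof (elim insertE emptyE)
      assume "Q = {Suc 0,2,4}"
      then have "matched_pattern d b Q"
        by (intro matched[of "4" "0" "3"]) (simp_all add: dd insert_Diff_if gadget_simps)
      then show ?thesis ..
    next
      assume "Q = {Suc 0,3,4}"
      then have "matched_pattern d b Q"
        by (intro matched[of "4" "0" "2"]) (simp_all add: dd insert_Diff_if gadget_simps)
      then show ?thesis ..
    next
      assume "Q = {2,3,4}"
      then have "matched_pattern d b Q"
        by (intro matched[of "4" "Suc 0" "5"]) (simp_all add: dd insert_Diff_if gadget_simps)
      then show ?thesis ..
    next
      assume "Q = {0,2,5}"
      then have "matched_pattern d b Q"
        by (intro matched[of "5" "Suc 0" "3"]) (simp_all add: dd insert_Diff_if gadget_simps)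
      then show ?thesis ..
    next
      assume "Q = {0,3,5}"
      then have "matched_pattern d b Q"
        by (intro matched[of "5" "Suc 0" "2"]) (simp_all add: dd insert_Diff_if gadget_simps)
      then show ?thesis ..
    next
      assume "Q = {2,3,5}"
      then have "matched_pattern d b Q"
        by (intro matched[of "5" "0" "4"]) (simp_all add: dd insert_Diff_if gadget_simps)
      then show ?thesis ..
    next
      assume "Q = {2,3,4,5}"
      then have "free_pattern d b Q" unfolding free_pattern_def dd by (auto simp: gadget_simps)
      then show ?thesis ..
    qed
  next
    assume dd: "d = Suc 0" "b = True"
    have "Q \<in> {{0,3,4,6,7}, {0,3,5,6,7}, {0,4,5,6,7}, {0,3,4,6,8}, {0,3,4,7,8}}"
      by (rule pattern_1_true) (use assms(2) dd in simp)
    then show ?thesis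
    proof (elim insertE emptyE)
      assume "Q = {0,3,4,6,7}"
      then have "matched_pattern d b Q"
        by (intro matched[of "0" "8" "5"]) (simp_all add: dd insert_Diff_if gadget_simps)
      then show ?thesis ..
    next
      assume "Q = {0,3,5,6,7}"
      then have "matched_pattern d b Q"
        by (intro matched[of "0" "Suc 0" "4"]) (simp_all add: dd insert_Diff_if gadget_simps)
      then show ?thesis ..
    next
      assume "Q = {0,4,5,6,7}"
      then have "matched_pattern d b Q"
        by (intro matched[of "0" "Suc 0" "3"]) (simp_all add: dd insert_Diff_if gadget_simps)
      then show ?thesis ..
    next
      assume "Q = {0,3,4,6,8}"
      then have "matched_pattern d b Q"
        by (intro matched[of "0" "2" "7"]) (simp_all add: dd insert_Diff_if gadget_simps)
      then show ?thesis ..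
    next
      assume "Q = {0,3,4,7,8}"
      then have "matched_pattern d b Q"
        by (intro matched[of "0" "2" "6"]) (simp_all add: dd insert_Diff_if gadget_simps)
      then show ?thesis ..
    qed
  next
    assume dd: "d = Suc 0" "b = False"
    have "Q \<in> {{0,3,4,6,7}, {0,3,5,6,7}, {0,4,5,6,7}, {0,3,4,6,8}, {0,3,4,7,8}}"
      by (rule pattern_1_false) (use assms(2) dd in simp)
    then show ?thesis
    proof (elim insertE emptyE)
      assume "Q = {0,3,4,6,7}"
      then have "matched_pattern d b Q"
        by (intro matched[of "0" "8" "5"]) (simp_all add: dd insert_Diff_if gadget_simps)
      then show ?thesis ..
    next
      assume "Q = {0,3,5,6,7}"
      then have "matched_pattern d b Q"
        by (intro matched[of "0" "2" "4"]) (simp_all add: dd insert_Diff_if gadget_simps)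
      then show ?thesis ..
    next
      assume "Q = {0,4,5,6,7}"
      then have "matched_pattern d b Q"
        by (intro matched[of "0" "Suc 0" "3"]) (simp_all add: dd insert_Diff_if gadget_simps)
      then show ?thesis ..
    next
      assume "Q = {0,3,4,6,8}"
      then have "matched_pattern d b Q"
        by (intro matched[of "0" "Suc 0" "7"]) (simp_all add: dd insert_Diff_if gadget_simps)
      then show ?thesis ..
    next
      assume "Q = {0,3,4,7,8}"
      then have "matched_pattern d b Q"
        by (intro matched[of "0" "2" "6"]) (simp_all add: dd insert_Diff_if gadget_simps)
      then show ?thesis ..
    qed
  qed
qed

section \<open>The inequality\<close>

context sgraph
begin

lemma double_count:
  assumes "finite A" "finite B"
  shows "(\<Sum>x\<in>A. card (nb B x)) = (\<Sum>y\<in>B. card (nb A y))"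
proof -
  have "(\<Sum>x\<in>A. card (nb B x)) = (\<Sum>x\<in>A. \<Sum>y\<in>B. if adj x y then 1 else 0)"
    using assms by (simp add: nb_def sum.If_cases Int_def)
  also have "\<dots> = (\<Sum>y\<in>B. \<Sum>x\<in>A. if adj y x then 1 else 0)"
    by (subst sum.swap) (simp add: adj_commute)
  also have "\<dots> = (\<Sum>y\<in>B. card (nb A y))"
    using assms by (simp add: nb_def sum.If_cases Int_def)
  finally show ?thesis .
qed

lemma card_nb_Un:
  assumes "finite A" "finite B" "A \<inter> B = {}"
  shows "card (nb (A \<union> B) v) = card (nb A v) + card (nb B v)"
proof -
  have "nb (A \<union> B) v = nb A v \<union> nb B v" "nb A v \<inter> nb B v = {}" using assms(3) by auto
  then show ?thesis using assms by (simp add: card_Un_disjoint finite_nb)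
qed

lemma sum_nb_remove:
  assumes "finite R" "v \<in> R"
  shows "(\<Sum>u\<in>R. card (nb R u)) = (\<Sum>u\<in>R - {v}. card (nb (R - {v}) u)) + 2 * card (nb R v)"
proof -
  let ?R = "R - {v}"
  have R: "R = ?R \<union> {v}" "finite ?R" using assms by auto
  have c: "card (nb R u) = card (nb ?R u) + card (nb {v} u)" for u
    by (subst R(1), rule card_nb_Un) (use assms in auto)
  have v0: "nb {v} v = {}" by auto
  have "(\<Sum>u\<in>R. card (nb R u)) = card (nb R v) + (\<Sum>u\<in>?R. card (nb R u))"
    using assms by (rule sum.remove)
  also have "(\<Sum>u\<in>?R. card (nb R u)) = (\<Sum>u\<in>?R. card (nb ?R u)) + (\<Sum>u\<in>?R. card (nb {v} u))"
    by (subst c) (rule sum.distrib)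
  also have "(\<Sum>u\<in>?R. card (nb {v} u)) = card (nb ?R v)"
    using double_count[OF R(2), of "{v}"] by simp
  also have "card (nb ?R v) = card (nb R v)" using c[of v] v0 by simp
  finally show ?thesis by simp
qed

text \<open>Deleting an end of every edge of R leaves |R| - e(R) vertices; a vertex of degree at least 2
  deals with two edges at once.\<close>
lemma indep_in_sparse:
  assumes "finite R"
  shows "\<exists>I\<subseteq>R. indep I \<and> 2 * card R \<le> 2 * card I + (\<Sum>v\<in>R. card (nb R v))"
  using assms
proof (induction "card R" arbitrary: R rule: less_induct)
  case less
  show ?case
  proof (cases "\<exists>v\<in>R. nb R v \<noteq> {}")
    case True
    then obtain v where v: "v \<in> R" "nb R v \<noteq> {}" by blast
    have "card (nb R v) \<ge> 1" using v(2) finite_nb[OF less.prems, of v] by (simp add: Suc_le_eq card_gt_0_iff)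
    moreover have c: "card (R - {v}) + 1 = card R" using card.remove[OF less.prems v(1)] by linarith
    moreover obtain I where I: "I \<subseteq> R - {v}" "indep I"
      "2 * card (R - {v}) \<le> 2 * card I + (\<Sum>u\<in>R - {v}. card (nb (R - {v}) u))"
      using less.hyps[of "R - {v}"] c less.prems by auto
    ultimately have "2 * card R \<le> 2 * card I + (\<Sum>u\<in>R. card (nb R u))"
      using sum_nb_remove[OF less.prems v(1)] by linarith
    then show ?thesis using I by blast
  next
    case False
    then have "v \<notin> nb R u" if "u \<in> R" for u v using that by simp
    then have "indep R" unfolding indep_def by simp
    then show ?thesis by (intro exI[of _ R]) simp
  qed
qed

text \<open>Deleting first a vertex of degree at least 2 removes two edges for one vertex. This gain
  is what forces R to induce a matching in the case of equality.\<close>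

lemma indep_in_sparse_strict:
  assumes "finite R" "v \<in> R" "card (nb R v) \<ge> 2"
  shows "\<exists>I\<subseteq>R. indep I \<and> 2 * card R + 2 \<le> 2 * card I + (\<Sum>v\<in>R. card (nb R v))"
proof -
  have c: "card (R - {v}) + 1 = card R" using card.remove[OF assms(1,2)] by linarith
  obtain I where I: "I \<subseteq> R - {v}" "indep I"
      "2 * card (R - {v}) \<le> 2 * card I + (\<Sum>u\<in>R - {v}. card (nb (R - {v}) u))"
    using indep_in_sparse[of "R - {v}"] assms by auto
  then have "2 * card R + 2 \<le> 2 * card I + (\<Sum>u\<in>R. card (nb R u))"
    using sum_nb_remove[OF assms(1,2)] c assms(3) by linarith
  then show ?thesis using I by blast
qed

end

context ccubic
begin

text \<open>The edges between D and its complement, counted from both sides and arranged without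
  subtraction.\<close>

lemma degree_sums:
  assumes "D \<subseteq> V"
  shows "(\<Sum>v\<in>V - D. card (nb (V - D) v)) + 3 * card D = 3 * card (V - D) + (\<Sum>v\<in>D. card (nb D v))"
proof -
  let ?R = "V - D"
  have fin: "finite D" "finite ?R" using assms finV finite_subset by auto
  have c: "card (nb D v) + card (nb ?R v) = 3" if "v \<in> V" for v
  proof -
    have "D \<union> ?R = V" using assms by blast
    then show ?thesis using card_nb_Un[OF fin, of v] deg3[OF that] by auto
  qed
  have "(\<Sum>v\<in>D. card (nb D v)) + (\<Sum>v\<in>D. card (nb ?R v)) = (\<Sum>v\<in>D. 3)"
    unfolding sum.distrib[symmetric] by (rule sum.cong) (use c assms in auto)
  moreover have "(\<Sum>v\<in>?R. card (nb D v)) + (\<Sum>v\<in>?R. card (nb ?R v)) = (\<Sum>v\<in>?R. 3)"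
    unfolding sum.distrib[symmetric] by (rule sum.cong) (use c in auto)
  moreover have "(\<Sum>v\<in>D. card (nb ?R v)) = (\<Sum>v\<in>?R. card (nb D v))" using fin by (rule double_count)
  ultimately show ?thesis by simp
qed

text \<open>For K4 the inequality fails, since its independence number is 1 and it has dissociation
  sets of order 2.\<close>

lemma five_alpha_ge:
  assumes n4: "card V \<noteq> 4" and a: "\<And>I. I \<subseteq> V \<Longrightarrow> indep I \<Longrightarrow> card I \<le> a"
    and D: "D \<subseteq> V" "\<And>v. v \<in> D \<Longrightarrow> card (nb D v) \<le> 1"
  shows "3 * card D \<le> 5 * a"
    and "5 * a = 3 * card D \<Longrightarrow> 3 * a = card V \<and> (\<forall>v\<in>D. card (nb D v) = 1) \<and>
      (\<forall>v\<in>V - D. card (nb (V - D) v) \<le> 1) \<and>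
      2 * card (V - D) = 2 * a + (\<Sum>v\<in>V - D. card (nb (V - D) v))"
proof -
  let ?R = "V - D"
  have fin: "finite D" "finite ?R" using D finV finite_subset by auto
  define S where "S = (\<Sum>v\<in>?R. card (nb ?R v))"
  obtain I where "I \<subseteq> V" "indep I" "card V \<le> 3 * card I" using brooks[OF n4] .
  then have 1: "card V \<le> 3 * a" using a[of I] by linarith
  obtain J where "J \<subseteq> ?R" "indep J" "2 * card ?R \<le> 2 * card J + S"
    using indep_in_sparse[OF fin(2)] by (auto simp: S_def)
  moreover have "card J \<le> a" using calculation(1,2) by (intro a) blast+
  ultimately have 2: "2 * card ?R \<le> 2 * a + S" by linarith
  have SD: "(\<Sum>v\<in>D. card (nb D v)) \<le> card D"
    using sum_mono[of D "\<lambda>v. card (nb D v)" "\<lambda>_. 1"] D(2) by simp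
  note sums = degree_sums[OF D(1)] card_V_Diff[OF D(1)]
  \<comment> \<open>As D induces degrees at most 1, S \<le> 3 |R| - 2 |D|. With 2 |R| \<le> 2a + S
    this yields 3 |D| \<le> 2a + |V| \<le> 5a, and equality at the end forces equality in each
    estimate.\<close>
  show "3 * card D \<le> 5 * a" using 1 2 SD sums by (simp add: S_def)
  assume eq: "5 * a = 3 * card D"
  have e: "3 * a = card V" "(\<Sum>v\<in>D. card (nb D v)) = card D" "2 * card ?R = 2 * a + S"
    using 1 2 SD sums eq by (simp_all add: S_def)
  have "card (nb D v) = 1" if v: "v \<in> D" for v
  proof (rule ccontr)
    assume "card (nb D v) \<noteq> 1"
    then have "card (nb D v) < 1" using D(2)[OF v] by linarith
    then have "(\<Sum>v\<in>D. card (nb D v)) < (\<Sum>v\<in>D. 1)"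
      using fin v D(2) by (intro sum_strict_mono_ex1) auto
    then show False using e(2) by simp
  qed
  moreover have "card (nb ?R v) \<le> 1" if v: "v \<in> ?R" for v
  proof (rule ccontr)
    assume "\<not> ?thesis"
    then have "card (nb ?R v) \<ge> 2" by simp
    then obtain J where "J \<subseteq> ?R" "indep J" "2 * card ?R + 2 \<le> 2 * card J + S"
      using indep_in_sparse_strict[OF fin(2) v] by (auto simp: S_def)
    moreover have "card J \<le> a" using calculation(1,2) by (intro a) blast+
    ultimately show False using e(3) by linarith
  qed
  ultimately show "3 * a = card V \<and> (\<forall>v\<in>D. card (nb D v) = 1) \<and>
      (\<forall>v\<in>V - D. card (nb (V - D) v) \<le> 1) \<and>
      2 * card (V - D) = 2 * a + (\<Sum>v\<in>V - D. card (nb (V - D) v))"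
    using e by (simp add: S_def)
qed

end

section \<open>The multigraph of a partition into gadgets\<close>

text \<open>The numberings \<open>\<iota>\<close> of vertices and \<open>h\<close> of tiles are
  fixed because vertices and edges of a multigraph are natural numbers. The shapes, kinds and
  labellings of the tiles are chosen once, since a tile alone need not determine them.\<close>

locale tiled_cubic = ccubic adj V for adj :: "'a \<Rightarrow> 'a \<Rightarrow> bool" and V +
  fixes P :: "'a set set" and d :: "'a set \<Rightarrow> nat" and b :: "'a set \<Rightarrow> bool"
    and g :: "'a set \<Rightarrow> nat \<Rightarrow> 'a" and \<iota> :: "'a \<Rightarrow> nat" and h :: "'a set \<Rightarrow> nat"
  assumes P: "tiling V P" and G: "T \<in> P \<Longrightarrow> gadget_at (d T) (b T) (g T) T"
    and inj_\<iota>: "inj_on \<iota> V" and inj_h: "inj_on h P"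
begin

definition blk :: "'a \<Rightarrow> 'a set" where
  "blk v = (THE T. T \<in> P \<and> v \<in> T)"

definition lab :: "'a \<Rightarrow> nat" where
  "lab v = inv_into (gadget_verts (d (blk v))) (g (blk v)) v"

definition AV :: "'a set" where
  "AV = {v \<in> V. lab v \<in> attach_verts (d (blk v))}"

definition partner :: "'a \<Rightarrow> 'a" where
  "partner v = (THE w. w \<in> nb V v \<and> blk w \<noteq> blk v)"

text \<open>Each edge between two gadgets is numbered by the smaller number of its ends.\<close>
definition eid :: "'a \<Rightarrow> nat" where
  "eid v = min (\<iota> v) (\<iota> (partner v))"

definition W :: "nat set" where "W = h ` P"

definition Ed :: "nat set" where "Ed = eid ` AV"

definition ends :: "nat \<Rightarrow> nat set" where
  "ends e = (\<lambda>v. h (blk v)) ` {v \<in> AV. eid v = e}"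

definition kind :: "nat \<Rightarrow> bool" where
  "kind w = b (inv_into P h w)"

definition att :: "nat \<Rightarrow> nat \<Rightarrow> nat" where
  "att w e = lab (THE v. v \<in> AV \<and> eid v = e \<and> h (blk v) = w)"

lemma blk_eq: "T \<in> P \<Longrightarrow> v \<in> T \<Longrightarrow> blk v = T"
  unfolding blk_def using tilingD(4)[OF P] by (intro the_equality) auto

lemma blk: "v \<in> V \<Longrightarrow> blk v \<in> P" "v \<in> V \<Longrightarrow> v \<in> blk v"
  using tilingD(3)[OF P, of v] blk_eq by auto

lemma PV: "T \<in> P \<Longrightarrow> T \<subseteq> V"
  by (rule tilingD(1)[OF P])

lemma finP: "finite P"
  using P finV by (rule tiling_finite)

lemma dP: "T \<in> P \<Longrightarrow> d T \<in> {1,2,3}"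
  using G gadget_atD(1) by blast

lemma lab_eq: "T \<in> P \<Longrightarrow> i \<in> gadget_verts (d T) \<Longrightarrow> g T i \<in> T \<and> blk (g T i) = T \<and> lab (g T i) = i"
proof -
  assume T: "T \<in> P" and i: "i \<in> gadget_verts (d T)"
  have gi: "g T i \<in> T" using gadget_atD(4)[OF G[OF T]] i by blast
  then have "blk (g T i) = T" using T by (rule blk_eq[rotated])
  then show ?thesis using gi gadget_atD(3)[OF G[OF T]] i by (simp add: lab_def)
qed

lemma lab:
  assumes "v \<in> V"
  shows "lab v \<in> gadget_verts (d (blk v))" "g (blk v) (lab v) = v"
proof -
  have "v \<in> g (blk v) ` gadget_verts (d (blk v))"
    using gadget_atD(4)[OF G[OF blk(1)[OF assms]]] blk(2)[OF assms] by blast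
  then show "lab v \<in> gadget_verts (d (blk v))" "g (blk v) (lab v) = v"
    unfolding lab_def by (rule inv_into_into, rule f_inv_into_f)
qed

lemma outer_attach:
  assumes "v \<in> V" "w \<in> V" "adj v w" "blk w \<noteq> blk v"
  shows "v \<in> AV"
proof (rule ccontr)
  assume "v \<notin> AV"
  then have "lab v \<in> gadget_verts (d (blk v)) - attach_verts (d (blk v))"
    using assms(1) lab by (auto simp: AV_def)
  then have "nb V v \<subseteq> blk v"
    using gadget_inner_nb[OF G[OF blk(1)[OF assms(1)]] _ subV PV[OF blk(1)[OF assms(1)]], of "lab v"]
      lab(2)[OF assms(1)] by simp
  then have "w \<in> blk v" using assms by auto
  then show False using blk_eq[OF blk(1)[OF assms(1)]] assms(4) by blast
qed

lemma AV_V: "v \<in> AV \<Longrightarrow> v \<in> V"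
  by (simp add: AV_def)

text \<open>An attachment vertex has two neighbours in its own tile, so exactly one of its three
  neighbours lies elsewhere.\<close>

lemma partner_ex1:
  assumes "v \<in> AV"
  shows "\<exists>!w. w \<in> nb V v \<and> blk w \<noteq> blk v"
proof -
  have v: "v \<in> V" "lab v \<in> attach_verts (d (blk v))" using assms by (auto simp: AV_def)
  let ?T = "blk v"
  have T: "?T \<in> P" "?T \<subseteq> V" using blk(1)[OF v(1)] PV by auto
  have finT: "finite ?T" using T(2) finV by (rule finite_subset)
  have "card (nb ?T v) = 2"
    using gadget_card_nb[OF G[OF T(1)] lab(1)[OF v(1)]] v lab(2)[OF v(1)] by simp
  moreover have "card (nb (?T \<union> (V - ?T)) v) = card (nb ?T v) + card (nb (V - ?T) v)"
    using finT finV by (intro card_nb_Un) auto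
  moreover have "?T \<union> (V - ?T) = V" using T by blast
  ultimately have "card (nb (V - ?T) v) = 1" using deg3[OF v(1)] by simp
  then obtain w where w: "nb (V - ?T) v = {w}" by (rule card_1_singletonE)
  have "x \<in> nb V v \<and> blk x \<noteq> blk v \<longleftrightarrow> x \<in> nb (V - ?T) v" for x
    using blk_eq[OF T(1), of x] blk(2)[of x] by auto
  then show ?thesis unfolding w by auto
qed

lemma partner:
  assumes "v \<in> AV"
  shows "partner v \<in> V" "adj v (partner v)" "blk (partner v) \<noteq> blk v" "partner v \<in> AV"
    "partner (partner v) = v"
    "w \<in> V \<Longrightarrow> adj v w \<Longrightarrow> blk w \<noteq> blk v \<Longrightarrow> w = partner v"
proof -
  have *: "partner v \<in> nb V v \<and> blk (partner v) \<noteq> blk v"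
    unfolding partner_def using partner_ex1[OF assms] by (rule theI')
  then show p: "partner v \<in> V" "adj v (partner v)" "blk (partner v) \<noteq> blk v" by auto
  show pA: "partner v \<in> AV" using outer_attach[OF p(1) AV_V[OF assms] adj_sym[OF p(2)]] p(3) by auto
  show "w = partner v" if "w \<in> V" "adj v w" "blk w \<noteq> blk v"
    using partner_ex1[OF assms] * that by auto
  show "partner (partner v) = v"
    using partner_ex1[OF pA] adj_sym[OF p(2)] p(3) AV_V[OF assms] unfolding partner_def[of "partner v"]
    by (intro the1_equality) auto
qed

lemma eid_partner: "v \<in> AV \<Longrightarrow> eid (partner v) = eid v"
  by (simp add: eid_def partner(5) min.commute)

lemma eid_eq:
  assumes "u \<in> AV" "v \<in> AV" "eid u = eid v"
  shows "u = v \<or> u = partner v"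
proof -
  have inV: "u \<in> V" "v \<in> V" "partner u \<in> V" "partner v \<in> V" using assms AV_V partner(1) by auto
  have "\<iota> u = \<iota> v \<or> \<iota> u = \<iota> (partner v) \<or> \<iota> (partner u) = \<iota> v \<or> \<iota> (partner u) = \<iota> (partner v)"
    using assms(3) unfolding eid_def min_def by (auto split: if_splits)
  then have "u = v \<or> u = partner v \<or> partner u = v \<or> partner u = partner v"
    using inj_\<iota> inV by (auto dest: inj_onD)
  then show ?thesis using partner(5)[OF assms(1)] partner(5)[OF assms(2)] by metis
qed

lemma eid_fibre: "v \<in> AV \<Longrightarrow> {u \<in> AV. eid u = eid v} = {v, partner v}"
  using eid_eq eid_partner partner(4) by blast

lemma ends_eid: "v \<in> AV \<Longrightarrow> ends (eid v) = {h (blk v), h (blk (partner v))}"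
  unfolding ends_def by (simp add: eid_fibre)

lemma h_blk_eq: "u \<in> V \<Longrightarrow> v \<in> V \<Longrightarrow> h (blk u) = h (blk v) \<longleftrightarrow> blk u = blk v"
  using inj_h blk(1) by (auto dest: inj_onD)

lemma h_eq: "S \<in> P \<Longrightarrow> T \<in> P \<Longrightarrow> h S = h T \<longleftrightarrow> S = T"
  using inj_h by (auto dest: inj_onD)

lemma ends_distinct: "v \<in> AV \<Longrightarrow> h (blk v) \<noteq> h (blk (partner v))"
  using h_blk_eq[of v "partner v"] partner(1,3)[of v] AV_V by auto

lemma Ed_cases:
  assumes "e \<in> Ed"
  obtains v where "v \<in> AV" "e = eid v"
  using assms unfolding Ed_def by blast

lemma attach_tile:
  assumes "T \<in> P"
  shows "{v \<in> AV. blk v = T} = g T ` attach_verts (d T)"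
proof (intro equalityI subsetI)
  fix v assume "v \<in> {v \<in> AV. blk v = T}"
  then have v: "v \<in> V" "lab v \<in> attach_verts (d T)" "blk v = T" by (auto simp: AV_def)
  then have "g T (lab v) = v" using lab(2) by blast
  then show "v \<in> g T ` attach_verts (d T)" using v(2) by (metis imageI)
next
  fix v assume "v \<in> g T ` attach_verts (d T)"
  then obtain i where i: "i \<in> attach_verts (d T)" "v = g T i" by blast
  then have "i \<in> gadget_verts (d T)" using attach_subset by blast
  then show "v \<in> {v \<in> AV. blk v = T}"
    using lab_eq[OF assms] i PV[OF assms] by (auto simp: AV_def)
qed

lemma incident:
  assumes "T \<in> P"
  shows "{e \<in> Ed. h T \<in> ends e} = eid ` {v \<in> AV. blk v = T}"
proof (intro equalityI subsetI)
  fix e assume "e \<in> {e \<in> Ed. h T \<in> ends e}"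
  then have e: "e \<in> Ed" "h T \<in> ends e" by auto
  obtain v where v: "v \<in> AV" "e = eid v" using e(1) by (rule Ed_cases)
  have "h T = h (blk v) \<or> h T = h (blk (partner v))" using e(2) ends_eid[OF v(1)] v(2) by simp
  then show "e \<in> eid ` {v \<in> AV. blk v = T}"
  proof
    assume "h T = h (blk v)"
    then have "T = blk v" using h_eq[OF assms blk(1)[OF AV_V[OF v(1)]]] by simp
    then show ?thesis using v by blast
  next
    assume "h T = h (blk (partner v))"
    then have "T = blk (partner v)" using h_eq[OF assms blk(1)[OF partner(1)[OF v(1)]]] by simp
    moreover have "e = eid (partner v)" using eid_partner[OF v(1)] v(2) by simp
    ultimately show ?thesis using partner(4)[OF v(1)] by blast
  qed
next
  fix e assume "e \<in> eid ` {v \<in> AV. blk v = T}"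
  then show "e \<in> {e \<in> Ed. h T \<in> ends e}" using ends_eid by (auto simp: Ed_def)
qed

lemma eid_inj_tile: "inj_on eid {v \<in> AV. blk v = T}"
proof (rule inj_onI)
  fix u v assume uv: "u \<in> {v \<in> AV. blk v = T}" "v \<in> {v \<in> AV. blk v = T}" "eid u = eid v"
  then have "u = v \<or> u = partner v" using eid_eq by blast
  then show "u = v" using partner(3)[of v] uv by auto
qed

lemma mdeg_eq:
  assumes "T \<in> P"
  shows "mdeg Ed ends (h T) = d T"
proof -
  have "inj_on (g T) (attach_verts (d T))"
    using gadget_atD(3)[OF G[OF assms]] attach_subset by (rule inj_on_subset)
  then have "card {v \<in> AV. blk v = T} = d T"
    unfolding attach_tile[OF assms] using card_attach_verts[OF dP[OF assms]] by (simp add: card_image)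
  then show ?thesis unfolding mdeg_def incident[OF assms] using eid_inj_tile by (simp add: card_image)
qed

lemma att_eq:
  assumes "v \<in> AV"
  shows "att (h (blk v)) (eid v) = lab v"
proof -
  have "(THE u. u \<in> AV \<and> eid u = eid v \<and> h (blk u) = h (blk v)) = v"
  proof (rule the_equality)
    fix u assume u: "u \<in> AV \<and> eid u = eid v \<and> h (blk u) = h (blk v)"
    then have "u = v \<or> u = partner v" using assms eid_eq by blast
    then show "u = v" using u ends_distinct[OF assms] by auto
  qed (use assms in simp)
  then show ?thesis by (simp add: att_def)
qed

lemma valid_att: "valid_att W Ed ends att"
  unfolding valid_att_def
proof
  fix w assume "w \<in> W"
  then obtain T where T: "T \<in> P" "w = h T" by (auto simp: W_def)
  have a: "att w (eid v) = lab v" if "v \<in> AV" "blk v = T" for v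
    using att_eq[OF that(1)] that T by simp
  have "inj_on (att w \<circ> eid) {v \<in> AV. blk v = T}"
  proof (rule inj_onI)
    fix u v assume uv: "u \<in> {v \<in> AV. blk v = T}" "v \<in> {v \<in> AV. blk v = T}" "(att w \<circ> eid) u = (att w \<circ> eid) v"
    then have "lab u = lab v" using a by simp
    then show "u = v" using lab(2)[of u] lab(2)[of v] uv AV_V by auto
  qed
  then have "inj_on (att w) (eid ` {v \<in> AV. blk v = T})"
    by (rule inj_on_imageI)
  moreover have "att w ` eid ` {v \<in> AV. blk v = T} = attach_verts (d T)"
  proof -
    have "att w ` eid ` {v \<in> AV. blk v = T} = lab ` {v \<in> AV. blk v = T}"
      unfolding image_image by (rule image_cong) (use a in auto)
    also have "\<dots> = lab ` g T ` attach_verts (d T)" by (simp add: attach_tile[OF T(1)])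
    also have "\<dots> = (\<lambda>i. i) ` attach_verts (d T)"
      unfolding image_image by (rule image_cong) (use lab_eq[OF T(1)] attach_subset in auto)
    finally show ?thesis by simp
  qed
  ultimately show "inj_on (att w) {e \<in> Ed. w \<in> ends e} \<and>
      att w ` {e \<in> Ed. w \<in> ends e} = attach_verts (mdeg Ed ends w)"
    unfolding T(2) incident[OF T(1)] mdeg_eq[OF T(1)] by simp
qed

lemma finEd: "finite Ed"
  unfolding Ed_def AV_def using finV by simp

lemma multigraph: "multigraph W Ed ends"
  unfolding multigraph_def
proof (intro conjI ballI)
  show "finite W" "finite Ed" using finP finEd by (auto simp: W_def)
  fix e assume "e \<in> Ed"
  then obtain v where v: "v \<in> AV" "e = eid v" by (rule Ed_cases)
  show "card (ends e) = 2" using ends_eid[OF v(1)] ends_distinct[OF v(1)] v(2) by simp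
  show "ends e \<subseteq> W" using ends_eid[OF v(1)] v AV_V blk(1) partner(1)[OF v(1)] by (auto simp: W_def)
qed

lemma mconnected: "mconnected W Ed ends"
  unfolding mconnected_def
proof (intro conjI ballI)
  obtain v where "v \<in> V" using neV by blast
  then show "W \<noteq> {}" using blk(1) by (auto simp: W_def)
  fix u v assume u: "u \<in> W" and v: "v \<in> W"
  let ?r = "{(x, y). \<exists>e\<in>Ed. ends e = {x, y}}"
  define X where "X = {x \<in> V. (u, h (blk x)) \<in> ?r\<^sup>*}"
  have nonempty: "\<exists>x\<in>T. x \<in> V \<and> blk x = T" if "T \<in> P" for T
  proof -
    have "T \<noteq> {}" using gadget_card_pos[of T] tilingD(2)[OF P that] by auto
    then show ?thesis using blk_eq[OF that] PV[OF that] by blast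
  qed
  have "X = V"
  proof (rule conn)
    show "X \<subseteq> V" by (auto simp: X_def)
    obtain T where "T \<in> P" "u = h T" using u by (auto simp: W_def)
    then show "X \<noteq> {}" using nonempty[of T] by (auto simp: X_def)
    fix x assume x: "x \<in> X"
    show "nb V x \<subseteq> X"
    proof
      fix y assume y: "y \<in> nb V x"
      have xV: "x \<in> V" "(u, h (blk x)) \<in> ?r\<^sup>*" using x by (auto simp: X_def)
      show "y \<in> X"
      proof (cases "blk y = blk x")
        case True
        then show ?thesis using xV y by (auto simp: X_def)
      next
        case False
        then have xA: "x \<in> AV" using outer_attach xV y by auto
        then have "y = partner x" using partner(6) y False by auto
        then have "(h (blk x), h (blk y)) \<in> ?r" using ends_eid[OF xA] xA by (auto simp: Ed_def)
        then show ?thesis using xV y by (auto simp: X_def intro: rtrancl_into_rtrancl)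
      qed
    qed
  qed
  moreover obtain T where "T \<in> P" "v = h T" using v by (auto simp: W_def)
  ultimately show "(u, v) \<in> ?r\<^sup>*" using nonempty[of T] by (auto simp: X_def)
qed

lemma ncount_eq: "ncount W Ed ends i = card {T \<in> P. d T = i}"
proof -
  have "{w \<in> W. mdeg Ed ends w = i} = h ` {T \<in> P. d T = i}"
    using mdeg_eq by (auto simp: W_def)
  moreover have "inj_on h {T \<in> P. d T = i}" using inj_h by (rule inj_on_subset) auto
  ultimately show ?thesis by (simp add: ncount_def card_image)
qed

text \<open>The weights 3, 2, 1 in condition (i) are the independence numbers of the
  gadgets.\<close>

lemma sum_alpha:
  "3 * ncount W Ed ends 1 + 2 * ncount W Ed ends 2 + ncount W Ed ends 3 = (\<Sum>T\<in>P. gadget_alpha (d T))"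
proof -
  have "(\<Sum>T\<in>P. gadget_alpha (d T)) =
    (\<Sum>T\<in>P. 3 * (if d T = 1 then 1 else 0) + 2 * (if d T = 2 then 1 else 0) + (if d T = 3 then 1 else 0))"
    by (rule sum.cong) (use dP in \<open>auto simp: gadget_alpha_def\<close>)
  also have "\<dots> = 3 * card {T \<in> P. d T = 1} + 2 * card {T \<in> P. d T = 2} + card {T \<in> P. d T = 3}"
    using finP by (simp add: sum.distrib sum_distrib_left[symmetric] sum.If_cases Int_def)
  finally show ?thesis by (simp add: ncount_eq)
qed

lemma card_V_sum: "card V = 3 * (\<Sum>T\<in>P. gadget_alpha (d T))"
proof -
  have "card V = (\<Sum>T\<in>P. card T)" by (rule tiling_card[OF P finV])
  also have "\<dots> = (\<Sum>T\<in>P. 3 * gadget_alpha (d T))" by (rule sum.cong) (use gadget_card[OF G] in auto)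
  finally show ?thesis by (simp add: sum_distrib_left)
qed

definition pos :: "'a \<Rightarrow> nat \<times> nat" where
  "pos v = (h (blk v), lab v)"

lemma pos_inj:
  assumes "u \<in> V" "v \<in> V"
  shows "pos u = pos v \<longleftrightarrow> u = v"
proof
  assume "pos u = pos v"
  then have "blk u = blk v" "lab u = lab v" using h_blk_eq[OF assms] by (auto simp: pos_def)
  then show "u = v" using lab(2)[OF assms(1)] lab(2)[OF assms(2)] by metis
qed simp

lemma pos_bij: "bij_betw pos V (blowup_V W Ed ends)"
  unfolding bij_betw_def
proof (intro conjI equalityI subsetI)
  show "inj_on pos V" by (rule inj_onI) (simp add: pos_inj)
  fix x assume "x \<in> pos ` V"
  then obtain v where v: "v \<in> V" "x = pos v" by blast
  then show "x \<in> blowup_V W Ed ends"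
    using lab(1)[OF v(1)] mdeg_eq[OF blk(1)[OF v(1)]] blk(1)[OF v(1)] by (auto simp: blowup_V_def pos_def W_def)
next
  fix x assume "x \<in> blowup_V W Ed ends"
  then obtain T i where x: "x = (h T, i)" "T \<in> P" "i \<in> gadget_verts (d T)"
    using mdeg_eq by (auto simp: blowup_V_def W_def)
  then have "pos (g T i) = x" "g T i \<in> V" using lab_eq[OF x(2,3)] PV[OF x(2)] by (auto simp: pos_def)
  then show "x \<in> pos ` V" by blast
qed

lemma adj_same_blk:
  assumes "u \<in> V" "v \<in> V" "blk u = blk v"
  shows "adj u v \<longleftrightarrow> {lab u, lab v} \<in> gadget_edges (d (blk u)) (b (blk u))"
proof -
  have "adj (g (blk u) (lab u)) (g (blk u) (lab v)) \<longleftrightarrow> lab v \<in> gnb (d (blk u)) (b (blk u)) (lab u)"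
    using gadget_atD(5)[OF G[OF blk(1)[OF assms(1)]]] lab(1)[OF assms(1)] lab(1)[OF assms(2)] assms(3) by simp
  then show ?thesis
    using lab(2)[OF assms(1)] lab(2)[OF assms(2)] lab(1)[OF assms(2)] assms(3) by (simp add: gnb_def)
qed

lemma pos_edge:
  assumes uv: "u \<in> V" "v \<in> V"
  shows "adj u v \<longleftrightarrow> {pos u, pos v} \<in> blowup_E W Ed ends kind att"
proof
  assume a: "adj u v"
  show "{pos u, pos v} \<in> blowup_E W Ed ends kind att"
  proof (cases "blk u = blk v")
    case True
    let ?w = "h (blk u)"
    have "?w \<in> W" "kind ?w = b (blk u)" "mdeg Ed ends ?w = d (blk u)"
      using blk(1)[OF uv(1)] mdeg_eq inj_h by (auto simp: W_def kind_def)
    moreover have "{pos u, pos v} = {(?w, lab u), (?w, lab v)}" using True by (simp add: pos_def)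
    ultimately show ?thesis using a adj_same_blk[OF uv True] unfolding blowup_E_def
      by (intro UnI1 CollectI exI[of _ ?w] exI[of _ "lab u"] exI[of _ "lab v"]) simp
  next
    case False
    have uA: "u \<in> AV" using outer_attach[OF uv a] False by auto
    have v: "v = partner u" using partner(6)[OF uA uv(2) a] False by auto
    have "{pos u, pos v} = {(h (blk u), att (h (blk u)) (eid u)), (h (blk v), att (h (blk v)) (eid u))}"
      using att_eq[OF uA] att_eq[OF partner(4)[OF uA]] eid_partner[OF uA] v by (simp add: pos_def)
    moreover have "eid u \<in> Ed" "ends (eid u) = {h (blk u), h (blk v)}" "h (blk u) \<noteq> h (blk v)"
      using uA ends_eid[OF uA] ends_distinct[OF uA] v by (auto simp: Ed_def)
    ultimately show ?thesis unfolding blowup_E_def by blast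
  qed
next
  assume "{pos u, pos v} \<in> blowup_E W Ed ends kind att"
  then consider w i j where "w \<in> W" "{i, j} \<in> gadget_edges (mdeg Ed ends w) (kind w)" "{pos u, pos v} = {(w, i), (w, j)}"
    | e x y where "e \<in> Ed" "ends e = {x, y}" "x \<noteq> y" "{pos u, pos v} = {(x, att x e), (y, att y e)}"
    unfolding blowup_E_def by blast
  then show "adj u v"
  proof cases
    case 1
    obtain T where T: "T \<in> P" "w = h T" using 1(1) by (auto simp: W_def)
    have e: "{i, j} \<in> gadget_edges (d T) (b T)" using 1(2) T mdeg_eq[OF T(1)] inj_h by (simp add: kind_def)
    have "pos u = (w, i) \<and> pos v = (w, j) \<or> pos u = (w, j) \<and> pos v = (w, i)"
      using 1(3) by (auto simp: doubleton_eq_iff)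
    then have l: "h (blk u) = h T" "h (blk v) = h T" "{lab u, lab v} = {i, j}"
      using T by (auto simp: pos_def)
    then have "blk u = T" "blk v = T" using h_eq T blk(1) uv by auto
    then show ?thesis using adj_same_blk[OF uv] e l by simp
  next
    case 2
    obtain z where z: "z \<in> AV" "e = eid z" using 2(1) by (rule Ed_cases)
    have "{x, y} = {h (blk z), h (blk (partner z))}" using 2(2) ends_eid[OF z(1)] z(2) by simp
    moreover have "att (h (blk z)) e = lab z" "att (h (blk (partner z))) e = lab (partner z)"
      using att_eq[OF z(1)] att_eq[OF partner(4)[OF z(1)]] eid_partner[OF z(1)] z(2) by auto
    ultimately have "{pos u, pos v} = {pos z, pos (partner z)}"
      using 2(4) by (auto simp: pos_def doubleton_eq_iff)
    then have "u = z \<and> v = partner z \<or> u = partner z \<and> v = z"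
      using pos_inj uv AV_V[OF z(1)] partner(1)[OF z(1)] by (auto simp: doubleton_eq_iff)
    then show ?thesis using partner(2)[OF z(1)] adj_sym by blast
  qed
qed

section \<open>The induced matching and the orientation obtained from D\<close>

text \<open>The equalities on s are those of the extremal case: D takes five ninths of the vertices,
  and the complement induces s edges.\<close>

lemma in_Hk_of_dissociation:
  assumes D: "D \<subseteq> V" and D1: "\<And>v. v \<in> D \<Longrightarrow> card (nb D v) = 1"
    and R1: "\<And>v. v \<in> V - D \<Longrightarrow> card (nb (V - D) v) \<le> 1"
    and s: "card D = 5 * s" "card V = 9 * s" "(\<Sum>v\<in>V - D. card (nb (V - D) v)) = 2 * s"
  shows "\<exists>k\<ge>1. in_Hk k W Ed ends"
proof -
  define Q where "Q T = {i \<in> gadget_verts (d T). g T i \<in> D}" for T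
  let ?R = "V - D"
  have fin: "finite D" "finite ?R" using D finV finite_subset by auto
  have finT: "finite T" if "T \<in> P" for T using PV[OF that] finV by (rule finite_subset)
  have QD: "g T ` Q T = D \<inter> T" if "T \<in> P" for T
    using gadget_atD(4)[OF G[OF that]] by (auto simp: Q_def)
  have injT: "inj_on (g T) X" if "T \<in> P" "X \<subseteq> gadget_verts (d T)" for T X
    using gadget_atD(3)[OF G[OF that(1)]] that(2) by (rule inj_on_subset)
  have gsub: "gnb (d T) (b T) i \<subseteq> gadget_verts (d T)" for T i by (auto simp: gnb_def)
  have nbQ: "nb (D \<inter> T) (g T i) = g T ` (gnb (d T) (b T) i \<inter> Q T)"
    "nb (T - D) (g T i) = g T ` (gnb (d T) (b T) i - Q T)"
    if T: "T \<in> P" "i \<in> gadget_verts (d T)" for T i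
  proof -
    have n: "nb T (g T i) = g T ` gnb (d T) (b T) i" by (rule gadget_nb[OF G[OF T(1)] T(2)])
    have "nb (D \<inter> T) (g T i) = nb T (g T i) \<inter> D" "nb (T - D) (g T i) = nb T (g T i) - D" by auto
    then show "nb (D \<inter> T) (g T i) = g T ` (gnb (d T) (b T) i \<inter> Q T)"
      "nb (T - D) (g T i) = g T ` (gnb (d T) (b T) i - Q T)"
      unfolding n using gsub[of T i] by (auto simp: Q_def)
  qed
  have cnbQ: "card (nb (D \<inter> T) (g T i)) = card (gnb (d T) (b T) i \<inter> Q T)"
    "card (nb (T - D) (g T i)) = card (gnb (d T) (b T) i - Q T)"
    if T: "T \<in> P" "i \<in> gadget_verts (d T)" for T i
    unfolding nbQ[OF T] using gsub[of T i] by (auto intro!: card_image injT[OF T(1)])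
  have local: "local_pattern (d T) (b T) (Q T)" if T: "T \<in> P" for T
    unfolding local_pattern_def
  proof (intro conjI ballI impI)
    show "Q T \<subseteq> gadget_verts (d T)" by (auto simp: Q_def)
    fix i assume i: "i \<in> Q T"
    then have iv: "i \<in> gadget_verts (d T)" "g T i \<in> D" by (auto simp: Q_def)
    have "card (nb (D \<inter> T) (g T i)) \<le> card (nb D (g T i))"
      using fin by (intro card_mono finite_nb nb_mono) auto
    then show "card (gnb (d T) (b T) i \<inter> Q T) \<le> 1" using D1[OF iv(2)] cnbQ[OF T iv(1)] by simp
    assume "i \<notin> attach_verts (d T)"
    then have sub: "nb V (g T i) \<subseteq> T"
      using gadget_inner_nb[OF G[OF T] _ subV PV[OF T], of i] iv by simp
    have "x \<in> T" if "x \<in> D" "adj (g T i) x" for x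
    proof -
      have "x \<in> nb V (g T i)" using that D by auto
      then show ?thesis using sub by blast
    qed
    then have "nb D (g T i) = nb (D \<inter> T) (g T i)" by auto
    then show "card (gnb (d T) (b T) i \<inter> Q T) = 1" using D1[OF iv(2)] cnbQ[OF T iv(1)] by simp
  next
    fix i assume "i \<in> gadget_verts (d T) - Q T"
    then have iv: "i \<in> gadget_verts (d T)" "g T i \<in> ?R" using lab_eq[OF T] PV[OF T] by (auto simp: Q_def)
    have "card (nb (T - D) (g T i)) \<le> card (nb ?R (g T i))"
      using fin PV[OF T] by (intro card_mono finite_nb nb_mono) auto
    then show "card (gnb (d T) (b T) i - Q T) \<le> 1" using R1[OF iv(2)] cnbQ[OF T iv(1)] by simp
  qed
  define Mt where "Mt = {T \<in> P. matched_pattern (d T) (b T) (Q T)}"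
  have MtP: "Mt \<subseteq> P" by (auto simp: Mt_def)
  have matched: "matched_pattern (d T) (b T) (Q T)" if "T \<in> Mt" for T using that by (simp add: Mt_def)
  have free: "free_pattern (d T) (b T) (Q T)" if "T \<in> P" "T \<notin> Mt" for T
    using local_pattern_cases[OF dP[OF that(1)] local[OF that(1)]] that by (auto simp: Mt_def)
  have s6: "(\<Sum>T\<in>P. gadget_alpha (d T)) = 3 * s" using card_V_sum s(2) by simp
  \<comment> \<open>Free tiles contribute 2 \<open>gadget_alpha\<close> vertices to D and matched
    ones one vertex less, so 5s = 2 * 3s - |Mt|.\<close>
  have cMt: "card Mt = s"
  proof -
    have cQ: "card (Q T) = card (D \<inter> T)" if "T \<in> P" for T
      unfolding QD[OF that, symmetric] by (rule card_image[symmetric], rule injT[OF that]) (auto simp: Q_def)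
    have "(\<Union>T\<in>P. D \<inter> T) = D" using D blk by blast
    then have "card D = (\<Sum>T\<in>P. card (D \<inter> T))" using tiling_card_parts[OF P finV, of "\<lambda>T. D \<inter> T"] by simp
    then have "card D + card Mt = (\<Sum>T\<in>P. card (Q T) + (if T \<in> Mt then 1 else 0))"
      using cQ finP MtP by (simp add: sum.distrib sum.If_cases Int_absorb1)
    also have "\<dots> = (\<Sum>T\<in>P. 2 * gadget_alpha (d T))"
    proof (rule sum.cong)
      fix T assume T: "T \<in> P"
      show "card (Q T) + (if T \<in> Mt then 1 else 0) = 2 * gadget_alpha (d T)"
        using matched[of T] free[OF T] by (auto simp: matched_pattern_def free_pattern_def)
    qed simp
    also have "\<dots> = 2 * (\<Sum>T\<in>P. gadget_alpha (d T))" by (rule sum_distrib_left[symmetric])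
    finally show ?thesis using s(1) s6 by simp
  qed
  text \<open>The gadgets meeting a matching edge already contain all edges avoiding D.\<close>
  have noRR: "partner v \<in> D" if v: "v \<in> AV" "v \<notin> D" for v
  proof (rule ccontr)
    assume p: "partner v \<notin> D"
    define X where "X = {v \<in> ?R. nb ?R v \<noteq> {}}"
    define X' where "X' T = {v \<in> T - D. nb (T - D) v \<noteq> {}}" for T
    have cX: "card X = 2 * s"
    proof -
      have "(\<Sum>v\<in>?R. card (nb ?R v)) = (\<Sum>v\<in>?R. if nb ?R v \<noteq> {} then 1 else 0)"
      proof (rule sum.cong)
        fix v assume v: "v \<in> ?R"
        have "card (nb ?R v) = 0 \<longleftrightarrow> nb ?R v = {}" using finite_nb[OF fin(2)] by simp
        then show "card (nb ?R v) = (if nb ?R v \<noteq> {} then 1 else 0)" using R1[OF v] by auto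
      qed simp
      also have "\<dots> = card X" using fin by (simp add: X_def sum.If_cases Int_def)
      finally show ?thesis using s(3) by simp
    qed
    have X'T: "card (X' T) = (if T \<in> Mt then 2 else 0)" if T: "T \<in> P" for T
    proof -
      have "X' T = g T ` {i \<in> gadget_verts (d T) - Q T. \<not> gnb (d T) (b T) i \<subseteq> Q T}"
      proof (intro equalityI subsetI)
        fix x assume "x \<in> X' T"
        then have x: "x \<in> T" "x \<notin> D" "nb (T - D) x \<noteq> {}" by (auto simp: X'_def)
        obtain i where i: "i \<in> gadget_verts (d T)" "x = g T i" using x(1) gadget_atD(4)[OF G[OF T]] by blast
        then have "gnb (d T) (b T) i - Q T \<noteq> {}" using x(3) nbQ(2)[OF T i(1)] by auto
        then show "x \<in> g T ` {i \<in> gadget_verts (d T) - Q T. \<not> gnb (d T) (b T) i \<subseteq> Q T}"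
          using i x(2) by (auto simp: Q_def)
      next
        fix x assume "x \<in> g T ` {i \<in> gadget_verts (d T) - Q T. \<not> gnb (d T) (b T) i \<subseteq> Q T}"
        then obtain i where i: "i \<in> gadget_verts (d T)" "i \<notin> Q T" "\<not> gnb (d T) (b T) i \<subseteq> Q T" "x = g T i" by blast
        have "nb (T - D) x \<noteq> {}" using nbQ(2)[OF T i(1)] i(3,4) by auto
        then show "x \<in> X' T" using i(1,2,4) lab_eq[OF T i(1)] by (auto simp: X'_def Q_def)
      qed
      then have "card (X' T) = card {i \<in> gadget_verts (d T) - Q T. \<not> gnb (d T) (b T) i \<subseteq> Q T}"
        by (simp only:) (rule card_image, rule injT[OF T], auto)
      also have "\<dots> = (if T \<in> Mt then 2 else 0)"
      proof (cases "T \<in> Mt")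
        case True
        then show ?thesis using matched[OF True] by (simp add: matched_pattern_def)
      next
        case False
        then have "{i \<in> gadget_verts (d T) - Q T. \<not> gnb (d T) (b T) i \<subseteq> Q T} = {}"
          using free[OF T False] unfolding free_pattern_def by blast
        then show ?thesis using False by simp
      qed
      finally show ?thesis .
    qed
    have "card (\<Union>T\<in>P. X' T) = (\<Sum>T\<in>P. card (X' T))"
      by (rule tiling_card_parts[OF P finV]) (auto simp: X'_def)
    also have "\<dots> = (\<Sum>T\<in>P. if T \<in> Mt then 2 else 0)" by (rule sum.cong) (use X'T in auto)
    also have "\<dots> = 2 * s" using finP MtP cMt by (simp add: sum.If_cases Int_absorb1)
    finally have cX': "card (\<Union>T\<in>P. X' T) = card X" using cX by simp
    have "(\<Union>T\<in>P. X' T) \<subseteq> X"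
    proof
      fix x assume "x \<in> (\<Union>T\<in>P. X' T)"
      then obtain T where T: "T \<in> P" "x \<in> T" "x \<notin> D" "nb (T - D) x \<noteq> {}" by (auto simp: X'_def)
      have "nb (T - D) x \<subseteq> nb ?R x" using PV[OF T(1)] by (intro nb_mono) auto
      then have "nb ?R x \<noteq> {}" using T(4) by blast
      then show "x \<in> X" using T PV[OF T(1)] by (auto simp: X_def)
    qed
    moreover have "finite X" using fin by (simp add: X_def)
    ultimately have XX: "(\<Union>T\<in>P. X' T) = X" using cX' by (metis card_subset_eq)
    have vV: "v \<in> V" by (rule AV_V[OF v(1)])
    have pR: "partner v \<in> nb ?R v" using partner(1,2)[OF v(1)] p by simp
    then have "v \<in> X" using vV v(2) by (auto simp: X_def)
    then obtain T where T: "T \<in> P" "v \<in> X' T" unfolding XX[symmetric] by blast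
    then have "nb (T - D) v \<noteq> {}" "v \<in> T" by (auto simp: X'_def)
    then obtain w where w: "w \<in> nb (T - D) v" by blast
    have "w \<noteq> partner v"
      using blk_eq[OF T(1), of w] blk_eq[OF T(1), of v] w \<open>v \<in> T\<close> partner(3)[OF v(1)] by auto
    moreover have "w \<in> nb ?R v" using w PV[OF T(1)] by auto
    ultimately have "2 \<le> card (nb ?R v)"
      using pR card_mono[OF finite_nb[OF fin(2)], of "{w, partner v}" v] by simp
    then show False using R1[of v] vV v(2) by simp
  qed
  \<comment> \<open>The unique neighbour of v in D lies in its tile or is its partner. Inside the
    tile there is one exactly if the tile is free.\<close>
  have key: "partner v \<in> D \<longleftrightarrow> blk v \<in> Mt" if v: "v \<in> AV" "v \<in> D" for v
  proof -
    let ?T = "blk v"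
    have vV: "v \<in> V" by (rule AV_V[OF v(1)])
    have T: "?T \<in> P" by (rule blk(1)[OF vV])
    have l: "lab v \<in> gadget_verts (d ?T)" "g ?T (lab v) = v" "lab v \<in> attach_verts (d ?T)"
      using lab[OF vV] v(1) by (auto simp: AV_def)
    have lQ: "lab v \<in> Q ?T" using l v(2) by (simp add: Q_def)
    have eq: "nb D v = nb (D \<inter> ?T) v \<union> ({partner v} \<inter> D)"
    proof (intro equalityI subsetI)
      fix w assume w: "w \<in> nb D v"
      then have "w \<in> V" using D by auto
      then show "w \<in> nb (D \<inter> ?T) v \<union> ({partner v} \<inter> D)"
        using w partner(6)[OF v(1), of w] blk(2)[of w] by (cases "blk w = blk v") auto
    next
      fix w assume "w \<in> nb (D \<inter> ?T) v \<union> ({partner v} \<inter> D)"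
      then show "w \<in> nb D v" using partner(2)[OF v(1)] by auto
    qed
    have pT: "partner v \<notin> ?T" using blk_eq[OF T, of "partner v"] partner(3)[OF v(1)] by auto
    have c: "card (nb (D \<inter> ?T) v) + card ({partner v} \<inter> D) = 1"
    proof -
      have "card (nb D v) = card (nb (D \<inter> ?T) v) + card ({partner v} \<inter> D)"
        unfolding eq using fin pT by (intro card_Un_disjoint) (auto simp: finite_nb)
      then show ?thesis using D1[OF v(2)] by simp
    qed
    have z: "card (nb (D \<inter> ?T) v) = 0 \<longleftrightarrow> gnb (d ?T) (b ?T) (lab v) \<inter> Q ?T = {}"
    proof -
      have "finite (gnb (d ?T) (b ?T) (lab v))" using gsub finite_gadget_verts by (rule finite_subset)
      then show ?thesis using cnbQ(1)[OF T l(1)] l(2) by simp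
    qed
    have "partner v \<in> D \<longleftrightarrow> gnb (d ?T) (b ?T) (lab v) \<inter> Q ?T = {}"
      using c z by (cases "partner v \<in> D") auto
    moreover have "gnb (d ?T) (b ?T) (lab v) \<inter> Q ?T = {} \<longleftrightarrow> ?T \<in> Mt"
    proof
      assume e: "gnb (d ?T) (b ?T) (lab v) \<inter> Q ?T = {}"
      show "?T \<in> Mt"
      proof (rule ccontr)
        assume "?T \<notin> Mt"
        then show False using free[OF T] lQ e unfolding free_pattern_def by blast
      qed
    next
      assume "?T \<in> Mt"
      then obtain i where "Q ?T \<inter> attach_verts (d ?T) = {i}" "gnb (d ?T) (b ?T) i \<inter> Q ?T = {}"
        using matched unfolding matched_pattern_def by blast
      moreover have "lab v \<in> Q ?T \<inter> attach_verts (d ?T)" using lQ l(3) by blast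
      ultimately show "gnb (d ?T) (b ?T) (lab v) \<inter> Q ?T = {}" by auto
    qed
    ultimately show ?thesis by blast
  qed
  have attQ: "{v \<in> AV. blk v = T \<and> v \<in> D} = g T ` (Q T \<inter> attach_verts (d T))" if T: "T \<in> P" for T
  proof -
    have "{v \<in> AV. blk v = T \<and> v \<in> D} = {v \<in> AV. blk v = T} \<inter> D" by blast
    also have "\<dots> = g T ` attach_verts (d T) \<inter> D" by (simp add: attach_tile[OF T])
    also have "\<dots> = g T ` (Q T \<inter> attach_verts (d T))" using attach_subset by (auto simp: Q_def)
    finally show ?thesis .
  qed
  have uniqM: "x = y" if xy: "x \<in> AV" "y \<in> AV" "x \<in> D" "y \<in> D" "blk x = blk y" "blk x \<in> Mt" for x y
  proof -
    have T: "blk x \<in> P" using xy(6) MtP by blast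
    obtain i where "Q (blk x) \<inter> attach_verts (d (blk x)) = {i}"
      using matched[OF xy(6)] unfolding matched_pattern_def by blast
    then have "{v \<in> AV. blk v = blk x \<and> v \<in> D} = {g (blk x) i}" using attQ[OF T] by simp
    then show ?thesis using xy by (metis (mono_tags, lifting) mem_Collect_eq singletonD)
  qed
  define MD where "MD = {v \<in> AV. v \<in> D \<and> partner v \<in> D}"
  define M where "M = eid ` MD"
  have MD_partner: "partner v \<in> MD" if "v \<in> MD" for v
    using that partner(4,5) by (auto simp: MD_def)
  have MD_iff: "eid v \<in> M \<longleftrightarrow> v \<in> MD" if v: "v \<in> AV" for v
  proof
    assume "eid v \<in> M"
    then obtain u where u: "u \<in> MD" "eid v = eid u" by (auto simp: M_def)
    then have "v = u \<or> v = partner u" using eid_eq[OF v, of u] by (auto simp: MD_def)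
    then show "v \<in> MD" using u(1) MD_partner by blast
  qed (auto simp: M_def)
  have MD_Mt: "blk v \<in> Mt" if "v \<in> MD" for v using that key by (auto simp: MD_def)
  have M_Ed: "M \<subseteq> Ed" by (auto simp: M_def MD_def Ed_def)
  have M_ends: "ends (eid v) = {h (blk v), h (blk (partner v))}" if "v \<in> MD" for v
    using that ends_eid by (auto simp: MD_def)
  have endsM: "\<Union>(ends ` M) = h ` Mt"
  proof (intro equalityI subsetI)
    fix w assume "w \<in> \<Union>(ends ` M)"
    then obtain v where v: "v \<in> MD" "w \<in> ends (eid v)" by (auto simp: M_def)
    then have "w = h (blk v) \<or> w = h (blk (partner v))" using M_ends by auto
    then show "w \<in> h ` Mt" using MD_Mt[OF v(1)] MD_Mt[OF MD_partner[OF v(1)]] by blast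
  next
    fix w assume "w \<in> h ` Mt"
    then obtain T where T: "T \<in> Mt" "w = h T" by blast
    have TP: "T \<in> P" using T MtP by blast
    obtain i where i: "Q T \<inter> attach_verts (d T) = {i}"
      using matched[OF T(1)] unfolding matched_pattern_def by blast
    then have "g T i \<in> {v \<in> AV. blk v = T \<and> v \<in> D}" using attQ[OF TP] by simp
    then have v: "g T i \<in> AV" "blk (g T i) = T" "g T i \<in> D" by auto
    then have "g T i \<in> MD" using key[OF v(1,3)] T(1) by (simp add: MD_def)
    then show "w \<in> \<Union>(ends ` M)" using M_ends[of "g T i"] v(2) T(2) by (auto simp: M_def)
  qed
  have disjM: "ends e \<inter> ends e' = {}" if e: "e \<in> M" "e' \<in> M" "e \<noteq> e'" for e e'
  proof (rule ccontr)
    assume "ends e \<inter> ends e' \<noteq> {}"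
    then obtain w where w: "w \<in> ends e" "w \<in> ends e'" by blast
    have ex: "\<exists>x\<in>MD. eid x = e \<and> w = h (blk x)" if "e \<in> M" "w \<in> ends e" for e
    proof -
      obtain v where v: "v \<in> MD" "e = eid v" using \<open>e \<in> M\<close> by (auto simp: M_def)
      then have "w = h (blk v) \<or> w = h (blk (partner v))" using M_ends \<open>w \<in> ends e\<close> by auto
      moreover have "eid (partner v) = e" using eid_partner v by (auto simp: MD_def)
      ultimately show ?thesis
        using v(2) bexI[OF _ v(1), of "\<lambda>x. eid x = e \<and> w = h (blk x)"]
          bexI[OF _ MD_partner[OF v(1)], of "\<lambda>x. eid x = e \<and> w = h (blk x)"] by auto
    qed
    obtain x where x: "x \<in> MD" "eid x = e" "w = h (blk x)" using ex[OF e(1) w(1)] by blast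
    obtain y where y: "y \<in> MD" "eid y = e'" "w = h (blk y)" using ex[OF e(2) w(2)] by blast
    have xy: "x \<in> AV" "y \<in> AV" "x \<in> D" "y \<in> D" using x(1) y(1) by (auto simp: MD_def)
    have "blk x = blk y" using h_blk_eq[OF AV_V[OF xy(1)] AV_V[OF xy(2)]] x(3) y(3) by simp
    then have "x = y" using uniqM xy MD_Mt[OF x(1)] by blast
    then show False using x y e(3) by simp
  qed
  have finM: "finite M" using M_Ed finEd by (rule finite_subset)
  have card2: "card (ends e) = 2" "finite (ends e)" if "e \<in> Ed" for e
    using multigraph that unfolding multigraph_def by (auto intro: card_ge_0_finite)
  have "card (h ` Mt) = (\<Sum>e\<in>M. card (ends e))"
    unfolding endsM[symmetric] using finM card2 M_Ed disjM by (intro card_UN_disjoint) auto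
  also have "\<dots> = (\<Sum>e\<in>M. 2)" by (rule sum.cong) (use card2 M_Ed in auto)
  finally have "card (h ` Mt) = 2 * card M" by simp
  moreover have "card (h ` Mt) = card Mt" using inj_h MtP by (meson card_image inj_on_subset)
  \<comment> \<open>The edges of \<open>M\<close> are disjoint and their ends are exactly the s
    matched tiles.\<close>
  ultimately have sM: "s = 2 * card M" using cMt by simp
  have ind: "induced_matching Ed ends M"
    unfolding induced_matching_def
  proof (intro conjI ballI impI M_Ed)
    show "ends e \<inter> ends e' = {}" if "e \<in> M" "e' \<in> M" "e \<noteq> e'" for e e' using disjM that .
    fix e assume e: "e \<in> Ed" "ends e \<subseteq> \<Union>(ends ` M)"
    obtain v where v: "v \<in> AV" "e = eid v" using e(1) by (rule Ed_cases)
    have in_Mt: "blk x \<in> Mt" if x: "x \<in> V" "h (blk x) \<in> h ` Mt" for x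
    proof -
      obtain T where T: "T \<in> Mt" "h (blk x) = h T" using x(2) by blast
      then have "blk x = T" using h_eq[OF blk(1)[OF x(1)], of T] MtP by blast
      then show ?thesis using T by simp
    qed
    have sub: "{h (blk v), h (blk (partner v))} \<subseteq> h ` Mt" using e(2) ends_eid[OF v(1)] v(2) endsM by simp
    have B: "blk v \<in> Mt" "blk (partner v) \<in> Mt"
      using in_Mt[OF AV_V[OF v(1)]] in_Mt[OF partner(1)[OF v(1)]] sub by auto
    \<comment> \<open>By \<open>noRR\<close> one end lies in D. Its tile is matched, so its outer
      neighbour lies in D as well.\<close>
    have "v \<in> MD"
    proof (cases "v \<in> D")
      case True
      then show ?thesis using key[OF v(1)] B(1) v(1) by (simp add: MD_def)
    next
      case False
      then have "partner v \<in> D" using noRR v(1) by blast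
      then have "v \<in> D" using key[OF partner(4)[OF v(1)]] B(2) partner(5)[OF v(1)] by simp
      then show ?thesis using False by blast
    qed
    then show "e \<in> M" using v(2) by (simp add: M_def)
  qed
  have cov1: "w \<in> \<Union>(ends ` M)" if w: "w \<in> W" "mdeg Ed ends w = 1" for w
  proof -
    obtain T where T: "T \<in> P" "w = h T" using w(1) by (auto simp: W_def)
    then have "d T = 1" using mdeg_eq w(2) by simp
    then have "T \<in> Mt" using free[OF T(1)] by (auto simp: free_pattern_def)
    then show ?thesis unfolding endsM using T by blast
  qed
  \<comment> \<open>An edge outside \<open>M\<close> is oriented away from D, and then the choice of
    v is unique.\<close>
  define tl where "tl e = h (blk (SOME v. v \<in> AV \<and> eid v = e \<and> v \<in> D))" for e
  have tl_eq: "tl (eid v) = h (blk v)" if v: "v \<in> AV" "v \<in> D" "partner v \<notin> D" for v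
  proof -
    have "(SOME u. u \<in> AV \<and> eid u = eid v \<and> u \<in> D) = v"
    proof (rule some_equality)
      fix u assume "u \<in> AV \<and> eid u = eid v \<and> u \<in> D"
      then show "u = v" using eid_eq[of u v] v by auto
    qed (use v in simp)
    then show ?thesis by (simp add: tl_def)
  qed
  \<comment> \<open>Two ends in D would put the edge into \<open>M\<close>, and \<open>noRR\<close>
    excludes that neither end is in D.\<close>
  have rep: "\<exists>v. v \<in> AV \<and> eid v = e \<and> v \<in> D \<and> partner v \<notin> D" if e: "e \<in> Ed - M" for e
  proof -
    obtain v where v: "v \<in> AV" "e = eid v" using e Ed_cases by blast
    have n: "v \<notin> MD" using e v by (auto simp: M_def)
    show ?thesis
    proof (cases "v \<in> D")
      case True
      then show ?thesis using v n by (auto simp: MD_def)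
    next
      case False
      then show ?thesis using v noRR[OF v(1)] partner(4,5)[OF v(1)] eid_partner[OF v(1)] by metis
    qed
  qed
  have tl_ends: "tl e \<in> ends e" if e: "e \<in> Ed - M" for e
  proof -
    obtain v where v: "v \<in> AV" "eid v = e" "v \<in> D" "partner v \<notin> D" using rep[OF e] by blast
    show ?thesis using tl_eq[OF v(1,3,4)] ends_eid[OF v(1)] v(2) by simp
  qed
  have tl_out: "card {e \<in> Ed - M. tl e = w} = 2" if w: "w \<in> W - \<Union>(ends ` M)" for w
  proof -
    obtain T where T: "T \<in> P" "w = h T" using w by (auto simp: W_def)
    have TM: "T \<notin> Mt" using w T unfolding endsM by blast
    let ?A = "{v \<in> AV. blk v = T \<and> v \<in> D}"
    have "{e \<in> Ed - M. tl e = w} = eid ` ?A"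
    proof (intro equalityI subsetI)
      fix e assume e: "e \<in> {e \<in> Ed - M. tl e = w}"
      then obtain v where v: "v \<in> AV" "eid v = e" "v \<in> D" "partner v \<notin> D" using rep[of e] by blast
      then have "h (blk v) = h T" using tl_eq[OF v(1,3,4)] e T by simp
      then have "blk v = T" using h_eq[OF blk(1)[OF AV_V[OF v(1)]] T(1)] by simp
      then show "e \<in> eid ` ?A" using v by blast
    next
      fix e assume "e \<in> eid ` ?A"
      then obtain v where v: "v \<in> AV" "blk v = T" "v \<in> D" "e = eid v" by blast
      have np: "partner v \<notin> D" using key[OF v(1,3)] v(2) TM by simp
      then have "e \<notin> M" using MD_iff[OF v(1)] v(4) by (simp add: MD_def)
      then show "e \<in> {e \<in> Ed - M. tl e = w}"
        using v np tl_eq[OF v(1,3) np] T(2) by (auto simp: Ed_def)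
    qed
    moreover have "inj_on eid ?A" using eid_inj_tile[of T] by (rule inj_on_subset) auto
    \<comment> \<open>A free tile has exactly two attachment vertices in D, and both outer edges
      leave D.\<close>
    moreover have "card ?A = 2"
    proof -
      have "Q T \<inter> attach_verts (d T) \<subseteq> gadget_verts (d T)" using attach_subset by blast
      then have "card ?A = card (Q T \<inter> attach_verts (d T))"
        unfolding attQ[OF T(1)] by (intro card_image injT[OF T(1)])
      then show ?thesis using free[OF T(1) TM] by (simp add: free_pattern_def)
    qed
    ultimately show ?thesis by (simp add: card_image)
  qed
  have "s > 0" using s(2) neV finV by (metis card_gt_0_iff mult_0_right neq0_conv)
  then have k: "card M \<ge> 1" using sM by linarith
  have "in_Hk (card M) W Ed ends"
    unfolding in_Hk_def
  proof (intro conjI exI)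
    have "d T \<le> 3" if "T \<in> P" for T using dP[OF that] by auto
    then show "\<forall>w\<in>W. mdeg Ed ends w \<le> 3" using mdeg_eq by (auto simp: W_def)
    show "3 * ncount W Ed ends 1 + 2 * ncount W Ed ends 2 + ncount W Ed ends 3 = 6 * card M"
      using sum_alpha s6 sM by simp
    show "\<forall>w\<in>W. mdeg Ed ends w = 1 \<longrightarrow> w \<in> \<Union>(ends ` M)" using cov1 by blast
    show "\<forall>e\<in>Ed - M. tl e \<in> ends e" using tl_ends by blast
    show "\<forall>w\<in>W - \<Union>(ends ` M). card {e \<in> Ed - M. tl e = w} = 2" using tl_out by blast
  qed (simp_all add: multigraph mconnected ind)
  then show ?thesis using k by blast
qed

end

context ccubic
begin

lemma in_Gk_of_tiled:
  assumes "tiled V" and D: "D \<subseteq> V" "\<And>v. v \<in> D \<Longrightarrow> card (nb D v) = 1"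
    and R: "\<And>v. v \<in> V - D \<Longrightarrow> card (nb (V - D) v) \<le> 1"
    and s: "card D = 5 * s" "card V = 9 * s" "(\<Sum>v\<in>V - D. card (nb (V - D) v)) = 2 * s"
    and E: "\<And>u v. adj u v \<longleftrightarrow> {u, v} \<in> E"
  shows "\<exists>k\<ge>1. in_Gk k V E"
proof -
  obtain P where P: "tiling V P" using assms(1) unfolding tiled_def by blast
  have "\<forall>T\<in>P. \<exists>x. gadget_at (fst x) (fst (snd x)) (snd (snd x)) T"
    using tilingD(2)[OF P] by (auto simp: gadget_def)
  then obtain F where F: "\<And>T. T \<in> P \<Longrightarrow> gadget_at (fst (F T)) (fst (snd (F T))) (snd (snd (F T))) T"
    by metis
  have finP: "finite P" using P finV by (rule tiling_finite)
  obtain \<iota> :: "'a \<Rightarrow> nat" where i: "inj_on \<iota> V" using finite_imp_inj_to_nat_seg[OF finV] by blast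
  obtain h :: "'a set \<Rightarrow> nat" where h: "inj_on h P" using finite_imp_inj_to_nat_seg[OF finP] by blast
  interpret tiled_cubic adj V P "\<lambda>T. fst (F T)" "\<lambda>T. fst (snd (F T))" "\<lambda>T. snd (snd (F T))" \<iota> h
    by unfold_locales (use P F i h in auto)
  obtain k where k: "k \<ge> 1" "in_Hk k W Ed ends" using in_Hk_of_dissociation[OF D R s] by blast
  have "graph_iso V E (blowup_V W Ed ends) (blowup_E W Ed ends kind att)"
    unfolding graph_iso_def using pos_bij pos_edge E by blast
  then have "in_Gk k V E" unfolding in_Gk_def using k(2) valid_att by blast
  then show ?thesis using k(1) by blast
qed

end

section \<open>Blown-up multigraphs\<close>

text \<open>The order and the independence bound of a blown-up graph. The value 0 for degree 0
  reflects the empty gadget, for which \<open>gadget_alpha\<close> would give 3.\<close>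

lemma in_Hk_sums:
  assumes H: "in_Hk k W Ed ends"
  shows "(\<Sum>w\<in>W. card (gadget_verts (mdeg Ed ends w))) = 18 * k"
    and "(\<Sum>w\<in>W. if mdeg Ed ends w = 0 then 0 else gadget_alpha (mdeg Ed ends w)) = 6 * k"
proof -
  let ?\<delta> = "mdeg Ed ends"
  let ?a = "\<lambda>w. if ?\<delta> w = 0 then 0 else gadget_alpha (?\<delta> w)"
  have fin: "finite W" and d3: "\<And>w. w \<in> W \<Longrightarrow> ?\<delta> w \<le> 3"
    and n: "3 * ncount W Ed ends 1 + 2 * ncount W Ed ends 2 + ncount W Ed ends 3 = 6 * k"
    using H by (auto simp: in_Hk_def multigraph_def)
  have d: "?\<delta> w = 0 \<or> ?\<delta> w = 1 \<or> ?\<delta> w = 2 \<or> ?\<delta> w = 3" if "w \<in> W" for w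
    using d3[OF that] by linarith
  have "(\<Sum>w\<in>W. ?a w) =
    (\<Sum>w\<in>W. 3 * (if ?\<delta> w = 1 then 1 else 0) + 2 * (if ?\<delta> w = 2 then 1 else 0) + (if ?\<delta> w = 3 then 1 else 0))"
    by (rule sum.cong) (use d in \<open>fastforce simp: gadget_alpha_def\<close>)+
  also have "\<dots> = 3 * ncount W Ed ends 1 + 2 * ncount W Ed ends 2 + ncount W Ed ends 3"
    using fin by (simp add: ncount_def sum.distrib sum_distrib_left[symmetric] sum.If_cases Int_def)
  finally show a: "(\<Sum>w\<in>W. ?a w) = 6 * k" using n by simp
  have "(\<Sum>w\<in>W. card (gadget_verts (?\<delta> w))) = (\<Sum>w\<in>W. 3 * ?a w)"
    by (rule sum.cong) (use d in \<open>fastforce simp: gadget_alpha_def gadget_verts_def\<close>)+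
  then show "(\<Sum>w\<in>W. card (gadget_verts (?\<delta> w))) = 18 * k" using a by (simp add: sum_distrib_left[symmetric])
qed

locale blown_up = ccubic adj V for adj :: "'a \<Rightarrow> 'a \<Rightarrow> bool" and V +
  fixes k :: nat and W Ed :: "nat set" and ends :: "nat \<Rightarrow> nat set" and kind :: "nat \<Rightarrow> bool"
    and att :: "nat \<Rightarrow> nat \<Rightarrow> nat" and f :: "'a \<Rightarrow> nat \<times> nat"
  assumes H: "in_Hk k W Ed ends" and att: "valid_att W Ed ends att"
    and f: "bij_betw f V (blowup_V W Ed ends)"
    and fE: "u \<in> V \<Longrightarrow> v \<in> V \<Longrightarrow> adj u v \<longleftrightarrow> {f u, f v} \<in> blowup_E W Ed ends kind att"
begin

abbreviation \<delta> :: "nat \<Rightarrow> nat" where "\<delta> \<equiv> mdeg Ed ends"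

lemma finW: "finite W" and finEd: "finite Ed"
  using H by (auto simp: in_Hk_def multigraph_def)

lemma \<delta>_le: "w \<in> W \<Longrightarrow> \<delta> w \<le> 3"
  using H by (auto simp: in_Hk_def)

lemma f_inj: "u \<in> V \<Longrightarrow> v \<in> V \<Longrightarrow> f u = f v \<Longrightarrow> u = v"
  using f by (auto simp: bij_betw_def dest: inj_onD)

lemma f_in: "v \<in> V \<Longrightarrow> fst (f v) \<in> W \<and> snd (f v) \<in> gadget_verts (\<delta> (fst (f v)))"
proof -
  assume "v \<in> V"
  then have "f v \<in> blowup_V W Ed ends" using f by (rule bij_betw_apply[rotated])
  then show ?thesis by (auto simp: blowup_V_def)
qed

text \<open>Sets of vertices are chosen gadget by gadget in what follows; this turns their order
  into a sum over \<open>W\<close>.\<close>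

lemma card_fibres:
  assumes "\<And>w. w \<in> W \<Longrightarrow> S w \<subseteq> gadget_verts (\<delta> w)"
  shows "card {v \<in> V. snd (f v) \<in> S (fst (f v))} = (\<Sum>w\<in>W. card (S w))"
proof -
  let ?D = "{v \<in> V. snd (f v) \<in> S (fst (f v))}"
  have "f ` ?D = Sigma W S"
  proof (intro equalityI subsetI)
    fix x assume "x \<in> f ` ?D"
    then obtain v where v: "v \<in> V" "snd (f v) \<in> S (fst (f v))" "x = f v" by auto
    then show "x \<in> Sigma W S" using f_in[OF v(1)] by (simp add: mem_Sigma_iff[of "fst (f v)" "snd (f v)", simplified])
  next
    fix x assume x: "x \<in> Sigma W S"
    then have "x \<in> blowup_V W Ed ends" using assms by (auto simp: blowup_V_def)
    then have "x \<in> f ` V" using bij_betw_imp_surj_on[OF f] by simp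
    then obtain v where "v \<in> V" "f v = x" by blast
    moreover have "snd x \<in> S (fst x)" using x by auto
    ultimately show "x \<in> f ` ?D" by auto
  qed
  moreover have "inj_on f ?D" by (rule inj_onI) (simp add: f_inj)
  ultimately have "card ?D = card (Sigma W S)" using card_image[of f ?D] by simp
  also have "\<dots> = (\<Sum>w\<in>W. card (S w))"
    by (intro card_SigmaI finW ballI) (rule finite_subset[OF assms finite_gadget_verts])
  finally show ?thesis .
qed

lemma card_V: "card V = 18 * k"
proof -
  have "{v \<in> V. snd (f v) \<in> gadget_verts (\<delta> (fst (f v)))} = V" using f_in by blast
  then show ?thesis using card_fibres[of "\<lambda>w. gadget_verts (\<delta> w)"] in_Hk_sums(1)[OF H] by simp
qed

lemma same_gadget:
  assumes "u \<in> V" "v \<in> V" "fst (f u) = fst (f v)" "adj u v"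
  shows "snd (f v) \<in> gnb (\<delta> (fst (f u))) (kind (fst (f u))) (snd (f u))"
proof -
  have "{f u, f v} \<in> blowup_E W Ed ends kind att" using fE[OF assms(1,2)] assms(4) by simp
  then consider w i j where "{i, j} \<in> gadget_edges (\<delta> w) (kind w)" "{f u, f v} = {(w, i), (w, j)}"
    | e x y where "x \<noteq> y" "{f u, f v} = {(x, att x e), (y, att y e)}"
    unfolding blowup_E_def by blast
  then show ?thesis
  proof cases
    case 1
    have "fst (f u) = w" "{snd (f u), snd (f v)} = {i, j}" using 1(2) by (auto simp: doubleton_eq_iff)
    then have "{snd (f u), snd (f v)} \<in> gadget_edges (\<delta> (fst (f u))) (kind (fst (f u)))" using 1(1) by simp
    then show ?thesis using gadget_edges_verts by (auto simp: gnb_def)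
  next
    case 2
    then show ?thesis using assms(3) by (auto simp: doubleton_eq_iff)
  qed
qed

lemma same_gadget_adj:
  assumes "u \<in> V" "v \<in> V" "fst (f u) = fst (f v)"
    "snd (f v) \<in> gnb (\<delta> (fst (f u))) (kind (fst (f u))) (snd (f u))"
  shows "adj u v"
proof -
  have "{f u, f v} = {(fst (f u), snd (f u)), (fst (f u), snd (f v))}"
    using assms(3) by (metis prod.collapse)
  moreover have "{snd (f u), snd (f v)} \<in> gadget_edges (\<delta> (fst (f u))) (kind (fst (f u)))"
    using assms(4) by (simp add: gnb_def)
  ultimately have "{f u, f v} \<in> blowup_E W Ed ends kind att"
    unfolding blowup_E_def using f_in[OF assms(1)] by blast
  then show ?thesis using fE[OF assms(1,2)] by simp
qed

lemma cross_edge: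
  assumes "u \<in> V" "v \<in> V" "fst (f u) \<noteq> fst (f v)" "adj u v"
  shows "\<exists>e\<in>Ed. ends e = {fst (f u), fst (f v)} \<and> snd (f u) = att (fst (f u)) e \<and> snd (f v) = att (fst (f v)) e"
proof -
  have "{f u, f v} \<in> blowup_E W Ed ends kind att" using fE[OF assms(1,2)] assms(4) by simp
  then consider w i j where "{f u, f v} = {(w, i), (w, j)}"
    | e x y where "e \<in> Ed" "ends e = {x, y}" "{f u, f v} = {(x, att x e), (y, att y e)}"
    unfolding blowup_E_def by blast
  then show ?thesis
  proof cases
    case 1
    then show ?thesis using assms(3) by (auto simp: doubleton_eq_iff)
  next
    case 2
    then have "f u = (x, att x e) \<and> f v = (y, att y e) \<or> f u = (y, att y e) \<and> f v = (x, att x e)"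
      by (auto simp: doubleton_eq_iff)
    then show ?thesis
    proof (elim disjE conjE)
      assume "f u = (x, att x e)" "f v = (y, att y e)"
      then show ?thesis using 2(1,2) by (intro bexI[of _ e]) simp_all
    next
      assume "f u = (y, att y e)" "f v = (x, att x e)"
      then show ?thesis using 2(1,2) by (intro bexI[of _ e]) (simp_all add: insert_commute)
    qed
  qed
qed

text \<open>An independent set meets each gadget in at most \<open>gadget_alpha\<close> vertices,
  and these numbers add up to 6k by condition (i).\<close>

lemma indep_bound:
  assumes I: "I \<subseteq> V" "indep I"
  shows "card I \<le> 6 * k"
proof -
  define L where "L w = {i. \<exists>v\<in>I. f v = (w, i)}" for w
  have Lv: "L w \<subseteq> gadget_verts (\<delta> w)" for w
  proof
    fix i assume "i \<in> L w"
    then obtain v where "v \<in> I" "f v = (w, i)" by (auto simp: L_def)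
    then show "i \<in> gadget_verts (\<delta> w)" using f_in[of v] I(1) by auto
  qed
  have "I = {v \<in> V. snd (f v) \<in> L (fst (f v))}"
  proof (intro equalityI subsetI)
    fix v assume "v \<in> I"
    then show "v \<in> {v \<in> V. snd (f v) \<in> L (fst (f v))}" using I(1) by (auto simp: L_def intro!: bexI[of _ v])
  next
    fix v assume "v \<in> {v \<in> V. snd (f v) \<in> L (fst (f v))}"
    then obtain u where u: "v \<in> V" "u \<in> I" "f u = f v" by (auto simp: L_def)
    then show "v \<in> I" using f_inj[of u v] I(1) by auto
  qed
  then have "card I = (\<Sum>w\<in>W. card (L w))" using card_fibres[of L] Lv by simp
  also have "\<dots> \<le> (\<Sum>w\<in>W. if \<delta> w = 0 then 0 else gadget_alpha (\<delta> w))"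
  proof (rule sum_mono)
    fix w assume w: "w \<in> W"
    show "card (L w) \<le> (if \<delta> w = 0 then 0 else gadget_alpha (\<delta> w))"
    proof (cases "\<delta> w = 0")
      case True
      then have "L w = {}" using Lv[of w] by (simp add: gadget_verts_def)
      then show ?thesis by simp
    next
      case False
      then have d: "\<delta> w \<in> {1,2,3}" using \<delta>_le[OF w] by auto
      have "j \<notin> gnb (\<delta> w) (kind w) i" if ij: "i \<in> L w" "j \<in> L w" for i j
      proof
        assume j: "j \<in> gnb (\<delta> w) (kind w) i"
        obtain u v where uv: "u \<in> I" "v \<in> I" "f u = (w, i)" "f v = (w, j)" using ij by (auto simp: L_def)
        then have "adj u v" using same_gadget_adj[of u v] I(1) j by auto
        then show False using I(2) uv by (auto simp: indep_def)
      qed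
      then have "card (L w) \<le> gadget_alpha (\<delta> w)" using gadget_independent_bound[OF d Lv] by blast
      then show ?thesis using False by simp
    qed
  qed
  finally show ?thesis using in_Hk_sums(2)[OF H] by simp
qed

text \<open>The table of traces read backwards: gadgets at an end of \<open>M\<close> receive a
  matched trace and the others a free one. Twice 6k, less one for each of the 2k ends of
  \<open>M\<close>, leaves 10k.\<close>

lemma dissociation_exists: "\<exists>D\<subseteq>V. card D = 10 * k \<and> (\<forall>v\<in>D. card (nb D v) \<le> 1)"
proof -
  obtain M tl where M: "induced_matching Ed ends M" "card M = k"
    and deg1: "\<And>w. w \<in> W \<Longrightarrow> \<delta> w = 1 \<Longrightarrow> w \<in> \<Union>(ends ` M)"
    and tl: "\<And>e. e \<in> Ed - M \<Longrightarrow> tl e \<in> ends e"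
    and out: "\<And>w. w \<in> W - \<Union>(ends ` M) \<Longrightarrow> card {e \<in> Ed - M. tl e = w} = 2"
    using H unfolding in_Hk_def by blast
  have MEd: "M \<subseteq> Ed" and Mdis: "\<And>e e'. e \<in> M \<Longrightarrow> e' \<in> M \<Longrightarrow> e \<noteq> e' \<Longrightarrow> ends e \<inter> ends e' = {}"
    using M(1) unfolding induced_matching_def by blast+
  have ends2: "card (ends e) = 2" "ends e \<subseteq> W" if "e \<in> Ed" for e
    using H that by (auto simp: in_Hk_def multigraph_def)
  define C where "C = \<Union>(ends ` M)"
  have CW: "C \<subseteq> W" using ends2 MEd by (auto simp: C_def)
  have finM: "finite M" using MEd finEd by (rule finite_subset)
  have "card C = (\<Sum>e\<in>M. card (ends e))"
    unfolding C_def
  proof (rule card_UN_disjoint[OF finM])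
    show "\<forall>e\<in>M. finite (ends e)" using ends2(2) MEd finW finite_subset by blast
  qed (use Mdis in blast)
  also have "\<dots> = (\<Sum>e\<in>M. 2)" by (rule sum.cong) (use ends2 MEd in auto)
  finally have cC: "card C = 2 * k" using M(2) by simp
  have attI: "inj_on (att w) {e \<in> Ed. w \<in> ends e}" "att w ` {e \<in> Ed. w \<in> ends e} = attach_verts (\<delta> w)"
    if "w \<in> W" for w using att that unfolding valid_att_def by auto
  define me where "me w = (SOME e. e \<in> M \<and> w \<in> ends e)" for w
  have me: "me w \<in> M" "w \<in> ends (me w)" if "w \<in> C" for w
  proof -
    have "\<exists>e. e \<in> M \<and> w \<in> ends e" using that by (auto simp: C_def)
    then have "me w \<in> M \<and> w \<in> ends (me w)" unfolding me_def by (rule someI_ex)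
    then show "me w \<in> M" "w \<in> ends (me w)" by auto
  qed
  have attme: "att w (me w) \<in> attach_verts (\<delta> w)" if "w \<in> C" for w
    using attI(2)[of w] me[OF that] MEd that CW by blast
  \<comment> \<open>At an end of \<open>M\<close> the attachment vertex of its matching edge is
    taken: alone in a triangle, with c and d in a subdivided K4, with both edges p_1q_1 and p_2q_2
    on nine vertices. Elsewhere, the attachment vertices of the two outgoing edges are taken, in a
    subdivided K4 together with c and d.\<close>
  define S where "S w = (if w \<in> C then
      if \<delta> w = 3 then {att w (me w)} else if \<delta> w = 2 then {2, 3, att w (me w)} else if \<delta> w = 1 then {0, 3, 4, 6, 7} else {}
    else if \<delta> w = 3 then att w ` {e \<in> Ed - M. tl e = w} else if \<delta> w = 2 then {2, 3, 4, 5} else {})" for w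
  have tl_inc: "{e \<in> Ed - M. tl e = w} \<subseteq> {e \<in> Ed. w \<in> ends e}" for w using tl by auto
  have d: "\<delta> w = 0 \<or> \<delta> w = 1 \<or> \<delta> w = 2 \<or> \<delta> w = 3" if "w \<in> W" for w using \<delta>_le[OF that] by linarith
  have dC: "\<delta> w \<noteq> 0" if "w \<in> C" for w
  proof -
    have "me w \<in> {e \<in> Ed. w \<in> ends e}" using me[OF that] MEd by auto
    then show ?thesis using finEd unfolding mdeg_def by auto
  qed
  have Ssub: "S w \<subseteq> gadget_verts (\<delta> w)" if w: "w \<in> W" for w
  proof -
    have "att w ` {e \<in> Ed - M. tl e = w} \<subseteq> attach_verts (\<delta> w)" using attI(2)[OF w] tl_inc by blast
    then show ?thesis using attme[of w] d[OF w]
      by (auto simp: S_def gadget_verts_simps attach_verts_simps split: if_splits)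
  qed
  have Scard: "card (S w) + (if w \<in> C then 1 else 0) = 2 * (if \<delta> w = 0 then 0 else gadget_alpha (\<delta> w))"
    if w: "w \<in> W" for w
  proof (cases "w \<in> C")
    case True
    then show ?thesis using d[OF w] dC[OF True] attme[OF True]
      by (auto simp: S_def gadget_alpha_def attach_verts_simps)
  next
    case False
    have "card (att w ` {e \<in> Ed - M. tl e = w}) = 2"
    proof -
      have "inj_on (att w) {e \<in> Ed - M. tl e = w}" using attI(1)[OF w] tl_inc by (rule inj_on_subset)
      then show ?thesis using out[of w] w False by (simp add: card_image C_def)
    qed
    moreover have "\<delta> w \<noteq> 1" using deg1[OF w] False by (auto simp: C_def)
    ultimately show ?thesis using d[OF w] False by (auto simp: S_def gadget_alpha_def)
  qed
  \<comment> \<open>The second part leaves the chosen attachment vertex of a matched gadget free for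
    a neighbour across the matching edge.\<close>
  have inner: "card (gnb (\<delta> w) b i \<inter> S w) \<le> 1"
    and inner0: "w \<in> C \<Longrightarrow> i \<in> attach_verts (\<delta> w) \<Longrightarrow> gnb (\<delta> w) b i \<inter> S w = {}"
    if w: "w \<in> W" and i: "i \<in> S w" for w i b
  proof -
    have iv: "i \<in> gadget_verts (\<delta> w)" using Ssub[OF w] i by blast
    have "card (gnb (\<delta> w) b i \<inter> S w) \<le> 1 \<and> (w \<in> C \<longrightarrow> i \<in> attach_verts (\<delta> w) \<longrightarrow> gnb (\<delta> w) b i \<inter> S w = {})"
    proof (cases "w \<in> C")
      case True
      consider "\<delta> w = Suc 0" | "\<delta> w = 2" "att w (me w) = 4" | "\<delta> w = 2" "att w (me w) = 5" | "\<delta> w = 3"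
        using d[OF w] dC[OF True] attme[OF True] by (auto simp: attach_verts_simps)
      then show ?thesis
      proof cases
        case 1
        have "S w = {0, 3, 4, 6, 7}" using True 1 by (simp add: S_def)
        then show ?thesis using i 1 by (auto simp: gnb_simps attach_verts_simps)
      next
        case 2
        have "S w = {2, 3, 4}" using True 2 by (simp add: S_def)
        then show ?thesis using i 2 by (auto simp: gnb_simps attach_verts_simps)
      next
        case 3
        have "S w = {2, 3, 5}" using True 3 by (simp add: S_def)
        then show ?thesis using i 3 by (auto simp: gnb_simps attach_verts_simps)
      next
        case 4
        have "S w = {i}" using True 4 i by (simp add: S_def)
        then show ?thesis using gnb_irrefl by auto
      qed
    next
      case False
      have "card (S w) = 2 \<or> \<delta> w = 2"
        using Scard[OF w] False i d[OF w] deg1[OF w]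
        by (auto simp: gadget_alpha_def C_def S_def split: if_splits)
      then have "card (gnb (\<delta> w) b i \<inter> S w) \<le> 1"
      proof
        assume c: "card (S w) = 2"
        then have "finite (S w)" by (simp add: card_ge_0_finite)
        then have "card (gnb (\<delta> w) b i \<inter> S w) \<le> card (S w - {i})"
          using gnb_irrefl by (intro card_mono) auto
        then show ?thesis using c i by simp
      next
        assume d2: "\<delta> w = 2"
        then have "S w = {2, 3, 4, 5}" using False by (simp add: S_def)
        then show ?thesis using i d2 by (auto simp: gnb_simps)
      qed
      then show ?thesis using False by simp
    qed
    then show "card (gnb (\<delta> w) b i \<inter> S w) \<le> 1"
      "w \<in> C \<Longrightarrow> i \<in> attach_verts (\<delta> w) \<Longrightarrow> gnb (\<delta> w) b i \<inter> S w = {}" by auto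
  qed
  have att_inj: "e = e'" if "w \<in> W" "e \<in> Ed" "e' \<in> Ed" "w \<in> ends e" "w \<in> ends e'" "att w e = att w e'" for w e e'
    using attI(1)[OF that(1)] that by (auto dest: inj_onD)
  \<comment> \<open>Chosen attachment vertices carry only edges of \<open>M\<close> or edges
    oriented away from their gadget.\<close>
  have outgoing: "if w \<in> C then e \<in> M else e \<notin> M \<and> tl e = w"
    if e: "e \<in> Ed" "w \<in> ends e" "att w e \<in> S w" for w e
  proof -
    have w: "w \<in> W" using e ends2 by blast
    have aw: "att w e \<in> attach_verts (\<delta> w)" using attI(2)[OF w] e by blast
    show ?thesis
    proof (cases "w \<in> C")
      case True
      have "att w e = att w (me w)"
        using True e(3) aw attme[OF True] d[OF w] dC[OF True]
        by (auto simp: S_def attach_verts_simps split: if_splits)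
      then have "e = me w" using att_inj[OF w e(1) _ e(2)] me[OF True] MEd by blast
      then show ?thesis using True me by simp
    next
      case False
      consider "\<delta> w = 3" "att w e \<in> att w ` {e \<in> Ed - M. tl e = w}" | "\<delta> w = 2"
        using False e(3) by (auto simp: S_def split: if_splits)
      then have "e \<in> {e \<in> Ed - M. tl e = w}"
      proof cases
        case 1
        then obtain e' where e': "e' \<in> {e \<in> Ed - M. tl e = w}" "att w e = att w e'" by blast
        then have "e = e'" using att_inj[OF w e(1) _ e(2) _ e'(2)] tl_inc by blast
        then show ?thesis using e' by simp
      next
        \<comment> \<open>A vertex of degree 2 outside \<open>M\<close> has both its edges
          outgoing.\<close>
        case 2
        have "card {e \<in> Ed - M. tl e = w} = card {e \<in> Ed. w \<in> ends e}"
          using out[of w] w False 2 by (simp add: C_def mdeg_def)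
        then have "{e \<in> Ed - M. tl e = w} = {e \<in> Ed. w \<in> ends e}"
          using tl_inc finEd by (intro card_subset_eq) auto
        then show ?thesis using e by blast
      qed
      then show ?thesis using False by simp
    qed
  qed
  define D where "D = {v \<in> V. snd (f v) \<in> S (fst (f v))}"
  have "card D = 10 * k"
  proof -
    have "card D + card C = (\<Sum>w\<in>W. card (S w) + (if w \<in> C then 1 else 0))"
      unfolding D_def using card_fibres[of S] Ssub finW CW
      by (simp add: sum.distrib sum.If_cases Int_absorb1)
    also have "\<dots> = (\<Sum>w\<in>W. 2 * (if \<delta> w = 0 then 0 else gadget_alpha (\<delta> w)))"
      by (rule sum.cong) (use Scard in auto)
    also have "\<dots> = 12 * k" using in_Hk_sums(2)[OF H] by (simp add: sum_distrib_left[symmetric])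
    finally show ?thesis using cC by simp
  qed
  moreover have "card (nb D v) \<le> 1" if v: "v \<in> D" for v
  proof -
    have vV: "v \<in> V" and vS: "snd (f v) \<in> S (fst (f v))" using v by (auto simp: D_def)
    let ?w = "fst (f v)" and ?i = "snd (f v)"
    have w: "?w \<in> W" using f_in[OF vV] by blast
    have finD: "finite D" using finV by (simp add: D_def)
    let ?N = "gnb (\<delta> ?w) (kind ?w) ?i \<inter> S ?w"
    define In where "In = {u \<in> nb D v. fst (f u) = ?w}"
    define Out where "Out = {u \<in> nb D v. fst (f u) \<noteq> ?w}"
    have split: "nb D v = In \<union> Out" by (auto simp: In_def Out_def)
    have fins: "finite In" "finite Out" using finD by (simp_all add: In_def Out_def)
    have DV: "D \<subseteq> V" by (auto simp: D_def)
    have In: "(\<lambda>u. snd (f u)) ` In \<subseteq> ?N"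
    proof
      fix j assume "j \<in> (\<lambda>u. snd (f u)) ` In"
      then obtain u where u: "u \<in> D" "adj v u" "fst (f u) = ?w" "j = snd (f u)" by (auto simp: In_def)
      have uV: "u \<in> V" using u(1) DV by blast
      have "j \<in> gnb (\<delta> ?w) (kind ?w) ?i" using same_gadget[OF vV uV] u by simp
      moreover have "j \<in> S ?w" using u by (auto simp: D_def)
      ultimately show "j \<in> ?N" by blast
    qed
    have "inj_on (\<lambda>u. snd (f u)) In"
    proof (rule inj_onI)
      fix x y assume xy: "x \<in> In" "y \<in> In" "snd (f x) = snd (f y)"
      then have "f x = f y" by (simp add: In_def prod_eq_iff)
      then show "x = y" using f_inj xy DV by (auto simp: In_def)
    qed
    moreover have finN: "finite ?N"
    proof -
      have "gnb (\<delta> ?w) (kind ?w) ?i \<subseteq> gadget_verts (\<delta> ?w)" by (auto simp: gnb_def)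
      then show ?thesis using finite_gadget_verts finite_subset by blast
    qed
    ultimately have cIn: "card In \<le> card ?N" using In by (metis card_inj_on_le)
    have OutD: "\<exists>e\<in>Ed. ends e = {?w, fst (f u)} \<and> ?i = att ?w e \<and> snd (f u) = att (fst (f u)) e \<and> u \<in> V \<and>
        fst (f u) \<noteq> ?w \<and> att (fst (f u)) e \<in> S (fst (f u))"
      if u: "u \<in> Out" for u
    proof -
      have u': "u \<in> D" "adj v u" "fst (f u) \<noteq> ?w" "u \<in> V" using u DV by (auto simp: Out_def)
      obtain e where "e \<in> Ed" "ends e = {?w, fst (f u)}" "?i = att ?w e" "snd (f u) = att (fst (f u)) e"
        using cross_edge[OF vV u'(4) _ u'(2)] u'(3) by metis
      then show ?thesis using u' by (auto simp: D_def)
    qed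
    show ?thesis
    proof (cases "Out = {}")
      case True
      then show ?thesis using split cIn inner[OF w vS, of "kind ?w"] by simp
    next
      case False
      then obtain u where u: "u \<in> Out" by blast
      obtain e where e: "e \<in> Ed" "ends e = {?w, fst (f u)}" "?i = att ?w e" "fst (f u) \<noteq> ?w"
        "att (fst (f u)) e \<in> S (fst (f u))" "snd (f u) = att (fst (f u)) e" "u \<in> V" using OutD[OF u] by blast
      \<comment> \<open>An edge outside \<open>M\<close> is outgoing at one end only, so it cannot
        join two chosen vertices; any outer edge inside \<open>D\<close> belongs to
        \<open>M\<close>.\<close>
      have wC: "?w \<in> C"
      proof (rule ccontr)
        assume n: "?w \<notin> C"
        have "?w \<in> ends e" "att ?w e \<in> S ?w" using e(2,3) vS by auto
        then have 1: "e \<notin> M" "tl e = ?w" using outgoing[OF e(1), of ?w] n by auto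
        have "fst (f u) \<in> ends e" using e(2) by simp
        then have "fst (f u) \<in> C \<and> e \<in> M \<or> tl e = fst (f u)" using outgoing[OF e(1) _ e(5)] by (auto split: if_splits)
        then show False using 1 e(4) by auto
      qed
      have ia: "?i \<in> attach_verts (\<delta> ?w)" using attI(2)[OF w] e(1,2,3) by blast
      have "?N = {}" by (rule inner0[OF w vS wC ia])
      then have In0: "In = {}" using cIn fins by simp
      \<comment> \<open>Distinct edges at ?w use distinct attachment vertices, so v lies on only one
        outer edge.\<close>
      have "u' = u" if u': "u' \<in> Out" for u'
      proof -
        obtain e' where e': "e' \<in> Ed" "ends e' = {?w, fst (f u')}" "?i = att ?w e'" "fst (f u') \<noteq> ?w"
          "snd (f u') = att (fst (f u')) e'" "u' \<in> V" using OutD[OF u'] by blast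
        have "e' = e" using att_inj[OF w e'(1) e(1)] e(2,3) e'(2,3) by simp
        then have "fst (f u') = fst (f u)" using e(2,4) e'(2,4) by (auto simp: doubleton_eq_iff)
        then have "f u' = f u" using e(6) e'(5) \<open>e' = e\<close> by (simp add: prod_eq_iff)
        then show ?thesis using f_inj e(7) e'(6) by blast
      qed
      then have "Out = {u}" using u by blast
      then show ?thesis using split In0 by simp
    qed
  qed
  ultimately show ?thesis by (intro exI[of _ D]) (auto simp: D_def)
qed

end

section \<open>The characterisation of equality\<close>

lemma Max_card_attained:
  fixes V :: "'a set"
  assumes "finite V" "\<And>S. Q S \<Longrightarrow> S \<subseteq> V" "Q {}"
  shows "\<exists>S. Q S \<and> card S = Max (card ` {S. Q S})" and "Q S \<Longrightarrow> card S \<le> Max (card ` {S. Q S})"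
proof -
  have "{S. Q S} \<subseteq> Pow V" using assms(2) by auto
  then have fin: "finite (card ` {S. Q S})"
    using assms(1) by (meson finite_Pow_iff finite_imageI finite_subset)
  have "Max (card ` {S. Q S}) \<in> card ` {S. Q S}" using fin assms(3) by (intro Max_in) auto
  then show "\<exists>S. Q S \<and> card S = Max (card ` {S. Q S})" by auto
  show "Q S \<Longrightarrow> card S \<le> Max (card ` {S. Q S})" using fin by (intro Max_ge) auto
qed

theorem theorem4:
  fixes V :: "'a set" and E :: "'a set set"
  assumes "simple_graph V E" and "connected_graph V E" and "cubic V E"
  shows "real (alpha V E) = 3 / 5 * real (diss V E) \<longleftrightarrow> (\<exists>k::nat. k \<ge> 1 \<and> in_Gk k V E)"
proof -
  define adj where "adj u v \<longleftrightarrow> {u, v} \<in> E" for u v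
  have finV: "finite V" and edges: "\<And>e. e \<in> E \<Longrightarrow> \<exists>u v. u \<in> V \<and> v \<in> V \<and> u \<noteq> v \<and> e = {u, v}"
    using assms(1) by (auto simp: simple_graph_def)
  interpret G: sgraph adj
  proof
    show "adj u v \<Longrightarrow> adj v u" for u v by (simp add: adj_def insert_commute)
    show "\<not> adj u u" for u using edges[of "{u}"] by (auto simp: adj_def doubleton_eq_iff)
  qed
  have nbs: "{u \<in> U. {u, v} \<in> E} = G.nb U v" for U v by (auto simp: G.nb_def adj_def insert_commute)
  interpret ccubic adj V
  proof
    show "finite V" "V \<noteq> {}" using finV assms(2) by (auto simp: connected_graph_def)
    show "card (G.nb V v) = 3" if "v \<in> V" for v
      using assms(3) that by (simp add: cubic_def degree_def nbs)
    fix X assume X: "X \<subseteq> V" "X \<noteq> {}" "\<And>w. w \<in> X \<Longrightarrow> G.nb V w \<subseteq> X"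
    obtain x where x: "x \<in> X" using X(2) by blast
    have "y \<in> X" if "(x, y) \<in> {(x, y). {x, y} \<in> E}\<^sup>*" for y
      using that
    proof (induction rule: rtrancl_induct)
      case (step y z)
      have "y \<in> V" "z \<in> V" using edges[of "{y, z}"] step(2) by (auto simp: doubleton_eq_iff)
      then have "z \<in> G.nb V y" using step(2) by (simp add: adj_def)
      then show ?case using X(3)[OF step(3)] by blast
    qed (rule x)
    then show "X = V" using X(1) x assms(2) unfolding connected_graph_def by blast
  qed
  have ind: "independent_set V E S \<longleftrightarrow> S \<subseteq> V \<and> G.indep S" for S
    by (auto simp: independent_set_def G.indep_def adj_def)
  have dis: "dissociation_set V E S \<longleftrightarrow> S \<subseteq> V \<and> (\<forall>v\<in>S. card (G.nb S v) \<le> 1)" for S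
    by (simp add: dissociation_set_def nbs)
  define a where "a = alpha V E"
  have a_ge: "card I \<le> a" if "I \<subseteq> V" "G.indep I" for I
    unfolding a_def alpha_def
    by (rule Max_card_attained(2)[OF finV]) (use that in \<open>auto simp: ind\<close>)
  obtain I where I: "I \<subseteq> V" "G.indep I" "card I = a"
  proof -
    have "\<exists>S. independent_set V E S \<and> card S = Max (card ` {S. independent_set V E S})"
      by (rule Max_card_attained(1)[OF finV]) (simp_all add: ind)
    then obtain S where "independent_set V E S" "card S = a" unfolding a_def alpha_def by blast
    then show ?thesis using that ind by blast
  qed
  have D_le: "card D \<le> diss V E" if "D \<subseteq> V" "\<And>v. v \<in> D \<Longrightarrow> card (G.nb D v) \<le> 1" for D
    unfolding diss_def
    by (rule Max_card_attained(2)[OF finV]) (use that in \<open>auto simp: dis\<close>)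
  obtain D where D: "D \<subseteq> V" "\<And>v. v \<in> D \<Longrightarrow> card (G.nb D v) \<le> 1" "card D = diss V E"
  proof -
    have "\<exists>S. dissociation_set V E S \<and> card S = Max (card ` {S. dissociation_set V E S})"
      by (rule Max_card_attained(1)[OF finV]) (simp_all add: dis)
    then obtain S where "dissociation_set V E S" "card S = diss V E" unfolding diss_def by blast
    then show ?thesis using that dis by blast
  qed
  have eq: "real (alpha V E) = 3 / 5 * real (diss V E) \<longleftrightarrow> 5 * a = 3 * card D"
  proof -
    have "real a = 3 / 5 * real n \<longleftrightarrow> real (5 * a) = real (3 * n)" for n by auto
    then show ?thesis unfolding D(3) a_def[symmetric] by (simp only: of_nat_eq_iff)
  qed
  show ?thesis
  proof
    assume "real (alpha V E) = 3 / 5 * real (diss V E)"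
    then have aD: "5 * a = 3 * card D" using eq by simp
    \<comment> \<open>Equality makes |D| a multiple of 5, so on four vertices D would be empty
      although a is positive.\<close>
    have n4: "card V \<noteq> 4"
    proof
      assume n4: "card V = 4"
      have "a \<noteq> 0"
      proof
        obtain v where "v \<in> V" using neV by blast
        then have "1 \<le> a" using a_ge[of "{v}"] by (simp add: G.indep_def)
        moreover assume "a = 0"
        ultimately show False by simp
      qed
      have "5 dvd 3 * card D" using aD by (metis dvd_triv_left)
      then have "5 dvd card D" by presburger
      moreover have "card D \<le> 4" using D(1) finV n4 by (metis card_mono)
      ultimately have "card D = 0" by presburger
      then show False using aD \<open>a \<noteq> 0\<close> by simp
    qed
    note x = five_alpha_ge(2)[OF n4 a_ge D(1,2) aD]
    obtain s where s: "card D = 5 * s"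
    proof -
      have "5 dvd 3 * card D" using aD by (metis dvd_triv_left)
      then have "5 dvd card D" by presburger
      then show ?thesis using that by (auto elim: dvdE)
    qed
    have as: "a = 3 * s" "card V = 9 * s" using aD s x by auto
    have x1: "3 * a = card V" using x by blast
    have tV: "G.tight V" unfolding G.tight_def
    proof (intro allI impI)
      fix J assume "J \<subseteq> V" "G.indep J"
      then have "card J \<le> a" by (rule a_ge)
      then show "3 * card J \<le> card V" using x1 by linarith
    qed
    \<comment> \<open>The order 9s is never 12, which disposes of the exceptional graphs.\<close>
    have "card V \<noteq> 12" using as by presburger
    then have tiled: "G.tiled V" using cubic_tight_tiled[OF tV I(1,2)] I(3) x1 by simp
    have "card (V - D) = 4 * s" using card_V_Diff[OF D(1)] s as by simp
    then have "(\<Sum>v\<in>V - D. card (G.nb (V - D) v)) = 2 * s" using x as by simp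
    then have "\<exists>k\<ge>1. in_Gk k V E"
      by (intro in_Gk_of_tiled[OF tiled D(1), of s]) (use x s as adj_def in simp_all)
    then show "\<exists>k::nat. k \<ge> 1 \<and> in_Gk k V E" by blast
  next
    assume "\<exists>k::nat. k \<ge> 1 \<and> in_Gk k V E"
    then obtain k where k: "k \<ge> 1" "in_Gk k V E" by blast
    obtain W Ed ends kind att where G: "in_Hk k W Ed ends" "valid_att W Ed ends att"
      "graph_iso V E (blowup_V W Ed ends) (blowup_E W Ed ends kind att)"
      using k(2) unfolding in_Gk_def by blast
    obtain f where f: "bij_betw f V (blowup_V W Ed ends)"
      "\<forall>u\<in>V. \<forall>v\<in>V. {u, v} \<in> E \<longleftrightarrow> {f u, f v} \<in> blowup_E W Ed ends kind att"
      using G(3) unfolding graph_iso_def by blast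
    interpret B: blown_up adj V k W Ed ends kind att f
      by unfold_locales (use G f in \<open>auto simp: adj_def\<close>)
    have n4: "card V \<noteq> 4" using B.card_V k(1) by linarith
    obtain D' where D': "D' \<subseteq> V" "card D' = 10 * k" "\<forall>v\<in>D'. card (G.nb D' v) \<le> 1"
      using B.dissociation_exists by blast
    \<comment> \<open>The bounds meet: 30k \<le> 3 |D| \<le> 5a \<le> 30k.\<close>
    have "10 * k \<le> card D" using D_le[OF D'(1)] D'(2,3) D(3) by simp
    moreover have "a \<le> 6 * k" using B.indep_bound[OF I(1,2)] I(3) by simp
    moreover have "3 * card D \<le> 5 * a" by (rule five_alpha_ge(1)[OF n4 a_ge D(1,2)])
    ultimately show "real (alpha V E) = 3 / 5 * real (diss V E)" using eq by linarith
  qed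
qed

end
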